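(* Let $p>2$ be a prime, let $n\ge 1$ be an integer, and let $D(n)$ be the Fraïssé limit of the class $\mathbb{K}(n)$. Let $\mathbb{C}(n)$ be a monster model of $\mathrm{Th}(D(n))$, and for small subsets $A,B,C$ of $\mathbb{C}(n)$ define $$A\downarrow^{0}_{B} C \quad\text{if and only if}\quad \langle A\cup B\rangle\cap\langle B\cup C\rangle=\langle B\rangle .$$ Then: (1) this relation is non-forking independence for $\mathrm{Th}(D(n))$; that is, for all small $A,B,C\subseteq\mathbb{C}(n)$, the relation holds for $A,C$ over $B$ if and only if for every finite tuple $\bar a$ from $A$ the type $\mathrm{tp}(\bar a/B\cup C)$ does not fork over $B$; (2) $\mathrm{Th}(D(n))$ is supersimple of SU-rank $1$; (3) $\mathrm{Th}(D(n))$ is not stable.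
   Context: $L(n)$ is the language of group theory together with $n$ additional constant symbols $c_1,\dots,c_n$. $\mathbb{G}(n)$ is the class of all $L(n)$-structures $G$ that are groups of nilpotency class at most 2 with $x^p=1$ for all $x$, such that $G'\subseteq\langle c_1^G,\dots,c_n^G\rangle\subseteq Z(G)$ and $c_1^G,\dots,c_n^G$ are linearly independent (an abelian group of exponent $p$ is viewed as an $\mathbb{F}_p$-vector space). Here $G'$ is the commutator subgroup and $Z(G)$ the center. $\mathbb{K}(n)$ is the class of finite structures in $\mathbb{G}(n)$. The class $\mathbb{K}(n)$ has the hereditary, joint embedding and amalgamation properties with respect to $L(n)$-embeddings, so it has a (countable) Fraïssé limit $D(n)$. For a subset $X$ of an $L(n)$-structure, $\langle X\rangle$ denotes the $L(n)$-substructure generated by $X$; in particular it always contains $\langle\emptyset\rangle=\langle c_1,\dots,c_n\rangle$. The SU-rank of the theory is the supremum of the SU-ranks of complete 1-types. *)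

theory Defs
  imports
    "HOL-Algebra.Generated_Groups"
    "HOL-Algebra.FiniteProduct"
    "HOL-Computational_Algebra.Primes"
    "HOL-Library.Extended_Nat"
    "HOL-Library.Countable_Set"
begin

unbundle cardinal_syntax

text \<open>A language is a set of function symbols with their arities; constants have arity 0 and
  equality is the only predicate.\<close>

type_synonym 'f lang = "('f \<times> nat) set"

datatype 'f trm = Var nat | Fun 'f "'f trm list"

datatype 'f fm = Eq "'f trm" "'f trm" | Neg "'f fm" | And "'f fm" "'f fm" | All nat "'f fm"

fun wf_trm :: "'f lang \<Rightarrow> 'f trm \<Rightarrow> bool" where
  "wf_trm L (Var x) \<longleftrightarrow> True"
| "wf_trm L (Fun f ts) \<longleftrightarrow> (f, length ts) \<in> L \<and> (\<forall>t\<in>set ts. wf_trm L t)"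

fun vars_trm :: "'f trm \<Rightarrow> nat set" where
  "vars_trm (Var x) = {x}"
| "vars_trm (Fun f ts) = (\<Union>t\<in>set ts. vars_trm t)"

fun wf_fm :: "'f lang \<Rightarrow> 'f fm \<Rightarrow> bool" where
  "wf_fm L (Eq s t) \<longleftrightarrow> wf_trm L s \<and> wf_trm L t"
| "wf_fm L (Neg \<phi>) \<longleftrightarrow> wf_fm L \<phi>"
| "wf_fm L (And \<phi> \<psi>) \<longleftrightarrow> wf_fm L \<phi> \<and> wf_fm L \<psi>"
| "wf_fm L (All x \<phi>) \<longleftrightarrow> wf_fm L \<phi>"

fun fv :: "'f fm \<Rightarrow> nat set" where
  "fv (Eq s t) = vars_trm s \<union> vars_trm t"
| "fv (Neg \<phi>) = fv \<phi>"
| "fv (And \<phi> \<psi>) = fv \<phi> \<union> fv \<psi>"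
| "fv (All x \<phi>) = fv \<phi> - {x}"

text \<open>The \<open>L\<close>-formulas \<open>\<phi>(x\<^sub>0,\<dots>,x\<^sub>k\<^sub>-\<^sub>1)\<close>; for \<open>k = 0\<close> these are the sentences.\<close>

definition fms :: "'f lang \<Rightarrow> nat \<Rightarrow> 'f fm set" where
  "fms L k = {\<phi>. wf_fm L \<phi> \<and> fv \<phi> \<subseteq> {..<k}}"

record ('f, 'a) struct =
  univ :: "'a set"
  fn :: "'f \<Rightarrow> 'a list \<Rightarrow> 'a"

definition is_struct :: "'f lang \<Rightarrow> ('f, 'a) struct \<Rightarrow> bool" where
  "is_struct L M \<longleftrightarrow> univ M \<noteq> {} \<and>
     (\<forall>(f, k)\<in>L. \<forall>xs. set xs \<subseteq> univ M \<and> length xs = k \<longrightarrow> fn M f xs \<in> univ M)"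

definition tuples :: "('f, 'a) struct \<Rightarrow> nat \<Rightarrow> 'a list set" where
  "tuples M k = {xs. set xs \<subseteq> univ M \<and> length xs = k}"

fun evalt :: "('f, 'a) struct \<Rightarrow> (nat \<Rightarrow> 'a) \<Rightarrow> 'f trm \<Rightarrow> 'a" where
  "evalt M e (Var x) = e x"
| "evalt M e (Fun f ts) = fn M f (map (evalt M e) ts)"

fun sat :: "('f, 'a) struct \<Rightarrow> (nat \<Rightarrow> 'a) \<Rightarrow> 'f fm \<Rightarrow> bool" where
  "sat M e (Eq s t) \<longleftrightarrow> evalt M e s = evalt M e t"
| "sat M e (Neg \<phi>) \<longleftrightarrow> \<not> sat M e \<phi>"
| "sat M e (And \<phi> \<psi>) \<longleftrightarrow> sat M e \<phi> \<and> sat M e \<psi>"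
| "sat M e (All x \<phi>) \<longleftrightarrow> (\<forall>a\<in>univ M. sat M (e(x := a)) \<phi>)"

text \<open>\<open>M \<Turnstile> \<phi>(a\<^sub>0,\<dots>,a\<^sub>k\<^sub>-\<^sub>1)\<close>. Only used for \<open>\<phi> \<in> fms L k\<close> with \<open>k = length as\<close>, so the
  values of \<open>(!) as\<close> beyond the end of the list play no role.\<close>

definition holds :: "('f, 'a) struct \<Rightarrow> 'f fm \<Rightarrow> 'a list \<Rightarrow> bool" where
  "holds M \<phi> as = sat M ((!) as) \<phi>"

definition Th :: "'f lang \<Rightarrow> ('f, 'a) struct \<Rightarrow> 'f fm set" where
  "Th L M = {\<phi> \<in> fms L 0. holds M \<phi> []}"

definition model :: "'f lang \<Rightarrow> 'f fm set \<Rightarrow> ('f, 'a) struct \<Rightarrow> bool" where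
  "model L T M \<longleftrightarrow> is_struct L M \<and> (\<forall>\<phi>\<in>T. holds M \<phi> [])"

inductive_set gen :: "'f lang \<Rightarrow> ('f, 'a) struct \<Rightarrow> 'a set \<Rightarrow> 'a set"
  for L :: "'f lang" and M :: "('f, 'a) struct" and X :: "'a set" where
  base: "x \<in> X \<Longrightarrow> x \<in> gen L M X"
| step: "(f, length xs) \<in> L \<Longrightarrow> (\<forall>x\<in>set xs. x \<in> gen L M X) \<Longrightarrow> fn M f xs \<in> gen L M X"

definition embedding ::
  "'f lang \<Rightarrow> ('f, 'a) struct \<Rightarrow> ('f, 'b) struct \<Rightarrow> ('a \<Rightarrow> 'b) \<Rightarrow> bool" where
  "embedding L M N h \<longleftrightarrow> h ` univ M \<subseteq> univ N \<and> inj_on h (univ M) \<and>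
     (\<forall>(f, k)\<in>L. \<forall>xs\<in>tuples M k. h (fn M f xs) = fn N f (map h xs))"

definition isomorphism ::
  "'f lang \<Rightarrow> ('f, 'a) struct \<Rightarrow> ('f, 'b) struct \<Rightarrow> ('a \<Rightarrow> 'b) \<Rightarrow> bool" where
  "isomorphism L M N h \<longleftrightarrow> embedding L M N h \<and> h ` univ M = univ N"

definition ultrahomogeneous :: "'f lang \<Rightarrow> ('f, 'a) struct \<Rightarrow> bool" where
  "ultrahomogeneous L M \<longleftrightarrow>
     (\<forall>X Y h. finite X \<and> X \<subseteq> univ M \<and> finite Y \<and> Y \<subseteq> univ M \<and>
        isomorphism L (M\<lparr>univ := gen L M X\<rparr>) (M\<lparr>univ := gen L M Y\<rparr>) h \<longrightarrow>
        (\<exists>g. isomorphism L M M g \<and> (\<forall>x\<in>gen L M X. g x = h x)))"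

text \<open>The class \<open>K\<close> is a class of finitely generated structures closed under isomorphism. It is
  given by its members whose universe is a set of natural numbers; when \<open>L\<close> is countable, every
  member of the class has such a copy. The conditions on \<open>X\<close> and on \<open>A\<close> say that the
  age of \<open>D\<close> is \<open>K\<close>.\<close>

definition fraisse_limit ::
  "'f lang \<Rightarrow> ('f, nat) struct set \<Rightarrow> ('f, 'd) struct \<Rightarrow> bool" where
  "fraisse_limit L K D \<longleftrightarrow> is_struct L D \<and> countable (univ D) \<and>
     (\<forall>X. finite X \<and> X \<subseteq> univ D \<longrightarrow>
        (\<exists>A\<in>K. \<exists>h. isomorphism L A (D\<lparr>univ := gen L D X\<rparr>) h)) \<and>
     (\<forall>A\<in>K. \<exists>h. embedding L A D h) \<and>
     ultrahomogeneous L D"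

text \<open>A formula \<open>\<phi>(x\<^sub>0,\<dots>,x\<^sub>k\<^sub>-\<^sub>1; b)\<close> with parameters is a pair \<open>(\<phi>, b)\<close>, where the parameter
  tuple \<open>b\<close> is substituted for the variables from \<open>x\<^sub>k\<close> on.\<close>

type_synonym ('f, 'a) pfm = "'f fm \<times> 'a list"

definition pfms :: "'f lang \<Rightarrow> nat \<Rightarrow> 'a set \<Rightarrow> ('f, 'a) pfm set" where
  "pfms L k B = {(\<phi>, b). set b \<subseteq> B \<and> \<phi> \<in> fms L (k + length b)}"

definition pholds :: "('f, 'a) struct \<Rightarrow> 'a list \<Rightarrow> ('f, 'a) pfm \<Rightarrow> bool" where
  "pholds M a \<theta> = holds M (fst \<theta>) (a @ snd \<theta>)"

definition tp :: "'f lang \<Rightarrow> ('f, 'a) struct \<Rightarrow> 'a set \<Rightarrow> 'a list \<Rightarrow> ('f, 'a) pfm set" where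
  "tp L M B a = {\<theta> \<in> pfms L (length a) B. pholds M a \<theta>}"

text \<open>The space of complete \<open>k\<close>-types over \<open>B\<close>: sets of formulas over \<open>B\<close> that are
  consistent with the elementary diagram of \<open>M\<close>, that is finitely satisfiable in \<open>M\<close>, and complete.\<close>

definition complete_types ::
  "'f lang \<Rightarrow> ('f, 'a) struct \<Rightarrow> nat \<Rightarrow> 'a set \<Rightarrow> ('f, 'a) pfm set set" where
  "complete_types L M k B = {p. p \<subseteq> pfms L k B \<and>
     (\<forall>q. finite q \<and> q \<subseteq> p \<longrightarrow> (\<exists>a\<in>tuples M k. \<forall>\<theta>\<in>q. pholds M a \<theta>)) \<and>
     (\<forall>(\<phi>, b)\<in>pfms L k B. (\<phi>, b) \<in> p \<or> (Neg \<phi>, b) \<in> p)}"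

definition small :: "'k rel \<Rightarrow> ('f, 'a) struct \<Rightarrow> 'a set \<Rightarrow> bool" where
  "small \<kappa> M A \<longleftrightarrow> A \<subseteq> univ M \<and> |A| <o \<kappa>"

definition saturated :: "'f lang \<Rightarrow> 'k rel \<Rightarrow> ('f, 'a) struct \<Rightarrow> bool" where
  "saturated L \<kappa> M \<longleftrightarrow>
     (\<forall>A p. small \<kappa> M A \<and> p \<in> complete_types L M 1 A \<longrightarrow>
        (\<exists>a\<in>tuples M 1. \<forall>\<theta>\<in>p. pholds M a \<theta>))"

definition elementary_on ::
  "'f lang \<Rightarrow> ('f, 'a) struct \<Rightarrow> 'a set \<Rightarrow> ('a \<Rightarrow> 'a) \<Rightarrow> bool" where
  "elementary_on L M A h \<longleftrightarrow> h ` A \<subseteq> univ M \<and>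
     (\<forall>as \<phi>. set as \<subseteq> A \<and> \<phi> \<in> fms L (length as) \<longrightarrow>
        (holds M \<phi> as \<longleftrightarrow> holds M \<phi> (map h as)))"

definition strongly_homogeneous :: "'f lang \<Rightarrow> 'k rel \<Rightarrow> ('f, 'a) struct \<Rightarrow> bool" where
  "strongly_homogeneous L \<kappa> M \<longleftrightarrow>
     (\<forall>A h. small \<kappa> M A \<and> elementary_on L M A h \<longrightarrow>
        (\<exists>g. isomorphism L M M g \<and> (\<forall>x\<in>A. g x = h x)))"

text \<open>A monster model of \<open>T\<close> is a \<open>\<kappa>\<close>-saturated and strongly \<open>\<kappa>\<close>-homogeneous model, for a
  cardinal \<open>\<kappa>\<close> greater than \<open>|L| + \<aleph>\<^sub>0\<close>; the small sets are those of cardinality less than \<open>\<kappa>\<close>.\<close>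

definition monster :: "'f lang \<Rightarrow> 'f fm set \<Rightarrow> 'k rel \<Rightarrow> ('f, 'a) struct \<Rightarrow> bool" where
  "monster L T \<kappa> M \<longleftrightarrow> Card_order \<kappa> \<and> natLeq <o \<kappa> \<and> |L| <o \<kappa> \<and>
     model L T M \<and> saturated L \<kappa> M \<and> strongly_homogeneous L \<kappa> M"

text \<open>Dividing, forking, supersimplicity, SU-rank and stability of a complete theory are evaluated in
  a monster model \<open>M\<close> of it; \<open>k\<close> is the number of free variables of the formulas and types.
  In \<open>divides\<close>, the family \<open>\<phi>(x, b i)\<close>, indexed by \<open>i\<close>, is \<open>m\<close>-inconsistent; the case \<open>m = 0\<close>
  never occurs, because the empty set of formulas is consistent.\<close>

definition divides ::
  "'f lang \<Rightarrow> ('f, 'a) struct \<Rightarrow> nat \<Rightarrow> ('f, 'a) pfm \<Rightarrow> 'a set \<Rightarrow> bool" where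
  "divides L M k \<theta> A \<longleftrightarrow> (\<exists>(b :: nat \<Rightarrow> 'a list) m.
     (\<forall>i. b i \<in> tuples M (length (snd \<theta>)) \<and> tp L M A (b i) = tp L M A (snd \<theta>)) \<and>
     (\<forall>I. finite I \<and> card I = m \<longrightarrow>
        \<not> (\<exists>a\<in>tuples M k. \<forall>i\<in>I. pholds M a (fst \<theta>, b i))))"

text \<open>A set \<open>p\<close> of formulas forks over \<open>A\<close> if it implies a finite disjunction of formulas, with
  parameters anywhere in \<open>M\<close>, each of which divides over \<open>A\<close>. By compactness, implication
  (modulo the elementary diagram of \<open>M\<close>) means implication in \<open>M\<close> by a finite part of \<open>p\<close>.\<close>

definition forks ::
  "'f lang \<Rightarrow> ('f, 'a) struct \<Rightarrow> nat \<Rightarrow> ('f, 'a) pfm set \<Rightarrow> 'a set \<Rightarrow> bool" where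
  "forks L M k p A \<longleftrightarrow> (\<exists>p0 D. finite p0 \<and> p0 \<subseteq> p \<and> finite D \<and> D \<subseteq> pfms L k (univ M) \<and>
     (\<forall>\<theta>\<in>D. divides L M k \<theta> A) \<and>
     (\<forall>a\<in>tuples M k. (\<forall>\<theta>\<in>p0. pholds M a \<theta>) \<longrightarrow> (\<exists>\<theta>\<in>D. pholds M a \<theta>)))"

definition supersimple :: "'f lang \<Rightarrow> 'k rel \<Rightarrow> ('f, 'a) struct \<Rightarrow> bool" where
  "supersimple L \<kappa> M \<longleftrightarrow>
     (\<forall>k B p. small \<kappa> M B \<and> p \<in> complete_types L M k B \<longrightarrow>
        (\<exists>B0. finite B0 \<and> B0 \<subseteq> B \<and> \<not> forks L M k p B0))"

text \<open>\<open>SU_ge L \<kappa> M k j B p\<close> is \<open>SU(p) \<ge> j\<close> for a complete \<open>k\<close>-type \<open>p\<close> over \<open>B\<close> and a finite ordinal \<open>j\<close>.\<close>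

fun SU_ge ::
  "'f lang \<Rightarrow> 'k rel \<Rightarrow> ('f, 'a) struct \<Rightarrow> nat \<Rightarrow> nat \<Rightarrow> 'a set \<Rightarrow> ('f, 'a) pfm set \<Rightarrow> bool" where
  "SU_ge L \<kappa> M k 0 B p \<longleftrightarrow> True"
| "SU_ge L \<kappa> M k (Suc j) B p \<longleftrightarrow>
     (\<exists>C q. small \<kappa> M C \<and> B \<subseteq> C \<and> q \<in> complete_types L M k C \<and> p \<subseteq> q \<and>
        forks L M k q B \<and> SU_ge L \<kappa> M k j C q)"

text \<open>The SU-rank is ordinal valued; here all infinite values, as well as the value
  "unranked", are identified with \<open>\<infinity>\<close>.\<close>

definition SU ::
  "'f lang \<Rightarrow> 'k rel \<Rightarrow> ('f, 'a) struct \<Rightarrow> nat \<Rightarrow> 'a set \<Rightarrow> ('f, 'a) pfm set \<Rightarrow> enat" where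
  "SU L \<kappa> M k B p = Sup {enat j | j. SU_ge L \<kappa> M k j B p}"

definition SU_rank :: "'f lang \<Rightarrow> 'k rel \<Rightarrow> ('f, 'a) struct \<Rightarrow> enat" where
  "SU_rank L \<kappa> M = Sup {SU L \<kappa> M 1 B p | B p. small \<kappa> M B \<and> p \<in> complete_types L M 1 B}"

definition order_property ::
  "'f lang \<Rightarrow> ('f, 'a) struct \<Rightarrow> nat \<Rightarrow> nat \<Rightarrow> 'f fm \<Rightarrow> bool" where
  "order_property L M k l \<phi> \<longleftrightarrow> (\<exists>a b :: nat \<Rightarrow> 'a list.
     (\<forall>i. a i \<in> tuples M k \<and> b i \<in> tuples M l) \<and>
     (\<forall>i j. holds M \<phi> (a i @ b j) \<longleftrightarrow> i < j))"

definition stable :: "'f lang \<Rightarrow> ('f, 'a) struct \<Rightarrow> bool" where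
  "stable L M \<longleftrightarrow> \<not> (\<exists>k l. \<exists>\<phi>\<in>fms L (k + l). order_property L M k l \<phi>)"

datatype gsym = One | Inv | Mul | Cst nat

definition Lg :: "nat \<Rightarrow> gsym lang" where
  "Lg n = {(One, 0), (Inv, 1), (Mul, 2)} \<union> {(Cst i, 0) | i. i \<in> {1..n}}"

definition grp :: "(gsym, 'a) struct \<Rightarrow> 'a monoid" where
  "grp M = \<lparr>carrier = univ M, monoid.mult = (\<lambda>x y. fn M Mul [x, y]), one = fn M One []\<rparr>"

definition cst :: "(gsym, 'a) struct \<Rightarrow> nat \<Rightarrow> 'a" where
  "cst M i = fn M (Cst i) []"

definition center :: "('a, 'm) monoid_scheme \<Rightarrow> 'a set" where
  "center G = {z \<in> carrier G. \<forall>x\<in>carrier G. z \<otimes>\<^bsub>G\<^esub> x = x \<otimes>\<^bsub>G\<^esub> z}"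

text \<open>Linear independence over \<open>\<F>\<^sub>p\<close> of a finite family in the center \<open>Z(G)\<close>, where \<open>G\<close> is of exponent \<open>p\<close>;
  linear combinations are written multiplicatively and scalars are represented by integers.\<close>

definition lin_indep ::
  "nat \<Rightarrow> ('a, 'm) monoid_scheme \<Rightarrow> 'i set \<Rightarrow> ('i \<Rightarrow> 'a) \<Rightarrow> bool" where
  "lin_indep p G I c \<longleftrightarrow>
     (\<forall>r :: 'i \<Rightarrow> int. finprod (G\<lparr>carrier := center G\<rparr>) (\<lambda>i. c i [^]\<^bsub>G\<^esub> r i) I = \<one>\<^bsub>G\<^esub> \<longrightarrow>
        (\<forall>i\<in>I. int p dvd r i))"

text \<open>The conjunct \<open>derived G (carrier G) \<subseteq> center G\<close> says that the nilpotency class is at most 2.\<close>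

definition in_G :: "nat \<Rightarrow> nat \<Rightarrow> (gsym, 'a) struct \<Rightarrow> bool" where
  "in_G p n M \<longleftrightarrow> is_struct (Lg n) M \<and>
     (let G = grp M; C = generate G (cst M ` {1..n}) in
        group G \<and> (\<forall>x\<in>carrier G. fn M Inv [x] = inv\<^bsub>G\<^esub> x) \<and>
        derived G (carrier G) \<subseteq> center G \<and>
        (\<forall>x\<in>carrier G. x [^]\<^bsub>G\<^esub> p = \<one>\<^bsub>G\<^esub>) \<and>
        derived G (carrier G) \<subseteq> C \<and> C \<subseteq> center G \<and>
        lin_indep p G {1..n} (cst M))"

definition K_class :: "nat \<Rightarrow> nat \<Rightarrow> (gsym, nat) struct set" where
  "K_class p n = {A. in_G p n A \<and> finite (univ A)}"

definition indep0 ::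
  "'f lang \<Rightarrow> ('f, 'a) struct \<Rightarrow> 'a set \<Rightarrow> 'a set \<Rightarrow> 'a set \<Rightarrow> bool" where
  "indep0 L M A B C \<longleftrightarrow> gen L M (A \<union> B) \<inter> gen L M (B \<union> C) = gen L M B"

end

theory Submission
  imports Defs
begin

text \<open>Modulo the constants, a structure in the class is an \<open>F\<^sub>p\<close>-vector space with an alternating bilinear
  map, the commutator, into \<open>\<langle>c\<^sub>1, \<dots>, c\<^sub>n\<rangle>\<close>. A new element over a substructure \<open>A\<close> is therefore
  determined by a homomorphism \<open>A \<rightarrow> \<langle>c\<^sub>1, \<dots>, c\<^sub>n\<rangle>\<close> that is trivial on the constants, and the
  Fraisse limit realizes every such homomorphism on a finite substructure. This is expressed by
  first-order sentences, so it passes to the monster model, where a back-and-forth argument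
  yields that isomorphisms of finite substructures are elementary, and saturation realizes
  homomorphisms on small sets.

  If \<open>a\<close> is independent from \<open>e\<close> over \<open>B\<close> and \<open>e\<^sub>0, e\<^sub>1, \<dots>\<close> have the same type over \<open>B\<close> as \<open>e\<close>, then along
  a suitable subsequence the substructures \<open>\<langle>B, e\<^sub>i\<rangle>\<close> are so disjoint that the homomorphisms prescribed by
  \<open>a\<close> on all of them amalgamate; hence no formula satisfied by \<open>(a, e)\<close> divides over \<open>B\<close>. Conversely, an
  element \<open>d \<notin> \<langle>B\<rangle>\<close> has infinitely many conjugates over \<open>B\<close>, so \<open>t(x, b) = d\<close> divides over \<open>B\<close>.
  Instability is witnessed by a sequence with \<open>[e\<^sub>i, e\<^sub>j] = c\<^sub>1\<close> for \<open>i < j\<close>.\<close>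

section \<open>First-order logic\<close>

text \<open>Finitely generated substructures are finite, with elements of the form
  \<open>a \<otimes> y [^] k\<close>. Hence the extension property is first-order, and lying outside
  such a substructure is a finite conjunction of inequations.

  Dividing is witnessed by arbitrary sequences of constant type over \<open>B\<close>, not by
  indiscernible ones, and the homomorphisms prescribed along such a sequence may clash where the
  substructures overlap. Inconsistency of all \<open>m\<close>-element subfamilies is refuted by any
  infinite subfamily with a common solution, which is why thinning out the sequence is allowed.

  Forking asks for more than dividing: a finite part of the type has to be realized outside finitely
  many dividing formulas at once. A realization that is independent from all their parameters
  together does this, so dividing and forking are handled in one step.

  That \<open>p\<close> is odd enters twice: the one-point extension has exponent \<open>p\<close>
  because \<open>p\<close> divides \<open>p choose 2\<close>, and \<open>[x, y] = c\<close> excludes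
  \<open>[y, x] = c\<close> because \<open>c \<otimes> c\<close> is not the identity.\<close>

lemma evalt_cong:
  "(\<And>x. x \<in> vars_trm t \<Longrightarrow> e x = e' x) \<Longrightarrow> evalt M e t = evalt M e' t"
proof (induction t)
  case (Fun f ts)
  then have *: "map (evalt M e) ts = map (evalt M e') ts" by auto
  show ?case by (simp only: evalt.simps *)
qed simp

lemma sat_cong: "(\<And>x. x \<in> fv \<phi> \<Longrightarrow> e x = e' x) \<Longrightarrow> sat M e \<phi> = sat M e' \<phi>"
proof (induction \<phi> arbitrary: e e')
  case (Eq s t)
  then have "evalt M e s = evalt M e' s" "evalt M e t = evalt M e' t"
    by (auto intro: evalt_cong)
  then show ?case by simp
next
  case (Neg \<phi>)
  have "sat M e \<phi> = sat M e' \<phi>" by (rule Neg.IH) (use Neg.prems in auto)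
  then show ?case by simp
next
  case (And \<phi> \<psi>)
  have "sat M e \<phi> = sat M e' \<phi>" by (rule And.IH) (use And.prems in auto)
  moreover have "sat M e \<psi> = sat M e' \<psi>" by (rule And.IH) (use And.prems in auto)
  ultimately show ?case by simp
next
  case (All x \<phi>)
  have "sat M (e(x := a)) \<phi> = sat M (e'(x := a)) \<phi>" for a
    by (rule All.IH) (use All.prems in auto)
  then show ?case by simp
qed

lemma finite_vars_trm: "finite (vars_trm t)"
  by (induction t) auto

lemma finite_fv: "finite (fv \<phi>)"
  by (induction \<phi>) (auto simp: finite_vars_trm)

section \<open>Derived connectives and quantifier-free formulas\<close>

definition ExF :: "nat \<Rightarrow> 'f fm \<Rightarrow> 'f fm" where
  "ExF x \<phi> = Neg (All x (Neg \<phi>))"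

definition Imp :: "'f fm \<Rightarrow> 'f fm \<Rightarrow> 'f fm" where
  "Imp \<phi> \<psi> = Neg (And \<phi> (Neg \<psi>))"

fun Conj :: "'f fm list \<Rightarrow> 'f fm" where
  "Conj [] = Eq (Var 0) (Var 0)"
| "Conj (\<phi> # \<phi>s) = And \<phi> (Conj \<phi>s)"

definition Disj :: "'f fm list \<Rightarrow> 'f fm" where
  "Disj \<phi>s = Neg (Conj (map Neg \<phi>s))"

lemma sat_ExF [simp]: "sat M e (ExF x \<phi>) \<longleftrightarrow> (\<exists>a\<in>univ M. sat M (e(x := a)) \<phi>)"
  by (simp add: ExF_def)

lemma sat_Imp [simp]: "sat M e (Imp \<phi> \<psi>) \<longleftrightarrow> (sat M e \<phi> \<longrightarrow> sat M e \<psi>)"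
  by (simp add: Imp_def)

lemma sat_Conj [simp]: "sat M e (Conj \<phi>s) \<longleftrightarrow> (\<forall>\<phi>\<in>set \<phi>s. sat M e \<phi>)"
  by (induction \<phi>s) auto

lemma sat_Disj [simp]: "sat M e (Disj \<phi>s) \<longleftrightarrow> (\<exists>\<phi>\<in>set \<phi>s. sat M e \<phi>)"
  by (simp add: Disj_def)

lemma wf_ExF [simp]: "wf_fm L (ExF x \<phi>) \<longleftrightarrow> wf_fm L \<phi>"
  by (simp add: ExF_def)

lemma wf_Imp [simp]: "wf_fm L (Imp \<phi> \<psi>) \<longleftrightarrow> wf_fm L \<phi> \<and> wf_fm L \<psi>"
  by (simp add: Imp_def)

lemma wf_Conj [simp]: "wf_fm L (Conj \<phi>s) \<longleftrightarrow> (\<forall>\<phi>\<in>set \<phi>s. wf_fm L \<phi>)"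
  by (induction \<phi>s) auto

lemma wf_Disj [simp]: "wf_fm L (Disj \<phi>s) \<longleftrightarrow> (\<forall>\<phi>\<in>set \<phi>s. wf_fm L \<phi>)"
  by (simp add: Disj_def)

fun qf :: "'f fm \<Rightarrow> bool" where
  "qf (Eq s t) \<longleftrightarrow> True"
| "qf (Neg \<phi>) \<longleftrightarrow> qf \<phi>"
| "qf (And \<phi> \<psi>) \<longleftrightarrow> qf \<phi> \<and> qf \<psi>"
| "qf (All x \<phi>) \<longleftrightarrow> False"

lemma qf_Conj [simp]: "qf (Conj \<phi>s) \<longleftrightarrow> (\<forall>\<phi>\<in>set \<phi>s. qf \<phi>)"
  by (induction \<phi>s) auto

lemma qf_Disj [simp]: "qf (Disj \<phi>s) \<longleftrightarrow> (\<forall>\<phi>\<in>set \<phi>s. qf \<phi>)"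
  by (simp add: Disj_def)

subsection \<open>Valid formulas and their transfer\<close>

text \<open>Axioms are written as open formulas and read as universally closed, so that their bodies
  can stay quantifier-free.\<close>

definition valid :: "('f, 'a) struct \<Rightarrow> 'f fm \<Rightarrow> bool" where
  "valid M \<phi> \<longleftrightarrow> (\<forall>e. range e \<subseteq> univ M \<longrightarrow> sat M e \<phi>)"

lemma valid_All: "valid M (All x \<phi>) \<longleftrightarrow> valid M \<phi>"
proof
  assume v: "valid M (All x \<phi>)"
  show "valid M \<phi>"
    unfolding valid_def
  proof (intro allI impI)
    fix e :: "nat \<Rightarrow> 'b" assume "range e \<subseteq> univ M"
    with v have "sat M (e(x := e x)) \<phi>" unfolding valid_def sat.simps by blast
    then show "sat M e \<phi>" by simp
  qed
next
  assume v: "valid M \<phi>"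
  have *: "range (e(x := a)) \<subseteq> univ M" if "range e \<subseteq> univ M" "a \<in> univ M" for e :: "nat \<Rightarrow> 'b" and a
    using that by (auto split: if_splits)
  show "valid M (All x \<phi>)"
    unfolding valid_def sat.simps using v * by (auto simp only: valid_def)
qed

fun alls :: "nat \<Rightarrow> 'f fm \<Rightarrow> 'f fm" where
  "alls 0 \<phi> = \<phi>"
| "alls (Suc k) \<phi> = alls k (All k \<phi>)"

lemma valid_alls: "valid M (alls k \<phi>) \<longleftrightarrow> valid M \<phi>"
  by (induction k arbitrary: \<phi>) (auto simp: valid_All)

lemma fv_alls: "fv (alls k \<phi>) = fv \<phi> - {..<k}"
  by (induction k arbitrary: \<phi>) auto

lemma wf_alls: "wf_fm L (alls k \<phi>) \<longleftrightarrow> wf_fm L \<phi>"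
  by (induction k arbitrary: \<phi>) auto

lemma valid_sentence:
  assumes "fv \<phi> = {}" "univ M \<noteq> {}"
  shows "valid M \<phi> \<longleftrightarrow> holds M \<phi> []"
proof -
  obtain a where "a \<in> univ M" using assms by blast
  then have "range (\<lambda>_::nat. a) \<subseteq> univ M" by auto
  moreover have "sat M e \<phi> \<longleftrightarrow> holds M \<phi> []" for e
    unfolding holds_def using assms by (intro sat_cong) auto
  ultimately show ?thesis unfolding valid_def by blast
qed

text \<open>The universal closure of a formula valid in \<open>D\<close> is a sentence of
  \<open>Th L D\<close>. This is the channel through which information passes from the Fraisse limit
  to the monster model.\<close>

lemma valid_transfer:
  assumes "is_struct L D" "model L (Th L D) M" "wf_fm L \<phi>" "valid D \<phi>"
  shows "valid M \<phi>"
proof -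
  obtain k where k: "fv \<phi> \<subseteq> {..<k}" using finite_nat_iff_bounded[of "fv \<phi>"] finite_fv by auto
  then have fv: "fv (alls k \<phi>) = {}" by (auto simp: fv_alls)
  have "alls k \<phi> \<in> Th L D"
    using assms(1,3,4) fv valid_alls valid_sentence[OF fv]
    by (fastforce simp: Th_def fms_def wf_alls is_struct_def)
  then have "holds M (alls k \<phi>) []" using assms(2) by (simp add: model_def)
  then show ?thesis
    using valid_sentence[OF fv, of M] assms(2) by (auto simp: valid_alls model_def is_struct_def)
qed

section \<open>Isomorphisms and change of universe\<close>

lemma fn_closed:
  "is_struct L M \<Longrightarrow> (f, length xs) \<in> L \<Longrightarrow> set xs \<subseteq> univ M \<Longrightarrow> fn M f xs \<in> univ M"
  by (auto simp: is_struct_def)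

lemma evalt_closed:
  "is_struct L M \<Longrightarrow> wf_trm L t \<Longrightarrow> (\<And>x. x \<in> vars_trm t \<Longrightarrow> e x \<in> univ M) \<Longrightarrow> evalt M e t \<in> univ M"
proof (induction t)
  case (Fun f ts)
  then have "set (map (evalt M e) ts) \<subseteq> univ M" by force
  with Fun.prems show ?case using fn_closed[of L M f "map (evalt M e) ts"] by simp
qed simp

lemma evalt_isomorphism:
  assumes "isomorphism L M N h" "is_struct L M" "range e \<subseteq> univ M"
  shows "wf_trm L t \<Longrightarrow> evalt N (h \<circ> e) t = h (evalt M e t)"
proof (induction t)
  case (Fun f ts)
  have "set (map (evalt M e) ts) \<subseteq> univ M"
    using assms Fun.prems by (auto intro!: evalt_closed)
  then have "map (evalt M e) ts \<in> tuples M (length ts)" by (auto simp: tuples_def)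
  then have "h (fn M f (map (evalt M e) ts)) = fn N f (map h (map (evalt M e) ts))"
    using assms(1) Fun.prems unfolding isomorphism_def embedding_def by fastforce
  moreover have "map h (map (evalt M e) ts) = map (evalt N (h \<circ> e)) ts"
    using Fun by (auto simp del: comp_apply simp: comp_apply[of h "evalt M e"])
  ultimately show ?case by (simp only: evalt.simps)
qed simp

lemma sat_isomorphism:
  assumes "isomorphism L M N h" "is_struct L M"
  shows "wf_fm L \<phi> \<Longrightarrow> range e \<subseteq> univ M \<Longrightarrow> sat N (h \<circ> e) \<phi> \<longleftrightarrow> sat M e \<phi>"
proof (induction \<phi> arbitrary: e)
  case (Eq s t)
  have "inj_on h (univ M)" using assms by (auto simp: isomorphism_def embedding_def)
  moreover have "evalt M e s \<in> univ M" "evalt M e t \<in> univ M"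
    using Eq assms by (auto intro!: evalt_closed)
  ultimately show ?case
    using Eq assms by (simp add: evalt_isomorphism[OF assms] inj_on_eq_iff del: comp_apply)
next
  case (All x \<phi>)
  have "sat N ((h \<circ> e)(x := h a)) \<phi> \<longleftrightarrow> sat M (e(x := a)) \<phi>" if "a \<in> univ M" for a
  proof -
    have "(h \<circ> e)(x := h a) = h \<circ> e(x := a)" by auto
    moreover have "range (e(x := a)) \<subseteq> univ M" using All.prems that by auto
    ultimately show ?thesis using All.IH[of "e(x := a)"] All.prems by (simp del: comp_apply fun_upd_apply)
  qed
  moreover have "univ N = h ` univ M" using assms by (auto simp: isomorphism_def)
  ultimately show ?case by (simp del: comp_apply fun_upd_apply)
qed auto

lemma valid_isomorphism:
  assumes "isomorphism L M N h" "is_struct L M" "wf_fm L \<phi>" "valid M \<phi>"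
  shows "valid N \<phi>"
  unfolding valid_def
proof (intro allI impI)
  fix e :: "nat \<Rightarrow> 'c" assume e: "range e \<subseteq> univ N"
  have N: "univ N = h ` univ M" using assms by (auto simp: isomorphism_def)
  define e' where "e' = inv_into (univ M) h \<circ> e"
  have "e = h \<circ> e'" using e by (auto simp: e'_def N f_inv_into_f fun_eq_iff subset_iff)
  moreover have "range e' \<subseteq> univ M"
    using e by (auto simp: e'_def N intro!: inv_into_into)
  ultimately show "sat N e \<phi>"
    using sat_isomorphism[OF assms(1-3), of e'] assms(4) by (simp add: valid_def)
qed

lemma evalt_univ_update [simp]: "evalt (M\<lparr>univ := S\<rparr>) e t = evalt M e t"
proof (induction t)
  case (Fun f ts)
  then have *: "map (evalt (M\<lparr>univ := S\<rparr>) e) ts = map (evalt M e) ts" by auto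
  show ?case by (simp only: evalt.simps *) simp
qed simp

lemma sat_univ_update: "qf \<phi> \<Longrightarrow> sat (M\<lparr>univ := S\<rparr>) e \<phi> \<longleftrightarrow> sat M e \<phi>"
  by (induction \<phi>) auto

lemma is_struct_isomorphism:
  assumes "isomorphism L M N h" "is_struct L M"
  shows "is_struct L N"
  unfolding is_struct_def
proof (intro conjI ballI)
  have N: "univ N = h ` univ M" using assms by (auto simp: isomorphism_def)
  show "univ N \<noteq> {}" using assms by (auto simp: N is_struct_def)
  have "\<forall>xs. set xs \<subseteq> univ N \<and> length xs = k \<longrightarrow> fn N f xs \<in> univ N" if fk: "(f, k) \<in> L" for f k
  proof (intro allI impI)
    fix xs assume xs: "set xs \<subseteq> univ N \<and> length xs = k"
    define ys where "ys = map (inv_into (univ M) h) xs"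
    have "xs = map h ys" using xs by (auto simp: ys_def N f_inv_into_f map_idI subset_iff)
    moreover have ys: "ys \<in> tuples M k"
      using xs by (auto simp: ys_def tuples_def N intro!: inv_into_into)
    ultimately have "h (fn M f ys) = fn N f xs"
      using assms(1) fk unfolding isomorphism_def embedding_def by fastforce
    moreover have "fn M f ys \<in> univ M"
      using ys fk assms(2) by (auto simp: tuples_def intro!: fn_closed)
    ultimately show "fn N f xs \<in> univ N" unfolding N by (metis imageI)
  qed
  then show "case x of (f, k) \<Rightarrow> \<forall>xs. set xs \<subseteq> univ N \<and> length xs = k \<longrightarrow> fn N f xs \<in> univ N"
    if "x \<in> L" for x using that by auto
qed

subsection \<open>Generated substructures\<close>

lemma gen_subset: "is_struct L M \<Longrightarrow> X \<subseteq> univ M \<Longrightarrow> gen L M X \<subseteq> univ M"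
proof
  fix x assume a: "is_struct L M" "X \<subseteq> univ M" "x \<in> gen L M X"
  from a(3) show "x \<in> univ M"
    by induction (use a(1,2) in \<open>auto intro!: fn_closed\<close>)
qed

lemma gen_least:
  assumes "X \<subseteq> A" "\<And>f xs. (f, length xs) \<in> L \<Longrightarrow> set xs \<subseteq> A \<Longrightarrow> fn M f xs \<in> A"
  shows "gen L M X \<subseteq> A"
proof
  fix x assume "x \<in> gen L M X"
  then show "x \<in> A" by induction (use assms in \<open>auto simp: subset_iff\<close>)
qed

lemma gen_incl: "X \<subseteq> gen L M X"
  by (auto intro: gen.base)

lemma gen_fn_closed: "(f, length xs) \<in> L \<Longrightarrow> set xs \<subseteq> gen L M X \<Longrightarrow> fn M f xs \<in> gen L M X"
  by (rule gen.step) auto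

lemma gen_mono: "X \<subseteq> Y \<Longrightarrow> gen L M X \<subseteq> gen L M Y"
  by (rule gen_least) (auto intro: gen.base gen_fn_closed)

lemma gen_idem [simp]: "gen L M (gen L M X) = gen L M X"
  by (intro equalityI gen_incl gen_least) (auto intro: gen_fn_closed)

lemma evalt_in_gen:
  "wf_trm L t \<Longrightarrow> e ` vars_trm t \<subseteq> X \<Longrightarrow> evalt M e t \<in> gen L M X"
proof (induction t)
  case (Fun f ts)
  then have "set (map (evalt M e) ts) \<subseteq> gen L M X" by fastforce
  with Fun.prems show ?case
    using gen_fn_closed[of f "map (evalt M e) ts" L M X] by simp
qed (auto intro: gen.base)

text \<open>Term representation is what turns membership in a substructure into equations.\<close>

lemma gen_term:
  assumes "x \<in> gen L M (e ` V)"
  obtains t where "wf_trm L t" "vars_trm t \<subseteq> V" "x = evalt M e t"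
proof -
  have "\<exists>t. wf_trm L t \<and> vars_trm t \<subseteq> V \<and> x = evalt M e t"
    using assms
  proof induction
    case (base x)
    then obtain v where "v \<in> V" "x = e v" by auto
    then show ?case by (intro exI[of _ "Var v"]) auto
  next
    case (step f xs)
    then have "\<forall>x. \<exists>t. x \<in> set xs \<longrightarrow> wf_trm L t \<and> vars_trm t \<subseteq> V \<and> x = evalt M e t" by blast
    then obtain T where
      T: "\<And>x. x \<in> set xs \<Longrightarrow> wf_trm L (T x) \<and> vars_trm (T x) \<subseteq> V \<and> x = evalt M e (T x)"
      by metis
    have "map (evalt M e) (map T xs) = xs" using T by (auto intro!: map_idI)
    then show ?case
      using step T by (intro exI[of _ "Fun f (map T xs)"]) auto
  qed
  with that show thesis by blast
qed

lemma gen_finite_support: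
  assumes "x \<in> gen L M X"
  obtains F where "finite F" "F \<subseteq> X" "x \<in> gen L M F"
proof -
  have "\<exists>F. finite F \<and> F \<subseteq> X \<and> x \<in> gen L M F"
    using assms
  proof induction
    case (base x)
    then show ?case by (intro exI[of _ "{x}"]) (auto intro: gen.base)
  next
    case (step f xs)
    then have "\<forall>x. \<exists>F. x \<in> set xs \<longrightarrow> finite F \<and> F \<subseteq> X \<and> x \<in> gen L M F" by blast
    then obtain F where F: "\<And>x. x \<in> set xs \<Longrightarrow> finite (F x) \<and> F x \<subseteq> X \<and> x \<in> gen L M (F x)"
      by metis
    have "set xs \<subseteq> gen L M (\<Union>(F ` set xs))"
      using F gen_mono[of "F _" "\<Union>(F ` set xs)" L M] by blast
    then show ?case
      using F step by (intro exI[of _ "\<Union>(F ` set xs)"]) (auto intro: gen_fn_closed)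
  qed
  with that show thesis by blast
qed

text \<open>An open formula involves finitely many elements, so it can be tested in the substructure
  that they generate; being quantifier-free, it does not notice the change of universe. With this
  the axioms pass from the age of the Fraisse limit to the limit itself.\<close>

lemma valid_of_substructures:
  assumes "is_struct L M" "qf \<phi>"
    and sub: "\<And>X. finite X \<Longrightarrow> X \<subseteq> univ M \<Longrightarrow> valid (M\<lparr>univ := gen L M X\<rparr>) \<phi>"
  shows "valid M \<phi>"
  unfolding valid_def
proof (intro allI impI)
  fix e :: "nat \<Rightarrow> 'b" assume e: "range e \<subseteq> univ M"
  \<comment> \<open>The value \<open>e 0\<close> is the default for variables that do not occur, so
    that \<open>X\<close> is finite and still contains the whole range of \<open>e'\<close>.\<close>
  define X where "X = insert (e 0) (e ` fv \<phi>)"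
  define e' where "e' = (\<lambda>x. if x \<in> fv \<phi> then e x else e 0)"
  have "finite X" "X \<subseteq> univ M" using e finite_fv by (auto simp: X_def)
  then have "valid (M\<lparr>univ := gen L M X\<rparr>) \<phi>" by (rule sub)
  moreover have "range e' \<subseteq> gen L M X"
    using gen_incl[of X L M] by (auto simp: e'_def X_def)
  ultimately have "sat M e' \<phi>"
    by (simp add: valid_def sat_univ_update[OF assms(2)])
  moreover have "sat M e' \<phi> = sat M e \<phi>" by (rule sat_cong) (simp add: e'_def)
  ultimately show "sat M e \<phi>" by simp
qed

section \<open>Axioms for the class of groups\<close>

abbreviation mulT :: "gsym trm \<Rightarrow> gsym trm \<Rightarrow> gsym trm" where
  "mulT s t \<equiv> Fun Mul [s, t]"

abbreviation oneT :: "gsym trm" where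
  "oneT \<equiv> Fun One []"

abbreviation cstT :: "nat \<Rightarrow> gsym trm" where
  "cstT i \<equiv> Fun (Cst i) []"

fun powT :: "gsym trm \<Rightarrow> nat \<Rightarrow> gsym trm" where
  "powT t 0 = oneT"
| "powT t (Suc k) = mulT (powT t k) t"

fun lcT :: "(nat \<Rightarrow> nat) \<Rightarrow> nat \<Rightarrow> gsym trm" where
  "lcT r 0 = oneT"
| "lcT r (Suc k) = mulT (lcT r k) (powT (cstT (Suc k)) (r (Suc k)))"

fun lc :: "(gsym, 'a) struct \<Rightarrow> (nat \<Rightarrow> nat) \<Rightarrow> nat \<Rightarrow> 'a" where
  "lc M r 0 = fn M One []"
| "lc M r (Suc k) = fn M Mul [lc M r k, cst M (Suc k) [^]\<^bsub>grp M\<^esub> r (Suc k)]"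

lemma grp_simps [simp]:
  "carrier (grp M) = univ M" "x \<otimes>\<^bsub>grp M\<^esub> y = fn M Mul [x, y]" "\<one>\<^bsub>grp M\<^esub> = fn M One []"
  by (auto simp: grp_def)

lemma Lg_simps [simp]:
  "(One, k) \<in> Lg n \<longleftrightarrow> k = 0" "(Inv, k) \<in> Lg n \<longleftrightarrow> k = 1" "(Mul, k) \<in> Lg n \<longleftrightarrow> k = 2"
  "(Cst i, k) \<in> Lg n \<longleftrightarrow> i \<in> {1..n} \<and> k = 0"
  by (auto simp: Lg_def)

lemma Lg_induct [consumes 1, case_names One Inv Mul Cst]:
  assumes "(f, length xs) \<in> Lg n" "P One []" "\<And>x. P Inv [x]" "\<And>x y. P Mul [x, y]"
    "\<And>i. i \<in> {1..n} \<Longrightarrow> P (Cst i) []"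
  shows "P f xs"
proof (cases f)
  case Mul
  then obtain x y where "xs = [x, y]"
    using assms(1) by (auto simp: length_Suc_conv numeral_2_eq_2)
  with Mul assms show ?thesis by simp
next
  case Inv
  then obtain x where "xs = [x]"
    using assms(1) by (auto simp: length_Suc_conv)
  with Inv assms show ?thesis by simp
qed (use assms in auto)

lemma evalt_powT [simp]: "evalt M e (powT t k) = evalt M e t [^]\<^bsub>grp M\<^esub> k"
  by (induction k) auto

lemma evalt_lcT [simp]: "evalt M e (lcT r k) = lc M r k"
  by (induction k) (auto simp: cst_def)

lemma wf_powT [simp]: "wf_trm (Lg n) t \<Longrightarrow> wf_trm (Lg n) (powT t k)"
  by (induction k) auto

lemma wf_lcT [simp]: "k \<le> n \<Longrightarrow> wf_trm (Lg n) (lcT r k)"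
  by (induction k) auto

lemma vars_powT: "vars_trm (powT t k) \<subseteq> vars_trm t"
  by (induction k) auto

lemma vars_lcT [simp]: "vars_trm (lcT r k) = {}"
proof (induction k)
  case (Suc k)
  then show ?case using vars_powT[of "cstT (Suc k)" "r (Suc k)"] by simp
qed simp

lemma lc_cong: "(\<And>i. i \<in> {1..k} \<Longrightarrow> r i = s i) \<Longrightarrow> lc M r k = lc M s k"
  by (induction k) auto

text \<open>Exponent vectors with entries below \<open>p\<close>, by which quantification over the
  span of the constants becomes a finite disjunction or conjunction. The shift by one is due to
  constants being numbered from 1 and list positions from 0.\<close>

definition exps :: "nat \<Rightarrow> nat \<Rightarrow> (nat \<Rightarrow> nat) list" where
  "exps p n = map (\<lambda>rs i. rs ! (i - 1)) (List.n_lists n [0..<p])"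

lemma exps_less: "r \<in> set (exps p n) \<Longrightarrow> i \<in> {1..n} \<Longrightarrow> r i < p"
proof -
  assume "r \<in> set (exps p n)" and i: "i \<in> {1..n}"
  then obtain rs where r: "r = (\<lambda>i. rs ! (i - 1))" and rs: "length rs = n" "set rs \<subseteq> {0..<p}"
    by (auto simp: exps_def set_n_lists)
  have "rs ! (i - 1) \<in> set rs" using i rs by (intro nth_mem) auto
  then show "r i < p" using r rs by auto
qed

lemma exps_cover:
  assumes "\<And>i. i \<in> {1..n} \<Longrightarrow> r i < p"
  obtains s where "s \<in> set (exps p n)" "\<And>i. i \<in> {1..n} \<Longrightarrow> s i = r i"
proof -
  define rs where "rs = map (\<lambda>i. r (Suc i)) [0..<n]"
  have "set rs \<subseteq> {0..<p}" using assms by (auto simp: rs_def)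
  then have "(\<lambda>i. rs ! (i - 1)) \<in> set (exps p n)"
    by (auto simp: exps_def set_n_lists rs_def intro!: image_eqI[where x = rs])
  moreover have "rs ! (i - 1) = r i" if "i \<in> {1..n}" for i using that by (auto simp: rs_def)
  ultimately show thesis using that by blast
qed

text \<open>Universal axioms with quantifier-free bodies. The disjunction puts every commutator into
  the span of the constants: \<open>x \<otimes> y\<close> and \<open>y \<otimes> x\<close> differ by
  one of finitely many linear combinations. The last family expresses linear independence.\<close>

definition G_axioms :: "nat \<Rightarrow> nat \<Rightarrow> gsym fm set" where
  "G_axioms p n =
     {Eq (mulT (mulT (Var 0) (Var 1)) (Var 2)) (mulT (Var 0) (mulT (Var 1) (Var 2))),
      Eq (mulT oneT (Var 0)) (Var 0),
      Eq (mulT (Fun Inv [Var 0]) (Var 0)) oneT,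
      Eq (powT (Var 0) p) oneT,
      Disj (map (\<lambda>r. Eq (mulT (Var 0) (Var 1)) (mulT (lcT r n) (mulT (Var 1) (Var 0)))) (exps p n))}
     \<union> (\<lambda>i. Eq (mulT (cstT i) (Var 0)) (mulT (Var 0) (cstT i))) ` {1..n}
     \<union> (\<lambda>r. Neg (Eq (lcT r n) oneT)) ` {r \<in> set (exps p n). \<exists>i\<in>{1..n}. r i \<noteq> 0}"

lemma wf_G_axioms: "\<phi> \<in> G_axioms p n \<Longrightarrow> wf_fm (Lg n) \<phi>"
  by (auto simp: G_axioms_def)

lemma qf_G_axioms: "\<phi> \<in> G_axioms p n \<Longrightarrow> qf \<phi>"
  by (auto simp: G_axioms_def)

definition sem_axioms :: "nat \<Rightarrow> nat \<Rightarrow> (gsym, 'a) struct \<Rightarrow> bool" where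
  "sem_axioms p n M \<longleftrightarrow>
     (\<forall>x\<in>univ M. \<forall>y\<in>univ M. \<forall>z\<in>univ M.
        fn M Mul [fn M Mul [x, y], z] = fn M Mul [x, fn M Mul [y, z]]) \<and>
     (\<forall>x\<in>univ M. fn M Mul [fn M One [], x] = x) \<and>
     (\<forall>x\<in>univ M. fn M Mul [fn M Inv [x], x] = fn M One []) \<and>
     (\<forall>x\<in>univ M. x [^]\<^bsub>grp M\<^esub> p = fn M One []) \<and>
     (\<forall>x\<in>univ M. \<forall>y\<in>univ M. \<exists>r. (\<forall>i\<in>{1..n}. r i < p) \<and>
        fn M Mul [x, y] = fn M Mul [lc M r n, fn M Mul [y, x]]) \<and>
     (\<forall>i\<in>{1..n}. \<forall>x\<in>univ M. fn M Mul [cst M i, x] = fn M Mul [x, cst M i]) \<and>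
     (\<forall>r. (\<forall>i\<in>{1..n}. r i < p) \<and> lc M r n = fn M One [] \<longrightarrow> (\<forall>i\<in>{1..n}. r i = 0))"

text \<open>With its two companions this replaces quantification over assignments by quantification
  over the assigned elements, so that validity of an open formula takes the usual form of an
  axiom.\<close>

lemma assignments1:
  assumes "univ M \<noteq> {}"
  shows "(\<forall>e. range e \<subseteq> univ M \<longrightarrow> P (e (0::nat))) \<longleftrightarrow> (\<forall>x\<in>univ M. P x)"
proof
  assume "\<forall>e. range e \<subseteq> univ M \<longrightarrow> P (e (0::nat))"
  then have "P x" if "x \<in> univ M" for x
    using that by (elim allE[of _ "\<lambda>_. x"]) auto
  then show "\<forall>x\<in>univ M. P x" by auto
qed auto

lemma assignments2:
  assumes "univ M \<noteq> {}"
  shows "(\<forall>e. range e \<subseteq> univ M \<longrightarrow> P (e (0::nat)) (e 1)) \<longleftrightarrow> (\<forall>x\<in>univ M. \<forall>y\<in>univ M. P x y)"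
proof
  assume *: "\<forall>e. range e \<subseteq> univ M \<longrightarrow> P (e (0::nat)) (e 1)"
  have "P x y" if "x \<in> univ M" "y \<in> univ M" for x y
    using *[rule_format, of "\<lambda>i. if i = 0 then x else y"] that by auto
  then show "\<forall>x\<in>univ M. \<forall>y\<in>univ M. P x y" by auto
qed (auto simp: image_subset_iff)

lemma assignments3:
  assumes "univ M \<noteq> {}"
  shows "(\<forall>e. range e \<subseteq> univ M \<longrightarrow> P (e (0::nat)) (e 1) (e 2)) \<longleftrightarrow>
    (\<forall>x\<in>univ M. \<forall>y\<in>univ M. \<forall>z\<in>univ M. P x y z)"
proof
  assume *: "\<forall>e. range e \<subseteq> univ M \<longrightarrow> P (e (0::nat)) (e 1) (e 2)"
  have "P x y z" if "x \<in> univ M" "y \<in> univ M" "z \<in> univ M" for x y z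
    using *[rule_format, of "\<lambda>i. if i = 0 then x else if i = 1 then y else z"] that by auto
  then show "\<forall>x\<in>univ M. \<forall>y\<in>univ M. \<forall>z\<in>univ M. P x y z" by auto
qed (auto simp: image_subset_iff)

lemma ex_exps_iff:
  "(\<exists>r\<in>set (exps p n). P (lc M r n)) \<longleftrightarrow> (\<exists>r. (\<forall>i\<in>{1..n}. r i < p) \<and> P (lc M r n))"
proof
  assume "\<exists>r. (\<forall>i\<in>{1..n}. r i < p) \<and> P (lc M r n)"
  then obtain r where r: "\<forall>i\<in>{1..n}. r i < p" "P (lc M r n)" by blast
  then obtain s where "s \<in> set (exps p n)" "\<And>i. i \<in> {1..n} \<Longrightarrow> s i = r i"
    using exps_cover[of n r p] by auto
  moreover have "lc M s n = lc M r n" using calculation by (intro lc_cong) auto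
  ultimately show "\<exists>r\<in>set (exps p n). P (lc M r n)" using r by (intro bexI[of _ s]) simp_all
next
  assume "\<exists>r\<in>set (exps p n). P (lc M r n)"
  then obtain r where "r \<in> set (exps p n)" "P (lc M r n)" by (elim bexE)
  then show "\<exists>r. (\<forall>i\<in>{1..n}. r i < p) \<and> P (lc M r n)"
    using exps_less[of r p n] by (intro exI[of _ r]) simp
qed

lemma valid_G_axioms_iff:
  assumes "is_struct (Lg n) M"
  shows "(\<forall>\<phi>\<in>G_axioms p n. valid M \<phi>) \<longleftrightarrow> sem_axioms p n M"
proof -
  have ne: "univ M \<noteq> {}" using assms by (auto simp: is_struct_def)
  have 1: "(\<forall>r\<in>set (exps p n). (\<exists>i\<in>{1..n}. r i \<noteq> 0) \<longrightarrow> lc M r n \<noteq> fn M One []) \<longleftrightarrow>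
    (\<forall>r. (\<forall>i\<in>{1..n}. r i < p) \<and> lc M r n = fn M One [] \<longrightarrow> (\<forall>i\<in>{1..n}. r i = 0))"
  proof
    assume *: "\<forall>r\<in>set (exps p n). (\<exists>i\<in>{1..n}. r i \<noteq> 0) \<longrightarrow> lc M r n \<noteq> fn M One []"
    show "\<forall>r. (\<forall>i\<in>{1..n}. r i < p) \<and> lc M r n = fn M One [] \<longrightarrow> (\<forall>i\<in>{1..n}. r i = 0)"
    proof (intro allI impI, elim conjE)
      fix r assume r: "\<forall>i\<in>{1..n}. r i < p" "lc M r n = fn M One []"
      then obtain s where "s \<in> set (exps p n)" "\<And>i. i \<in> {1..n} \<Longrightarrow> s i = r i"
        using exps_cover[of n r p] by auto
      then show "\<forall>i\<in>{1..n}. r i = 0" using r lc_cong[of n s r M] * by auto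
    qed
  next
    assume *: "\<forall>r. (\<forall>i\<in>{1..n}. r i < p) \<and> lc M r n = fn M One [] \<longrightarrow> (\<forall>i\<in>{1..n}. r i = 0)"
    show "\<forall>r\<in>set (exps p n). (\<exists>i\<in>{1..n}. r i \<noteq> 0) \<longrightarrow> lc M r n \<noteq> fn M One []"
    proof (intro ballI impI notI)
      fix r assume r: "r \<in> set (exps p n)" "\<exists>i\<in>{1..n}. r i \<noteq> 0" "lc M r n = fn M One []"
      then have "\<forall>i\<in>{1..n}. r i < p" using exps_less[of r p n] by simp
      with * r show False by simp
    qed
  qed
  obtain a where "a \<in> univ M" using ne by blast
  then have ex: "\<exists>e::nat \<Rightarrow> 'a. range e \<subseteq> univ M" by (intro exI[of _ "\<lambda>_. a"]) auto
  have "(\<forall>\<phi>\<in>G_axioms p n. valid M \<phi>) \<longleftrightarrow>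
    (\<forall>e. range e \<subseteq> univ M \<longrightarrow>
      fn M Mul [fn M Mul [e (0::nat), e 1], e 2] = fn M Mul [e 0, fn M Mul [e 1, e 2]]) \<and>
    (\<forall>e. range e \<subseteq> univ M \<longrightarrow> fn M Mul [fn M One [], e (0::nat)] = e 0) \<and>
    (\<forall>e. range e \<subseteq> univ M \<longrightarrow> fn M Mul [fn M Inv [e (0::nat)], e 0] = fn M One []) \<and>
    (\<forall>e. range e \<subseteq> univ M \<longrightarrow> e (0::nat) [^]\<^bsub>grp M\<^esub> p = fn M One []) \<and>
    (\<forall>e. range e \<subseteq> univ M \<longrightarrow> (\<exists>r\<in>set (exps p n).
       fn M Mul [e (0::nat), e 1] = fn M Mul [lc M r n, fn M Mul [e 1, e 0]])) \<and>
    (\<forall>i\<in>{1..n}. \<forall>e. range e \<subseteq> univ M \<longrightarrow> fn M Mul [cst M i, e (0::nat)] = fn M Mul [e 0, cst M i]) \<and>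
    (\<forall>r\<in>set (exps p n). (\<exists>i\<in>{1..n}. r i \<noteq> 0) \<longrightarrow> lc M r n \<noteq> fn M One [])"
    unfolding G_axioms_def valid_def
    by (simp add: ball_Un ex cst_def conj_assoc) (simp only: Ball_def imp_conjL)
  also have "\<dots> \<longleftrightarrow> sem_axioms p n M"
    unfolding assignments1[OF ne, of "\<lambda>x. fn M Mul [fn M One [], x] = x"]
      assignments1[OF ne, of "\<lambda>x. fn M Mul [fn M Inv [x], x] = fn M One []"]
      assignments1[OF ne, of "\<lambda>x. x [^]\<^bsub>grp M\<^esub> p = fn M One []"]
      assignments1[OF ne, of "\<lambda>x. fn M Mul [cst M _, x] = fn M Mul [x, cst M _]"]
      assignments2[OF ne, of "\<lambda>x y. \<exists>r. (\<forall>i\<in>{1..n}. r i < p) \<and>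
        fn M Mul [x, y] = fn M Mul [lc M r n, fn M Mul [y, x]]"]
      assignments3[OF ne, of "\<lambda>x y z. fn M Mul [fn M Mul [x, y], z] = fn M Mul [x, fn M Mul [y, z]]"]
      1 sem_axioms_def ex_exps_iff[of p n "\<lambda>z. fn M Mul [_, _] = fn M Mul [z, _]"]
    by (rule refl)
  finally show ?thesis .
qed

section \<open>Groups of exponent \<open>p\<close> with central constants\<close>

lemma (in group) inv_mult_cancel:
  assumes "x \<in> carrier G" "y \<in> carrier G"
  shows "inv x \<otimes> (x \<otimes> y) = y" "x \<otimes> (inv x \<otimes> y) = y"
  using assms by (simp_all flip: m_assoc)

text \<open>Common ground for both directions of \<open>in_G_iff\<close>: the locale can be entered
  from \<open>in_G\<close> as well as from \<open>sem_axioms\<close>, and it links \<open>lc\<close>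
  with \<open>finprod\<close>, \<open>generate\<close> and \<open>lin_indep\<close>.\<close>

locale central_constants = group G for G (structure) +
  fixes p n :: nat and M :: "(gsym, 'a) struct"
  assumes G_eq: "G = grp M"
    and cst_center: "i \<in> {1..n} \<Longrightarrow> cst M i \<in> center G"
    and pow_p: "x \<in> carrier G \<Longrightarrow> x [^] p = \<one>"
    and p_pos: "p > 0"
begin

abbreviation Z where "Z \<equiv> G\<lparr>carrier := center G\<rparr>"

lemma center_subgroup: "subgroup (center G) G"
proof
  fix x assume x: "x \<in> center G"
  then have xc: "x \<in> carrier G" by (simp add: center_def)
  have "inv x \<otimes> y = y \<otimes> inv x" if "y \<in> carrier G" for y
  proof -
    have "inv x \<otimes> y = inv x \<otimes> (y \<otimes> x) \<otimes> inv x" using that xc by (simp add: m_assoc)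
    also have "\<dots> = inv x \<otimes> (x \<otimes> y) \<otimes> inv x" using that x by (simp add: center_def)
    also have "\<dots> = y \<otimes> inv x" using that xc by (simp add: m_assoc[symmetric])
    finally show ?thesis .
  qed
  then show "inv x \<in> center G" using xc by (simp add: center_def)
next
  fix x y assume "x \<in> center G" "y \<in> center G"
  then have x: "x \<in> carrier G" "\<And>z. z \<in> carrier G \<Longrightarrow> x \<otimes> z = z \<otimes> x"
    and y: "y \<in> carrier G" "\<And>z. z \<in> carrier G \<Longrightarrow> y \<otimes> z = z \<otimes> y"
    by (simp_all add: center_def)
  have "x \<otimes> y \<otimes> z = z \<otimes> (x \<otimes> y)" if z: "z \<in> carrier G" for z
  proof -
    have "x \<otimes> y \<otimes> z = x \<otimes> (z \<otimes> y)" using x(1) y z by (simp only: m_assoc)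
    also have "\<dots> = z \<otimes> x \<otimes> y" using x y(1) z by (simp only: m_assoc[symmetric])
    finally show ?thesis using x(1) y(1) z by (simp only: m_assoc)
  qed
  then show "x \<otimes> y \<in> center G" using x(1) y(1) by (simp add: center_def)
qed (auto simp: center_def)

lemma center_commutes: "z \<in> center G \<Longrightarrow> x \<in> carrier G \<Longrightarrow> z \<otimes> x = x \<otimes> z"
  unfolding center_def by blast

lemma center_carrier: "z \<in> center G \<Longrightarrow> z \<in> carrier G"
  unfolding center_def by blast

lemma Z_comm_group: "comm_group Z"
proof -
  interpret Z: group Z by (rule subgroup.subgroup_is_group[OF center_subgroup is_group])
  show ?thesis by (rule Z.group_comm_groupI) (simp add: center_commutes center_carrier)
qed

lemma lc_Suc: "lc M r (Suc k) = lc M r k \<otimes> cst M (Suc k) [^] r (Suc k)"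
  by (simp add: G_eq)

lemma lc_0: "lc M r 0 = \<one>"
  by (simp add: G_eq)

lemma center_pow: "x \<in> center G \<Longrightarrow> x [^] (k::nat) \<in> center G"
  using monoid.nat_pow_closed[of Z x k] Z_comm_group
  by (simp add: comm_group_def comm_monoid_def nat_pow_consistent[symmetric])

lemma lc_finprod: "k \<le> n \<Longrightarrow> lc M r k = finprod Z (\<lambda>i. cst M i [^] r i) {1..k}"
proof (induction k)
  case 0
  interpret Z: comm_group Z by (rule Z_comm_group)
  show ?case using lc_0 by simp
next
  case (Suc k)
  interpret Z: comm_group Z by (rule Z_comm_group)
  have *: "{1..Suc k} = insert (Suc k) {1..k}" by auto
  have "finprod Z (\<lambda>i. cst M i [^] r i) {1..Suc k} =
    cst M (Suc k) [^] r (Suc k) \<otimes> finprod Z (\<lambda>i. cst M i [^] r i) {1..k}"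
    unfolding * by (subst Z.finprod_insert) (use Suc.prems in \<open>auto intro!: center_pow cst_center\<close>)
  also have "finprod Z (\<lambda>i. cst M i [^] r i) {1..k} = lc M r k" using Suc by simp
  also have "cst M (Suc k) [^] r (Suc k) \<otimes> lc M r k = lc M r (Suc k)"
  proof -
    have "finprod Z (\<lambda>i. cst M i [^] r i) {1..k} \<in> carrier Z"
      by (rule Z.finprod_closed) (use Suc.prems in \<open>auto intro!: center_pow cst_center\<close>)
    then have "lc M r k \<in> carrier G" using Suc by (simp add: center_def)
    moreover have "cst M (Suc k) [^] r (Suc k) \<in> center G"
      using Suc.prems by (auto intro!: center_pow cst_center)
    ultimately show ?thesis unfolding lc_Suc by (simp add: center_def)
  qed
  finally show ?case by simp
qed

lemma lc_center: "lc M r n \<in> center G"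
proof -
  interpret Z: comm_group Z by (rule Z_comm_group)
  have "finprod Z (\<lambda>i. cst M i [^] r i) {1..n} \<in> carrier Z"
    by (rule Z.finprod_closed) (auto intro!: center_pow cst_center)
  then show ?thesis by (simp add: lc_finprod)
qed

lemma lc_closed [simp, intro]: "lc M r n \<in> carrier G"
  using lc_center by (simp add: center_def)

lemma lc_mult: "lc M r n \<otimes> lc M s n = lc M (\<lambda>i. r i + s i) n"
proof -
  interpret Z: comm_group Z by (rule Z_comm_group)
  have c: "cst M i \<in> carrier G" if "i \<in> {1..n}" for i using cst_center[OF that] by (simp add: center_def)
  have "finprod Z (\<lambda>i. cst M i [^] r i \<otimes>\<^bsub>Z\<^esub> cst M i [^] s i) {1..n} =
    finprod Z (\<lambda>i. cst M i [^] r i) {1..n} \<otimes>\<^bsub>Z\<^esub> finprod Z (\<lambda>i. cst M i [^] s i) {1..n}"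
    by (rule Z.finprod_multf) (auto intro!: center_pow cst_center)
  moreover have "finprod Z (\<lambda>i. cst M i [^] r i \<otimes>\<^bsub>Z\<^esub> cst M i [^] s i) {1..n} =
    finprod Z (\<lambda>i. cst M i [^] (r i + s i)) {1..n}"
    using c by (intro Z.finprod_cong') (auto simp: nat_pow_mult intro!: center_pow cst_center)
  ultimately show ?thesis by (simp add: lc_finprod)
qed

lemma pow_mod: "x \<in> carrier G \<Longrightarrow> x [^] (k mod p) = x [^] (k::nat)"
proof -
  assume x: "x \<in> carrier G"
  have "x [^] k = x [^] (p * (k div p) + k mod p)" by simp
  also have "\<dots> = (x [^] p) [^] (k div p) \<otimes> x [^] (k mod p)"
    using x by (simp add: nat_pow_mult nat_pow_pow)
  finally show ?thesis using x by (simp add: pow_p)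
qed

lemma int_pow_mod: "x \<in> carrier G \<Longrightarrow> x [^] nat (k mod int p) = x [^] (k::int)"
proof -
  assume x: "x \<in> carrier G"
  have "x [^] k = x [^] (int p * (k div int p) + k mod int p)" by simp
  also have "\<dots> = x [^] (int p * (k div int p)) \<otimes> x [^] (k mod int p)"
    using x by (intro int_pow_mult) 
  also have "x [^] (int p * (k div int p)) = (x [^] int p) [^] (k div int p)"
    using x by (simp add: int_pow_pow)
  also have "x [^] int p = \<one>" using x pow_p by (simp add: int_pow_int)
  also have "x [^] (k mod int p) = x [^] nat (k mod int p)"
    using p_pos by (simp flip: int_pow_int)
  finally show ?thesis using x by simp
qed

lemma lc_mod: "lc M (\<lambda>i. r i mod p) n = lc M r n"
proof -
  interpret Z: comm_group Z by (rule Z_comm_group)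
  have c: "cst M i \<in> carrier G" if "i \<in> {1..n}" for i using cst_center[OF that] by (simp add: center_def)
  show ?thesis unfolding lc_finprod[OF order_refl]
    using c by (intro Z.finprod_cong') (auto simp: pow_mod intro!: center_pow cst_center)
qed

lemma lc_eq_cst:
  assumes "j \<in> {1..n}"
  shows "lc M (\<lambda>i. if i = j then 1 else 0) n = cst M j"
proof -
  interpret Z: comm_group Z by (rule Z_comm_group)
  have c: "cst M i \<in> center G" "cst M i \<in> carrier G" if "i \<in> {1..n}" for i
    using cst_center[OF that] by (auto simp: center_def)
  have "lc M (\<lambda>i. if i = j then 1 else 0) n =
     finprod Z (\<lambda>i. cst M i [^] (if i = j then 1 else 0 :: nat)) {1..n}"
    by (rule lc_finprod) simp
  also have "\<dots> = finprod Z (\<lambda>i. if j = i then cst M i else \<one>\<^bsub>Z\<^esub>) {1..n}"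
    using c center_subgroup by (intro Z.finprod_cong') (auto simp: subgroup.one_closed)
  also have "\<dots> = cst M j"
    by (rule Z.finprod_singleton) (use c assms in auto)
  finally show ?thesis .
qed

lemma lc_zero: "(\<And>i. i \<in> {1..n} \<Longrightarrow> r i = 0) \<Longrightarrow> lc M r n = \<one>"
proof -
  interpret Z: comm_group Z by (rule Z_comm_group)
  assume "\<And>i. i \<in> {1..n} \<Longrightarrow> r i = 0"
  then have "finprod Z (\<lambda>i. cst M i [^] r i) {1..n} = finprod Z (\<lambda>i. \<one>\<^bsub>Z\<^esub>) {1..n}"
    using center_subgroup by (intro Z.finprod_cong') (auto simp: subgroup.one_closed)
  also have "\<dots> = \<one>\<^bsub>Z\<^esub>" by (rule Z.finprod_one_eqI) simp
  finally show ?thesis unfolding lc_finprod[OF order_refl] by simp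
qed

text \<open>The combinations \<open>lc M r n\<close> are closed under inverses because the exponents
  can be multiplied by \<open>p - 1\<close>; reduction modulo \<open>p\<close> then bounds
  them.\<close>

lemma generate_constants: "generate G (cst M ` {1..n}) = {lc M r n | r. \<forall>i. r i < p}"
proof
  let ?S = "{lc M r n | r. \<forall>i. r i < p}"
  have S: "lc M r n \<in> ?S" for r
    using lc_mod[of r] p_pos by (intro CollectI exI[of _ "\<lambda>i. r i mod p"]) auto
  have "subgroup ?S G"
  proof
    fix x assume "x \<in> ?S"
    then obtain r where r: "x = lc M r n" by blast
    have "lc M r n \<otimes> lc M (\<lambda>i. (p - 1) * r i) n = lc M (\<lambda>i. p * r i) n"
      unfolding lc_mult using p_pos by (intro lc_cong) (simp add: diff_mult_distrib)
    also have "\<dots> = lc M (\<lambda>i. 0) n" using lc_mod[of "\<lambda>i. p * r i"] by simp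
    also have "\<dots> = \<one>" by (rule lc_zero) simp
    finally have "inv x = lc M (\<lambda>i. (p - 1) * r i) n" unfolding r by (metis inv_equality inv_inv lc_closed)
    then show "inv x \<in> ?S" using S by simp
  next
    fix x y assume "x \<in> ?S" "y \<in> ?S"
    then show "x \<otimes> y \<in> ?S" using lc_mult S by auto
  next
    show "\<one> \<in> ?S" using S[of "\<lambda>_. 0"] lc_zero[of "\<lambda>_. 0"] by simp
  qed auto
  moreover have "cst M ` {1..n} \<subseteq> ?S"
  proof
    fix x assume "x \<in> cst M ` {1..n}"
    then obtain j where "j \<in> {1..n}" "x = cst M j" by blast
    then show "x \<in> ?S" using lc_eq_cst[of j] S[of "\<lambda>i. if i = j then 1 else 0"] by simp
  qed
  ultimately show "generate G (cst M ` {1..n}) \<subseteq> ?S" by (intro generate_subgroup_incl)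
  have "cst M ` {1..n} \<subseteq> carrier G" using cst_center by (auto simp: center_def)
  then have sg: "subgroup (generate G (cst M ` {1..n})) G" by (rule generate_is_subgroup)
  have "lc M r k \<in> generate G (cst M ` {1..n})" if "k \<le> n" for r k
    using that
  proof (induction k)
    case 0
    show ?case by (simp only: lc_0 subgroup.one_closed[OF sg])
  next
    case (Suc k)
    have "cst M (Suc k) \<in> generate G (cst M ` {1..n})"
      using Suc.prems by (intro generate.incl) auto
    then have "cst M (Suc k) [^] r (Suc k) \<in> generate G (cst M ` {1..n})"
    proof (induction "r (Suc k)" arbitrary: r)
      case 0
      then show ?case by (metis nat_pow_0 subgroup.one_closed[OF sg])
    next
      case (Suc m)
      from Suc(1)[of "\<lambda>_. m"] Suc.prems have "cst M (Suc k) [^] m \<in> generate G (cst M ` {1..n})"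
        by simp
      with Suc.prems show ?case
        unfolding Suc.hyps(2)[symmetric] nat_pow_Suc by (intro subgroup.m_closed[OF sg])
    qed
    with Suc show ?case unfolding lc_Suc by (intro subgroup.m_closed[OF sg]) auto
  qed
  then show "?S \<subseteq> generate G (cst M ` {1..n})" by blast
qed

text \<open>Integer scalars are replaced by their residues in \<open>{0..<p}\<close>, which changes
  no power because the exponent is \<open>p\<close>. What remains is a finite list of conditions
  that axioms can state.\<close>

lemma lin_indep_iff:
  "lin_indep p G {1..n} (cst M) \<longleftrightarrow>
    (\<forall>r. (\<forall>i\<in>{1..n}. r i < p) \<and> lc M r n = \<one> \<longrightarrow> (\<forall>i\<in>{1..n}. r i = 0))"
proof
  interpret Z: comm_group Z by (rule Z_comm_group)
  have c: "cst M i \<in> carrier G" if "i \<in> {1..n}" for i using cst_center[OF that] by (simp add: center_def)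
  {
    assume li: "lin_indep p G {1..n} (cst M)"
    show "\<forall>r. (\<forall>i\<in>{1..n}. r i < p) \<and> lc M r n = \<one> \<longrightarrow> (\<forall>i\<in>{1..n}. r i = 0)"
    proof (intro allI impI, elim conjE)
      fix r assume r: "\<forall>i\<in>{1..n}. r i < p" "lc M r n = \<one>"
      have "finprod Z (\<lambda>i. cst M i [^] int (r i)) {1..n} = \<one>"
        using r(2) lc_finprod[of n r] by (simp add: int_pow_int)
      then have "\<forall>i\<in>{1..n}. int p dvd int (r i)"
        using li unfolding lin_indep_def by (elim allE[of _ "\<lambda>i. int (r i)"]) simp
      then show "\<forall>i\<in>{1..n}. r i = 0" using r(1) by (metis int_dvd_int_iff mod_less dvd_eq_mod_eq_0)
    qed
  next
    assume *: "\<forall>r. (\<forall>i\<in>{1..n}. r i < p) \<and> lc M r n = \<one> \<longrightarrow> (\<forall>i\<in>{1..n}. r i = 0)"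
    show "lin_indep p G {1..n} (cst M)"
      unfolding lin_indep_def
    proof (intro allI impI)
      fix r :: "nat \<Rightarrow> int" assume r: "finprod Z (\<lambda>i. cst M i [^] r i) {1..n} = \<one>"
      have "finprod Z (\<lambda>i. cst M i [^] r i) {1..n} = lc M (\<lambda>i. nat (r i mod int p)) n"
        unfolding lc_finprod[OF order_refl]
      proof (rule Z.finprod_cong')
        show "cst M i [^] r i = cst M i [^] nat (r i mod int p)" if "i \<in> {1..n}" for i
          using int_pow_mod[OF c[OF that], of "r i"] by (rule sym)
        show "(\<lambda>i. cst M i [^] nat (r i mod int p)) \<in> {1..n} \<rightarrow> carrier Z"
          by (auto intro!: center_pow cst_center)
      qed simp
      then have "lc M (\<lambda>i. nat (r i mod int p)) n = \<one>" using r by (simp only:)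
      moreover have "\<forall>i\<in>{1..n}. nat (r i mod int p) < p" using p_pos by (simp add: nat_less_iff)
      ultimately have "\<forall>i\<in>{1..n}. nat (r i mod int p) = 0"
        using *[THEN spec, of "\<lambda>i. nat (r i mod int p)"] by blast
      then show "\<forall>i\<in>{1..n}. int p dvd r i"
      proof (intro ballI)
        fix i assume "i \<in> {1..n}" and "\<forall>i\<in>{1..n}. nat (r i mod int p) = 0"
        then have "r i mod int p \<le> 0" by simp
        moreover have "r i mod int p \<ge> 0" using p_pos by simp
        ultimately show "int p dvd r i" by (simp add: dvd_eq_mod_eq_0)
      qed
    qed
  }
qed

end

text \<open>The derived subgroup is generated by commutators, so it lies in the span of the
  constants as soon as each single commutator is a linear combination of them. This makes the class
  axiomatizable by identities and inequations.\<close>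

lemma in_G_iff:
  assumes p: "p > 0"
  shows "in_G p n M \<longleftrightarrow> is_struct (Lg n) M \<and> sem_axioms p n M"
proof
  assume g: "in_G p n M"
  then have st: "is_struct (Lg n) M" and gr: "group (grp M)" by (auto simp: in_G_def Let_def)
  interpret group "grp M" by (rule gr)
  define C where "C = generate (grp M) (cst M ` {1..n})"
  have cst: "cst M i \<in> C" if "i \<in> {1..n}" for i using that unfolding C_def by (intro generate.incl) auto
  have C: "C \<subseteq> center (grp M)" "derived (grp M) (univ M) \<subseteq> C"
    and pow: "\<And>x. x \<in> univ M \<Longrightarrow> x [^]\<^bsub>grp M\<^esub> p = fn M One []"
    and Inv: "\<And>x. x \<in> univ M \<Longrightarrow> fn M Inv [x] = inv\<^bsub>grp M\<^esub> x"
    and li: "lin_indep p (grp M) {1..n} (cst M)"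
    using g by (auto simp: in_G_def Let_def C_def)
  interpret central_constants "grp M" p n M
    by unfold_locales (use p C cst pow in auto)
  have "\<exists>r. (\<forall>i\<in>{1..n}. r i < p) \<and> fn M Mul [x, y] = fn M Mul [lc M r n, fn M Mul [y, x]]"
    if x: "x \<in> univ M" and y: "y \<in> univ M" for x y
  proof -
    let ?c = "x \<otimes>\<^bsub>grp M\<^esub> y \<otimes>\<^bsub>grp M\<^esub> inv\<^bsub>grp M\<^esub> x \<otimes>\<^bsub>grp M\<^esub> inv\<^bsub>grp M\<^esub> y"
    have "?c \<in> derived (grp M) (univ M)"
      unfolding derived_def by (rule generate.incl) (use x y in blast)
    then obtain r where r: "\<forall>i. r i < p" "?c = lc M r n"
      using C(2) unfolding C_def generate_constants by blast
    have "x \<otimes>\<^bsub>grp M\<^esub> y = ?c \<otimes>\<^bsub>grp M\<^esub> (y \<otimes>\<^bsub>grp M\<^esub> x)"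
    proof -
      have cl: "x \<in> carrier (grp M)" "y \<in> carrier (grp M)" using x y by auto
      show ?thesis using cl by (simp add: m_assoc inv_mult_cancel del: grp_simps)
    qed
    then show ?thesis using r by (intro exI[of _ r]) simp
  qed
  moreover have "fn M Mul [cst M i, x] = fn M Mul [x, cst M i]" if "i \<in> {1..n}" "x \<in> univ M" for i x
    using C cst that by (fastforce simp: center_def)
  moreover have "fn M Mul [fn M Inv [x], x] = fn M One []" if "x \<in> univ M" for x
    using l_inv[of x] that by (simp add: Inv)
  moreover have "fn M Mul [fn M One [], x] = x" if "x \<in> univ M" for x
    using l_one[of x] that by simp
  moreover have "fn M Mul [fn M Mul [x, y], z] = fn M Mul [x, fn M Mul [y, z]]"
    if "x \<in> univ M" "y \<in> univ M" "z \<in> univ M" for x y z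
    using m_assoc[of x y z] that by simp
  ultimately show "is_struct (Lg n) M \<and> sem_axioms p n M"
    using st pow lin_indep_iff li unfolding sem_axioms_def by simp
next
  assume s: "is_struct (Lg n) M \<and> sem_axioms p n M"
  then have st: "is_struct (Lg n) M" and ax: "sem_axioms p n M" by auto
  have cl: "fn M One [] \<in> univ M" "\<And>x. x \<in> univ M \<Longrightarrow> fn M Inv [x] \<in> univ M"
    "\<And>x y. x \<in> univ M \<Longrightarrow> y \<in> univ M \<Longrightarrow> fn M Mul [x, y] \<in> univ M"
    "\<And>i. i \<in> {1..n} \<Longrightarrow> cst M i \<in> univ M"
    unfolding cst_def by (auto intro!: fn_closed[OF st])
  have "group (grp M)"
    by (rule groupI) (use cl ax in \<open>auto simp: sem_axioms_def\<close>)
  then interpret group "grp M" .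
  interpret central_constants "grp M" p n M
    by unfold_locales (use p ax cl in \<open>auto simp: sem_axioms_def center_def\<close>)
  define C where "C = generate (grp M) (cst M ` {1..n})"
  have C: "C = {lc M r n | r. \<forall>i. r i < p}" unfolding C_def by (rule generate_constants)
  have CZ: "C \<subseteq> center (grp M)" using lc_center by (auto simp: C)
  have sgC: "subgroup C (grp M)" unfolding C_def by (rule generate_is_subgroup) (use cl in auto)
  have "x \<otimes>\<^bsub>grp M\<^esub> y \<otimes>\<^bsub>grp M\<^esub> inv\<^bsub>grp M\<^esub> x \<otimes>\<^bsub>grp M\<^esub> inv\<^bsub>grp M\<^esub> y \<in> C"
    if x: "x \<in> carrier (grp M)" and y: "y \<in> carrier (grp M)" for x y
  proof -
    obtain r where "\<forall>i\<in>{1..n}. r i < p" and r: "x \<otimes>\<^bsub>grp M\<^esub> y = lc M r n \<otimes>\<^bsub>grp M\<^esub> (y \<otimes>\<^bsub>grp M\<^esub> x)"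
    proof -
      have "\<forall>x\<in>univ M. \<forall>y\<in>univ M. \<exists>r. (\<forall>i\<in>{1..n}. r i < p) \<and>
          fn M Mul [x, y] = fn M Mul [lc M r n, fn M Mul [y, x]]"
        using ax unfolding sem_axioms_def by (elim conjE)
      then show thesis using x y that by (simp only: grp_simps) metis
    qed
    have "x \<otimes>\<^bsub>grp M\<^esub> y \<otimes>\<^bsub>grp M\<^esub> inv\<^bsub>grp M\<^esub> x \<otimes>\<^bsub>grp M\<^esub> inv\<^bsub>grp M\<^esub> y = lc M r n"
    proof -
      have l: "lc M r n \<in> carrier (grp M)" by (rule lc_closed)
      have "x \<otimes>\<^bsub>grp M\<^esub> y \<otimes>\<^bsub>grp M\<^esub> inv\<^bsub>grp M\<^esub> x \<otimes>\<^bsub>grp M\<^esub> inv\<^bsub>grp M\<^esub> y =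
        lc M r n \<otimes>\<^bsub>grp M\<^esub> (y \<otimes>\<^bsub>grp M\<^esub> x \<otimes>\<^bsub>grp M\<^esub> inv\<^bsub>grp M\<^esub> x \<otimes>\<^bsub>grp M\<^esub> inv\<^bsub>grp M\<^esub> y)"
        unfolding r using x y l by (simp only: m_assoc m_closed inv_closed)
      also have "y \<otimes>\<^bsub>grp M\<^esub> x \<otimes>\<^bsub>grp M\<^esub> inv\<^bsub>grp M\<^esub> x \<otimes>\<^bsub>grp M\<^esub> inv\<^bsub>grp M\<^esub> y = \<one>\<^bsub>grp M\<^esub>"
        using x y by (simp only: m_assoc m_closed inv_closed r_inv r_one inv_mult_cancel)
      finally show ?thesis using l by (simp only: r_one)
    qed
    moreover have "lc M r n \<in> C"
      using lc_mod[of r] p unfolding C by (intro CollectI exI[of _ "\<lambda>i. r i mod p"]) auto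
    ultimately show ?thesis by simp
  qed
  then have der: "derived (grp M) (carrier (grp M)) \<subseteq> C"
    unfolding derived_def by (intro generate_subgroup_incl sgC) auto
  have "fn M Inv [x] = inv\<^bsub>grp M\<^esub> x" if "x \<in> univ M" for x
    using inv_equality[of "fn M Inv [x]" x] that ax cl by (auto simp: sem_axioms_def)
  moreover have "lin_indep p (grp M) {1..n} (cst M)"
    using ax unfolding lin_indep_iff by (simp add: sem_axioms_def)
  ultimately show "in_G p n M"
    using st der CZ is_group ax unfolding in_G_def Let_def C_def[symmetric]
    by (auto simp: sem_axioms_def)
qed

section \<open>The structures of the class as groups of nilpotency class two\<close>

locale nil2 = group G for G (structure) +
  fixes p n :: nat and M :: "(gsym, 'a) struct"
  assumes G_eq: "G = grp M" and in_G: "in_G p n M" and prime_p: "prime p" and p_gt_2: "p > 2"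
begin

abbreviation L where "L \<equiv> Lg n"

abbreviation gn where "gn \<equiv> gen L M"

definition C where "C = generate G (cst M ` {1..n})"

lemma carrier_eq: "carrier G = univ M" and mult_eq: "x \<otimes> y = fn M Mul [x, y]"
  and one_eq: "\<one> = fn M One []"
  by (simp_all add: G_eq)

lemma struct_M: "is_struct L M"
  using in_G by (simp add: in_G_def)

lemma Inv_eq: "x \<in> carrier G \<Longrightarrow> fn M Inv [x] = inv x"
  using in_G by (simp add: in_G_def Let_def G_eq)

lemma C_subset_center: "C \<subseteq> center G"
  using in_G unfolding C_def in_G_def Let_def G_eq[symmetric] by (elim conjE)

lemma derived_subset_C: "derived G (carrier G) \<subseteq> C"
  using in_G unfolding C_def in_G_def Let_def G_eq[symmetric] by (elim conjE)

sublocale central_constants G p n M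
proof
  show "G = grp M" by (rule G_eq)
  show "cst M i \<in> center G" if "i \<in> {1..n}" for i
    using C_subset_center generate.incl[of "cst M i" "cst M ` {1..n}" G] that by (auto simp: C_def)
  show "x [^] p = \<one>" if "x \<in> carrier G" for x
    using in_G that by (simp add: in_G_def Let_def G_eq)
  show "p > 0" using p_gt_2 by simp
qed

lemma C_eq: "C = {lc M r n | r. \<forall>i. r i < p}"
  unfolding C_def by (rule generate_constants)

lemma lc_in_C: "lc M r n \<in> C"
  using lc_mod[of r] p_pos unfolding C_eq by (intro CollectI exI[of _ "\<lambda>i. r i mod p"]) auto

lemma C_exps:
  assumes "z \<in> C"
  obtains r where "r \<in> set (exps p n)" "z = lc M r n"
proof -
  obtain r where r: "z = lc M r n" "\<forall>i. r i < p" using assms by (auto simp: C_eq)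
  obtain s where "s \<in> set (exps p n)" "\<And>i. i \<in> {1..n} \<Longrightarrow> s i = r i"
    using exps_cover[of n r p] r(2) by auto
  moreover have "lc M s n = lc M r n" using calculation by (intro lc_cong) auto
  ultimately show thesis using that r by simp
qed

lemma finite_C: "finite C"
proof (rule finite_subset)
  show "C \<subseteq> (\<lambda>r. lc M r n) ` set (exps p n)" using C_exps by blast
qed simp

lemma C_central: "z \<in> C \<Longrightarrow> x \<in> carrier G \<Longrightarrow> z \<otimes> x = x \<otimes> z"
  using C_subset_center center_commutes by blast

lemma C_carrier: "z \<in> C \<Longrightarrow> z \<in> carrier G"
  using C_subset_center center_carrier by blast

lemma C_subgroup: "subgroup C G"
  unfolding C_def by (rule generate_is_subgroup) (use cst_center center_carrier in blast)

lemma cst_C: "i \<in> {1..n} \<Longrightarrow> cst M i \<in> C"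
  unfolding C_def by (rule generate.incl) simp

lemma C_one [simp]: "\<one> \<in> C"
  by (rule subgroup.one_closed[OF C_subgroup])

lemma C_mult [simp]: "x \<in> C \<Longrightarrow> y \<in> C \<Longrightarrow> x \<otimes> y \<in> C"
  by (rule subgroup.m_closed[OF C_subgroup])

lemma C_left_commute: "z \<in> C \<Longrightarrow> x \<in> carrier G \<Longrightarrow> y \<in> carrier G \<Longrightarrow> x \<otimes> (z \<otimes> y) = z \<otimes> (x \<otimes> y)"
  using C_central[of z x] C_carrier[of z] by (simp flip: m_assoc)

lemma C_pow [simp]: "z \<in> C \<Longrightarrow> z [^] (k::nat) \<in> C"
  by (induction k) auto

lemma C_mult_mult': "a \<in> C \<Longrightarrow> b \<in> C \<Longrightarrow> c \<in> C \<Longrightarrow> d \<in> C \<Longrightarrow>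
    (a \<otimes> b) \<otimes> (c \<otimes> d) = (a \<otimes> c) \<otimes> (b \<otimes> d)"
  using C_carrier by (simp add: m_assoc C_left_commute[of c b d])

lemma C_pow_mult: "x \<in> C \<Longrightarrow> y \<in> C \<Longrightarrow> (x \<otimes> y) [^] (k::nat) = x [^] k \<otimes> y [^] k"
proof (induction k)
  case (Suc k)
  have "(x \<otimes> y) [^] Suc k = (x [^] k \<otimes> y [^] k) \<otimes> (x \<otimes> y)" using Suc by simp
  also have "\<dots> = (x [^] k \<otimes> x) \<otimes> (y [^] k \<otimes> y)" using Suc.prems by (intro C_mult_mult') auto
  finally show ?case by simp
qed (simp add: C_carrier)

subsection \<open>Commutators\<close>

definition comm where "comm x y = x \<otimes> y \<otimes> inv x \<otimes> inv y"

lemma comm_in_C [simp]: "x \<in> carrier G \<Longrightarrow> y \<in> carrier G \<Longrightarrow> comm x y \<in> C"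
proof -
  assume "x \<in> carrier G" "y \<in> carrier G"
  then have "comm x y \<in> derived G (carrier G)"
    unfolding derived_def comm_def by (intro generate.incl) blast
  then show ?thesis using derived_subset_C by blast
qed

lemma comm_closed [simp]: "x \<in> carrier G \<Longrightarrow> y \<in> carrier G \<Longrightarrow> comm x y \<in> carrier G"
  using C_carrier comm_in_C by blast

lemma comm_swap: "x \<in> carrier G \<Longrightarrow> y \<in> carrier G \<Longrightarrow> x \<otimes> y = comm x y \<otimes> (y \<otimes> x)"
  by (simp add: comm_def m_assoc inv_mult_cancel)

lemma comm_left_commute:
  "u \<in> carrier G \<Longrightarrow> v \<in> carrier G \<Longrightarrow> x \<in> carrier G \<Longrightarrow> w \<in> carrier G \<Longrightarrow>
    x \<otimes> (comm u v \<otimes> w) = comm u v \<otimes> (x \<otimes> w)"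
  by (rule C_left_commute) auto

lemma comm_unique:
  assumes "x \<otimes> y = z \<otimes> (y \<otimes> x)" "x \<in> carrier G" "y \<in> carrier G" "z \<in> carrier G"
  shows "comm x y = z"
proof -
  have "comm x y \<otimes> (y \<otimes> x) = z \<otimes> (y \<otimes> x)" using comm_swap[of x y] assms by simp
  then show ?thesis using assms by simp
qed

text \<open>Moving \<open>z\<close> to the front past \<open>y\<close> and then past
  \<open>x\<close> leaves two factors that commute with everything; this is one half of the
  bilinearity of the commutator.\<close>

lemma comm_mult_left:
  assumes "x \<in> carrier G" "y \<in> carrier G" "z \<in> carrier G"
  shows "comm (x \<otimes> y) z = comm x z \<otimes> comm y z"
proof (rule comm_unique)
  have "x \<otimes> y \<otimes> z = x \<otimes> (comm y z \<otimes> (z \<otimes> y))"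
    using comm_swap[of y z] assms by (simp add: m_assoc)
  also have "\<dots> = comm y z \<otimes> ((x \<otimes> z) \<otimes> y)" using assms by (simp add: comm_left_commute m_assoc)
  also have "x \<otimes> z = comm x z \<otimes> (z \<otimes> x)" using assms by (intro comm_swap)
  also have "comm y z \<otimes> ((comm x z \<otimes> (z \<otimes> x)) \<otimes> y) = comm y z \<otimes> comm x z \<otimes> (z \<otimes> (x \<otimes> y))"
    using assms by (simp add: m_assoc)
  also have "comm y z \<otimes> comm x z = comm x z \<otimes> comm y z" using assms by (intro C_central) auto
  finally show "x \<otimes> y \<otimes> z = comm x z \<otimes> comm y z \<otimes> (z \<otimes> (x \<otimes> y))" .
qed (use assms in auto)

lemma comm_mult_right:
  assumes "x \<in> carrier G" "y \<in> carrier G" "z \<in> carrier G"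
  shows "comm x (y \<otimes> z) = comm x y \<otimes> comm x z"
proof (rule comm_unique)
  have "x \<otimes> (y \<otimes> z) = (comm x y \<otimes> (y \<otimes> x)) \<otimes> z"
    using comm_swap[of x y] assms by (simp only: m_assoc[symmetric])
  also have "\<dots> = comm x y \<otimes> (y \<otimes> (x \<otimes> z))" using assms by (simp add: m_assoc)
  also have "x \<otimes> z = comm x z \<otimes> (z \<otimes> x)" using assms by (intro comm_swap)
  also have "comm x y \<otimes> (y \<otimes> (comm x z \<otimes> (z \<otimes> x))) = comm x y \<otimes> comm x z \<otimes> (y \<otimes> z \<otimes> x)"
    using assms comm_left_commute[of x z y "z \<otimes> x"] by (simp add: m_assoc)
  finally show "x \<otimes> (y \<otimes> z) = comm x y \<otimes> comm x z \<otimes> (y \<otimes> z \<otimes> x)" .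
qed (use assms in auto)

lemma comm_C_left: "z \<in> C \<Longrightarrow> x \<in> carrier G \<Longrightarrow> comm z x = \<one>"
  by (rule comm_unique) (auto simp: C_central C_carrier)

lemma comm_C_right: "z \<in> C \<Longrightarrow> x \<in> carrier G \<Longrightarrow> comm x z = \<one>"
  by (rule comm_unique) (auto simp: C_central C_carrier)

lemma comm_self: "x \<in> carrier G \<Longrightarrow> comm x x = \<one>"
  by (rule comm_unique) auto

lemma comm_inv_swap: "x \<in> carrier G \<Longrightarrow> y \<in> carrier G \<Longrightarrow> comm y x = inv (comm x y)"
proof (rule comm_unique)
  assume "x \<in> carrier G" "y \<in> carrier G"
  then show "y \<otimes> x = inv (comm x y) \<otimes> (x \<otimes> y)"
    using comm_swap[of x y] by (simp add: inv_mult_cancel)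
qed auto

lemma comm_pow_left: "x \<in> carrier G \<Longrightarrow> y \<in> carrier G \<Longrightarrow> comm (x [^] (k::nat)) y = comm x y [^] k"
  by (induction k) (auto simp: comm_C_left comm_mult_left)

lemma pow_swap:
  assumes "x \<in> carrier G" "y \<in> carrier G"
  shows "x [^] (k::nat) \<otimes> y = comm x y [^] k \<otimes> y \<otimes> x [^] k"
  using comm_swap[of "x [^] k" y] assms by (simp add: comm_pow_left m_assoc)

subsection \<open>Subgroups containing the constants\<close>

text \<open>By \<open>sub_gn\<close> and \<open>gn_sub\<close> these are exactly the universes of
  substructures.\<close>

definition sub where "sub A \<longleftrightarrow> subgroup A G \<and> C \<subseteq> A"

lemma sub_carrier: "sub A \<Longrightarrow> x \<in> A \<Longrightarrow> x \<in> carrier G"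
  using subgroup.mem_carrier by (auto simp: sub_def)

lemma sub_subset: "sub A \<Longrightarrow> A \<subseteq> carrier G"
  using sub_carrier by blast

lemma sub_mult: "sub A \<Longrightarrow> x \<in> A \<Longrightarrow> y \<in> A \<Longrightarrow> x \<otimes> y \<in> A"
  using subgroup.m_closed by (auto simp: sub_def)

lemma sub_inv: "sub A \<Longrightarrow> x \<in> A \<Longrightarrow> inv x \<in> A"
  using subgroup.m_inv_closed by (auto simp: sub_def)

lemma sub_C: "sub A \<Longrightarrow> z \<in> C \<Longrightarrow> z \<in> A"
  by (auto simp: sub_def)

lemma sub_pow: "sub A \<Longrightarrow> x \<in> A \<Longrightarrow> x [^] (k::nat) \<in> A"
  by (induction k) (auto simp: sub_C sub_mult)

lemma pow_minus_one: "x \<in> carrier G \<Longrightarrow> x [^] (p - 1) = inv x"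
proof -
  assume x: "x \<in> carrier G"
  have "x [^] (p - 1) \<otimes> x = x [^] Suc (p - 1)" by simp
  also have "\<dots> = \<one>" using p_pos x pow_p by simp
  finally show ?thesis using x by (intro inv_equality[symmetric]) auto
qed

text \<open>Closure under inverses comes for free in a group of exponent \<open>p\<close>.\<close>

lemma subI:
  assumes "A \<subseteq> carrier G" "C \<subseteq> A" "\<And>x y. x \<in> A \<Longrightarrow> y \<in> A \<Longrightarrow> x \<otimes> y \<in> A"
  shows "sub A"
proof -
  have one: "\<one> \<in> A" using assms(2) C_one by blast
  have pow: "x [^] (k::nat) \<in> A" if "x \<in> A" for x k
    using that by (induction k) (auto intro: one assms(3))
  have "subgroup A G"
  proof
    show "inv x \<in> A" if "x \<in> A" for x
      using pow[OF that, of "p - 1"] pow_minus_one[of x] assms(1) that by auto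
  qed (use assms one in auto)
  then show ?thesis using assms(2) by (simp add: sub_def)
qed

lemma sub_fn_closed:
  assumes "sub A" "(f, length xs) \<in> L" "set xs \<subseteq> A"
  shows "fn M f xs \<in> A"
  using assms(2,3)
proof (induction rule: Lg_induct)
  case One
  then show ?case using sub_C[OF assms(1) C_one] by (simp add: one_eq)
next
  case (Inv x)
  then show ?case using sub_inv[OF assms(1)] sub_carrier[OF assms(1)] Inv_eq by auto
next
  case (Mul x y)
  then show ?case using sub_mult[OF assms(1)] by (simp flip: mult_eq)
next
  case (Cst i)
  then show ?case using sub_C[OF assms(1) cst_C] by (simp add: cst_def)
qed

lemma gen_sub_least: "sub A \<Longrightarrow> X \<subseteq> A \<Longrightarrow> gn X \<subseteq> A"
  by (rule gen_least) (auto intro: sub_fn_closed)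

lemma gn_carrier: "X \<subseteq> carrier G \<Longrightarrow> gn X \<subseteq> carrier G"
  using gen_subset[OF struct_M] by (simp add: carrier_eq)

lemma sub_gn: "X \<subseteq> carrier G \<Longrightarrow> sub (gn X)"
proof -
  assume X: "X \<subseteq> carrier G"
  have mult: "x \<otimes> y \<in> gn X" if "x \<in> gn X" "y \<in> gn X" for x y
    unfolding mult_eq using that by (intro gen_fn_closed) auto
  have "inv x \<in> gn X" if "x \<in> gn X" for x
    using gen_fn_closed[of Inv "[x]" L M X] that Inv_eq[of x] gn_carrier[OF X] by auto
  moreover have "\<one> \<in> gn X" unfolding one_eq by (intro gen_fn_closed) auto
  ultimately have sg: "subgroup (gn X) G"
    using gn_carrier[OF X] mult by unfold_locales auto
  have "cst M ` {1..n} \<subseteq> gn X" unfolding cst_def by (auto intro!: gen_fn_closed)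
  then have "C \<subseteq> gn X" unfolding C_def by (rule generate_subgroup_incl[OF _ sg])
  with sg show ?thesis by (simp add: sub_def)
qed

lemma gn_sub: "sub A \<Longrightarrow> gn A = A"
  using gen_sub_least[of A A] gen_incl[of A L M] by simp

lemma sub_C_self: "sub C"
  by (simp add: sub_def C_subgroup)

lemma gn_empty: "gn {} = C"
  using gen_sub_least[OF sub_C_self] sub_C[OF sub_gn] by blast

text \<open>The substructure generated by \<open>A\<close> and \<open>y\<close>, see
  \<open>gn_insert\<close>, with all powers of \<open>y\<close> collected on the right.\<close>

definition adj where "adj A y = {a \<otimes> y [^] k | a (k::nat). a \<in> A}"

lemma adjI: "a \<in> A \<Longrightarrow> a \<otimes> y [^] (k::nat) \<in> adj A y"
  by (auto simp: adj_def)

lemma adjE: "x \<in> adj A y \<Longrightarrow> (\<And>a k. a \<in> A \<Longrightarrow> x = a \<otimes> y [^] (k::nat) \<Longrightarrow> thesis) \<Longrightarrow> thesis"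
  by (auto simp: adj_def)

lemma adj_incl: "sub A \<Longrightarrow> A \<subseteq> adj A y"
  using adjI[of _ A y 0] sub_carrier by fastforce

lemma adj_self: "sub A \<Longrightarrow> y \<in> carrier G \<Longrightarrow> y \<in> adj A y"
  using adjI[of \<one> A y 1] sub_C[OF _ C_one] by auto

text \<open>Moving \<open>b\<close> to the left of \<open>y [^] i\<close> costs the central factor
  \<open>comm y b [^] i\<close>. The formula is also the model for the multiplication of
  \<open>split_ext\<close>.\<close>

lemma adj_mult:
  assumes "a \<in> carrier G" "b \<in> carrier G" "y \<in> carrier G"
  shows "(a \<otimes> y [^] (i::nat)) \<otimes> (b \<otimes> y [^] (j::nat)) = (a \<otimes> b \<otimes> comm y b [^] i) \<otimes> y [^] (i + j)"
proof -
  have "(a \<otimes> y [^] i) \<otimes> (b \<otimes> y [^] j) = a \<otimes> (y [^] i \<otimes> b) \<otimes> y [^] j"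
    using assms by (simp add: m_assoc)
  also have "y [^] i \<otimes> b = comm y b [^] i \<otimes> b \<otimes> y [^] i" using assms by (simp add: pow_swap)
  also have "comm y b [^] i \<otimes> b = b \<otimes> comm y b [^] i" using assms by (intro C_central) auto
  finally show ?thesis using assms by (simp add: m_assoc nat_pow_mult)
qed

lemma sub_adj:
  assumes A: "sub A" and y: "y \<in> carrier G"
  shows "sub (adj A y)"
proof (rule subI)
  show "adj A y \<subseteq> carrier G" using sub_carrier[OF A] y by (auto simp: adj_def)
  show "C \<subseteq> adj A y" using sub_C[OF A] adj_incl[OF A] by blast
  show "x \<otimes> z \<in> adj A y" if "x \<in> adj A y" "z \<in> adj A y" for x z
  proof -
    obtain a i where a: "a \<in> A" "x = a \<otimes> y [^] (i::nat)" using \<open>x \<in> adj A y\<close> by (rule adjE)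
    obtain b j where b: "b \<in> A" "z = b \<otimes> y [^] (j::nat)" using \<open>z \<in> adj A y\<close> by (rule adjE)
    have "x \<otimes> z = (a \<otimes> b \<otimes> comm y b [^] i) \<otimes> y [^] (i + j)"
      unfolding a(2) b(2) by (rule adj_mult) (use a b sub_carrier[OF A] y in auto)
    moreover have "a \<otimes> b \<otimes> comm y b [^] i \<in> A"
      by (rule sub_mult[OF A sub_mult[OF A] sub_C[OF A]]) (use a b sub_carrier[OF A] y in auto)
    ultimately show ?thesis using adjI by simp
  qed
qed

lemma adj_least: "sub B \<Longrightarrow> A \<subseteq> B \<Longrightarrow> y \<in> B \<Longrightarrow> adj A y \<subseteq> B"
  by (auto elim!: adjE intro!: sub_mult sub_pow)

lemma gn_insert:
  assumes "X \<subseteq> carrier G" "y \<in> carrier G"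
  shows "gn (insert y X) = adj (gn X) y"
proof
  note s = sub_gn[OF assms(1)]
  show "gn (insert y X) \<subseteq> adj (gn X) y"
    using gen_incl[of X L M] adj_incl[OF s, of y] adj_self[OF s assms(2)]
    by (intro gen_sub_least sub_adj s assms) auto
  show "adj (gn X) y \<subseteq> gn (insert y X)"
    using assms by (intro adj_least sub_gn gen_mono) (auto intro: gen.base)
qed

lemma adj_mod: "y \<in> carrier G \<Longrightarrow> adj A y = (\<lambda>(a, k). a \<otimes> y [^] k) ` (A \<times> {..<p})"
proof (intro equalityI subsetI)
  fix x assume y: "y \<in> carrier G" and "x \<in> adj A y"
  then obtain a k where a: "a \<in> A" "x = a \<otimes> y [^] (k::nat)" by (elim adjE)
  then have "x = a \<otimes> y [^] (k mod p)" using y by (simp add: pow_mod)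
  with a p_pos show "x \<in> (\<lambda>(a, k). a \<otimes> y [^] k) ` (A \<times> {..<p})"
    by (intro image_eqI[of _ _ "(a, k mod p)"]) auto
qed (auto intro: adjI)

lemma finite_gn: "finite X \<Longrightarrow> X \<subseteq> carrier G \<Longrightarrow> finite (gn X)"
proof (induction X rule: finite_induct)
  case empty
  then show ?case by (simp add: gn_empty finite_C)
next
  case (insert y X)
  then show ?case by (simp add: gn_insert adj_mod)
qed

lemma sub_set_mult:
  assumes A: "sub A" and B: "sub B"
  shows "sub (A <#> B)"
proof (rule subI)
  show "A <#> B \<subseteq> carrier G" using sub_carrier[OF A] sub_carrier[OF B] by (auto simp: set_mult_def)
  show "C \<subseteq> A <#> B"
  proof
    fix z assume z: "z \<in> C"
    then have "z = z \<otimes> \<one>" using C_carrier by simp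
    then show "z \<in> A <#> B" using sub_C[OF A z] sub_C[OF B C_one] unfolding set_mult_def by blast
  qed
  fix x y assume "x \<in> A <#> B" "y \<in> A <#> B"
  then obtain a b a' b' where ab: "a \<in> A" "b \<in> B" "x = a \<otimes> b" "a' \<in> A" "b' \<in> B" "y = a' \<otimes> b'"
    by (auto simp: set_mult_def)
  have c: "a \<in> carrier G" "b \<in> carrier G" "a' \<in> carrier G" "b' \<in> carrier G"
    using ab sub_carrier A B by auto
  have "x \<otimes> y = a \<otimes> (b \<otimes> a') \<otimes> b'" using ab c by (simp add: m_assoc)
  also have "\<dots> = a \<otimes> (comm b a' \<otimes> (a' \<otimes> b)) \<otimes> b'" using comm_swap[of b a'] c by simp
  also have "\<dots> = (comm b a' \<otimes> (a \<otimes> a')) \<otimes> (b \<otimes> b')"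
    using c by (simp add: m_assoc comm_left_commute)
  finally show "x \<otimes> y \<in> A <#> B"
    unfolding set_mult_def using sub_mult[OF A sub_C[OF A comm_in_C[OF c(2,3)]] sub_mult[OF A ab(1,4)]]
      sub_mult[OF B ab(2,5)] by blast
qed

lemma gn_Un:
  assumes "X \<subseteq> carrier G" "Y \<subseteq> carrier G"
  shows "gn (X \<union> Y) = gn X <#> gn Y"
proof
  note X = sub_gn[OF assms(1)] and Y = sub_gn[OF assms(2)]
  have "X \<subseteq> gn X <#> gn Y"
  proof
    fix x assume x: "x \<in> X"
    then have "x = x \<otimes> \<one>" using assms by auto
    then show "x \<in> gn X <#> gn Y"
      using gen.base[OF x] sub_C[OF Y C_one] unfolding set_mult_def by blast
  qed
  moreover have "Y \<subseteq> gn X <#> gn Y"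
  proof
    fix x assume x: "x \<in> Y"
    then have "x = \<one> \<otimes> x" using assms by auto
    then show "x \<in> gn X <#> gn Y"
      using gen.base[OF x] sub_C[OF X C_one] unfolding set_mult_def by blast
  qed
  ultimately show "gn (X \<union> Y) \<subseteq> gn X <#> gn Y"
    by (intro gen_sub_least sub_set_mult X Y) auto
  show "gn X <#> gn Y \<subseteq> gn (X \<union> Y)"
    using sub_mult[OF sub_gn[of "X \<union> Y"]] gen_mono[of X "X \<union> Y" L M] gen_mono[of Y "X \<union> Y" L M] assms
    unfolding set_mult_def by blast
qed

text \<open>If \<open>k\<close> were prime to \<open>p\<close>, it would be invertible modulo
  \<open>p\<close>, and \<open>y\<close> would be a power of \<open>y [^] k\<close>.\<close>

lemma pow_not_in:
  assumes A: "sub A" and y: "y \<in> carrier G" "y \<notin> A" and k: "y [^] (k::nat) \<in> A"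
  shows "p dvd k"
proof (rule ccontr)
  assume nd: "\<not> p dvd k"
  then have "coprime k p" using prime_imp_coprime[OF prime_p nd] by (simp add: coprime_commute)
  moreover have "k \<noteq> 0" using nd by (metis dvd_0_right)
  ultimately obtain u v where uv: "k * u = p * v + 1"
    using bezout_nat[of k p] by (auto simp: coprime_iff_gcd_eq_1)
  have "(y [^] k) [^] u = y [^] (p * v + 1)" using y by (simp only: nat_pow_pow uv)
  also have "\<dots> = (y [^] p) [^] v \<otimes> y" using y by (simp add: nat_pow_pow)
  also have "\<dots> = y" using y by (simp add: pow_p)
  finally show False using sub_pow[OF A k, of u] y by simp
qed

lemma adj_unique:
  assumes A: "sub A" and y: "y \<in> carrier G" "y \<notin> A" and ab: "a \<in> A" "b \<in> A"
    and eq: "a \<otimes> y [^] (i::nat) = b \<otimes> y [^] (j::nat)"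
  shows "i mod p = j mod p \<and> a = b"
proof -
  have c: "a \<in> carrier G" "b \<in> carrier G" using ab sub_carrier[OF A] by auto
  have "inv b \<otimes> a = inv b \<otimes> (a \<otimes> y [^] i) \<otimes> inv (y [^] i)" using c y by (simp add: m_assoc)
  also have "\<dots> = y [^] j \<otimes> inv (y [^] i)" using c y by (simp add: eq inv_mult_cancel)
  \<comment> \<open>The inverse is written with a natural exponent so that \<open>pow_not_in\<close>
    applies.\<close>
  also have "inv (y [^] i) = y [^] (i * (p - 1))"
    using y pow_minus_one[of "y [^] i"] by (simp add: nat_pow_pow)
  also have "y [^] j \<otimes> y [^] (i * (p - 1)) = y [^] (j + i * (p - 1))" using y by (simp add: nat_pow_mult)
  finally have "y [^] (j + i * (p - 1)) \<in> A" using sub_mult[OF A sub_inv[OF A ab(2)] ab(1)] by simp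
  then have "p dvd j + i * (p - 1)" using A y by (intro pow_not_in)
  moreover have "i + (j + i * (p - 1)) = j + i * p" using p_pos by (cases p) (auto simp: algebra_simps)
  ultimately have ij: "i mod p = j mod p"
    by (metis mod_mult_self1 mod_mod_trivial dvd_eq_mod_eq_0 mod_add_right_eq add_0_right)
  then have "y [^] i = y [^] j" using y pow_mod[of y i] pow_mod[of y j] by simp
  then show ?thesis using eq c y ij by simp
qed

text \<open>By uniqueness of the normal form, a function on \<open>adj A y\<close> may be prescribed
  on the pairs \<open>(a, i)\<close> as long as it respects \<open>i\<close> modulo
  \<open>p\<close>. Characters and isomorphisms on \<open>adj A y\<close> are both built in this
  way.\<close>

lemma adj_function:
  assumes A: "sub A" and y: "y \<in> carrier G" "y \<notin> A"
    and F: "\<And>a i. a \<in> A \<Longrightarrow> F a (i mod p) = F a i"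
  obtains h where "\<And>a i. a \<in> A \<Longrightarrow> h (a \<otimes> y [^] (i::nat)) = F a i"
proof -
  define rep where "rep x = (SOME (a, i). a \<in> A \<and> x = a \<otimes> y [^] (i::nat))" for x
  have "(case rep (a \<otimes> y [^] i) of (b, j) \<Rightarrow> F b j) = F a i" if a: "a \<in> A" for a i
  proof -
    obtain b j where bj: "rep (a \<otimes> y [^] i) = (b, j)" by force
    have "case rep (a \<otimes> y [^] i) of (b, j) \<Rightarrow> b \<in> A \<and> a \<otimes> y [^] i = b \<otimes> y [^] j"
      unfolding rep_def by (rule someI[of _ "(a, i)"]) (use a in simp)
    then have "b \<in> A" "a \<otimes> y [^] i = b \<otimes> y [^] j" by (auto simp: bj)
    then have "i mod p = j mod p \<and> a = b" using A y a by (intro adj_unique)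
    then show ?thesis using F[OF a, of i] F[OF a, of j] bj by simp
  qed
  then show thesis by (rule that)
qed

subsection \<open>Characters and partial isomorphisms\<close>

text \<open>The candidates for the map \<open>comm x\<close> on \<open>A\<close>, compare
  \<open>chr_comm\<close>. When \<open>A\<close> is a substructure, they are the linear maps from
  the vector space \<open>A\<close> modulo \<open>C\<close> to \<open>C\<close>.\<close>

definition chr where
  "chr A f \<longleftrightarrow> (\<forall>a\<in>A. f a \<in> C) \<and> (\<forall>a\<in>A. \<forall>b\<in>A. f (a \<otimes> b) = f a \<otimes> f b) \<and> (\<forall>z\<in>C. f z = \<one>)"

lemma chr_in_C: "chr A f \<Longrightarrow> a \<in> A \<Longrightarrow> f a \<in> C"
  and chr_mult: "chr A f \<Longrightarrow> a \<in> A \<Longrightarrow> b \<in> A \<Longrightarrow> f (a \<otimes> b) = f a \<otimes> f b"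
  and chr_C: "chr A f \<Longrightarrow> z \<in> C \<Longrightarrow> f z = \<one>"
  by (auto simp: chr_def)

lemma chr_mono: "chr B f \<Longrightarrow> A \<subseteq> B \<Longrightarrow> chr A f"
  unfolding chr_def by blast

lemma chr_comm: "x \<in> carrier G \<Longrightarrow> sub A \<Longrightarrow> chr A (comm x)"
  using sub_carrier[of A] by (auto simp: chr_def comm_mult_right comm_C_right)

lemma chr_inv:
  assumes "chr A f" "sub A" "a \<in> A"
  shows "f (inv a) = inv (f a)"
proof -
  have "f (inv a) \<otimes> f a = f (inv a \<otimes> a)" using assms sub_inv by (simp add: chr_mult)
  also have "\<dots> = \<one>" using assms sub_carrier by (auto simp: chr_C)
  finally show ?thesis
    using assms sub_inv[of A a] chr_in_C[of A f] C_carrier by (intro inv_equality[symmetric]) auto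
qed

text \<open>The value at the new element can be chosen at will: \<open>w\<close> has exponent
  \<open>p\<close>, and the commutator that appears when a product is brought into normal form is
  killed by \<open>f\<close>.\<close>

lemma chr_adj:
  assumes A: "sub A" and f: "chr A f" and y: "y \<in> carrier G" "y \<notin> A" and w: "w \<in> C"
  obtains g where "chr (adj A y) g" "\<And>a. a \<in> A \<Longrightarrow> g a = f a" "g y = w"
proof -
  have "f a \<otimes> w [^] (i mod p) = f a \<otimes> w [^] i" for a i using w C_carrier by (simp add: pow_mod)
  then obtain g where g: "\<And>a i. a \<in> A \<Longrightarrow> g (a \<otimes> y [^] (i::nat)) = f a \<otimes> w [^] i"
    using adj_function[OF A y, of "\<lambda>a i. f a \<otimes> w [^] i"] by blast
  have gA: "g a = f a" if "a \<in> A" for a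
    using g[OF that, of 0] that sub_carrier[OF A] chr_in_C[OF f] C_carrier by simp
  have gy: "g y = w"
    using g[OF sub_C[OF A C_one], of 1] y w C_carrier chr_C[OF f] by simp
  have "chr (adj A y) g"
    unfolding chr_def
  proof (intro conjI ballI)
    fix x assume "x \<in> adj A y"
    then show "g x \<in> C" using g chr_in_C[OF f] w by (auto elim!: adjE)
  next
    fix z assume "z \<in> C"
    then show "g z = \<one>" using gA sub_C[OF A] chr_C[OF f] by simp
  next
    fix x z assume "x \<in> adj A y" and "z \<in> adj A y"
    obtain a i where a: "a \<in> A" "x = a \<otimes> y [^] (i::nat)" using \<open>x \<in> adj A y\<close> by (rule adjE)
    obtain b j where b: "b \<in> A" "z = b \<otimes> y [^] (j::nat)" using \<open>z \<in> adj A y\<close> by (rule adjE)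
    have c: "a \<in> carrier G" "b \<in> carrier G" using a b sub_carrier[OF A] by auto
    have e: "x \<otimes> z = (a \<otimes> b \<otimes> comm y b [^] i) \<otimes> y [^] (i + j)"
      unfolding a(2) b(2) by (rule adj_mult) (use c y in auto)
    have k: "comm y b [^] i \<in> C" using c y by simp
    have "a \<otimes> b \<otimes> comm y b [^] i \<in> A" by (intro sub_mult[OF A] a b sub_C[OF A k])
    then have "g (x \<otimes> z) = f (a \<otimes> b \<otimes> comm y b [^] i) \<otimes> w [^] (i + j)" unfolding e by (rule g)
    also have "f (a \<otimes> b \<otimes> comm y b [^] i) = f a \<otimes> f b"
      using a b f k sub_mult[OF A] sub_C[OF A k] chr_in_C[OF f] C_carrier by (simp add: chr_mult chr_C)
    also have "w [^] (i + j) = w [^] i \<otimes> w [^] j" using w C_carrier by (simp add: nat_pow_mult)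
    also have "f a \<otimes> f b \<otimes> (w [^] i \<otimes> w [^] j) = (f a \<otimes> w [^] i) \<otimes> (f b \<otimes> w [^] j)"
      using a b chr_in_C[OF f] w by (intro C_mult_mult') auto
    also have "\<dots> = g x \<otimes> g z" using g a b by simp
    finally show "g (x \<otimes> z) = g x \<otimes> g z" .
  qed
  then show thesis using that gA gy by blast
qed

text \<open>Generators are added one at a time, each new one with value
  \<open>\<one>\<close>.\<close>

lemma chr_extend:
  assumes X: "X \<subseteq> carrier G" and f: "chr (gn X) f" and S: "finite S" "S \<subseteq> carrier G"
  obtains g where "chr (gn (X \<union> S)) g" "\<And>a. a \<in> gn X \<Longrightarrow> g a = f a"
proof -
  have "\<exists>g. chr (gn (X \<union> S)) g \<and> (\<forall>a\<in>gn X. g a = f a)"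
    using S
  proof (induction S rule: finite_induct)
    case empty
    then show ?case using f by auto
  next
    case (insert y S)
    then obtain g where g: "chr (gn (X \<union> S)) g" "\<forall>a\<in>gn X. g a = f a" by auto
    have XS: "X \<union> S \<subseteq> carrier G" and y: "y \<in> carrier G" using X insert by auto
    have e: "gn (X \<union> insert y S) = adj (gn (X \<union> S)) y" using gn_insert[OF XS y] by simp
    have m: "gn X \<subseteq> gn (X \<union> S)" by (intro gen_mono) auto
    show ?case
    proof (cases "y \<in> gn (X \<union> S)")
      case True
      then have "adj (gn (X \<union> S)) y \<subseteq> gn (X \<union> S)" using XS by (intro adj_least sub_gn) auto
      then show ?thesis using g e chr_mono by metis
    next
      case False
      obtain h where "chr (adj (gn (X \<union> S)) y) h" "\<And>a. a \<in> gn (X \<union> S) \<Longrightarrow> h a = g a"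
        using chr_adj[OF sub_gn[OF XS] g(1) y False C_one] by blast
      then show ?thesis using e g m by (intro exI[of _ h]) auto
    qed
  qed
  then show thesis using that by blast
qed

text \<open>If \<open>a \<otimes> b = a' \<otimes> b'\<close>, then
  \<open>inv a' \<otimes> a = b' \<otimes> inv b\<close> lies in both \<open>A\<close> and
  \<open>B\<close>, where the two characters agree. So \<open>f a \<otimes> g b\<close> depends only
  on the product.\<close>

lemma chr_amalgam:
  assumes A: "sub A" and B: "sub B" and f: "chr A f" and g: "chr B g"
    and agree: "\<And>x. x \<in> A \<Longrightarrow> x \<in> B \<Longrightarrow> f x = g x"
  obtains h where "chr (A <#> B) h" "\<And>a. a \<in> A \<Longrightarrow> h a = f a" "\<And>b. b \<in> B \<Longrightarrow> h b = g b"
proof -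
  define rep where "rep x = (SOME (a, b). a \<in> A \<and> b \<in> B \<and> x = a \<otimes> b)" for x
  define h where "h x = (case rep x of (a, b) \<Rightarrow> f a \<otimes> g b)" for x
  note cA = sub_carrier[OF A] and cB = sub_carrier[OF B]
  have fC: "f a \<in> C" "f a \<in> carrier G" if "a \<in> A" for a using chr_in_C[OF f that] C_carrier by auto
  have gC: "g b \<in> C" "g b \<in> carrier G" if "b \<in> B" for b using chr_in_C[OF g that] C_carrier by auto
  have h: "h (a \<otimes> b) = f a \<otimes> g b" if ab: "a \<in> A" "b \<in> B" for a b
  proof -
    obtain a' b' where r: "rep (a \<otimes> b) = (a', b')" by force
    have "case rep (a \<otimes> b) of (a', b') \<Rightarrow> a' \<in> A \<and> b' \<in> B \<and> a \<otimes> b = a' \<otimes> b'"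
      unfolding rep_def by (rule someI[of _ "(a, b)"]) (use ab in simp)
    then have ab': "a' \<in> A" "b' \<in> B" "a \<otimes> b = a' \<otimes> b'" by (auto simp: r)
    note c = cA[OF ab(1)] cA[OF ab'(1)] cB[OF ab(2)] cB[OF ab'(2)]
    have "inv a' \<otimes> a = inv a' \<otimes> (a \<otimes> b) \<otimes> inv b" using c by (simp add: m_assoc)
    also have "\<dots> = b' \<otimes> inv b" using c ab'(3) by (simp add: inv_mult_cancel)
    finally have e: "inv a' \<otimes> a = b' \<otimes> inv b" .
    have "f (inv a' \<otimes> a) = g (b' \<otimes> inv b)"
      unfolding e by (rule agree)
        (use e sub_mult[OF A sub_inv[OF A ab'(1)] ab(1)] sub_mult[OF B ab'(2) sub_inv[OF B ab(2)]] in auto)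
    then have "inv (f a') \<otimes> f a = g b' \<otimes> inv (g b)"
      using ab ab' by (simp add: chr_mult[OF f] chr_mult[OF g] chr_inv[OF f A] chr_inv[OF g B]
          sub_inv[OF A] sub_inv[OF B])
    then have "f a' \<otimes> (inv (f a') \<otimes> f a) \<otimes> g b = f a' \<otimes> (g b' \<otimes> inv (g b)) \<otimes> g b" by simp
    then have "f a \<otimes> g b = f a' \<otimes> g b'"
      using fC gC ab ab' by (simp add: m_assoc inv_mult_cancel)
    then show ?thesis by (simp add: h_def r)
  qed
  have hA: "h a = f a" if "a \<in> A" for a
    using h[OF that sub_C[OF B C_one]] that cA fC chr_C[OF g] by simp
  have hB: "h b = g b" if "b \<in> B" for b
    using h[OF sub_C[OF A C_one] that] that cB gC chr_C[OF f] by simp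
  have "chr (A <#> B) h"
    unfolding chr_def
  proof (intro conjI ballI)
    fix x assume "x \<in> A <#> B"
    then show "h x \<in> C" using h fC gC by (auto simp: set_mult_def)
  next
    fix z assume "z \<in> C"
    then show "h z = \<one>" using hA sub_C[OF A] chr_C[OF f] by simp
  next
    fix x y assume "x \<in> A <#> B" "y \<in> A <#> B"
    then obtain a b a' b' where ab: "a \<in> A" "b \<in> B" "x = a \<otimes> b" "a' \<in> A" "b' \<in> B" "y = a' \<otimes> b'"
      by (auto simp: set_mult_def)
    note c = cA[OF ab(1)] cA[OF ab(4)] cB[OF ab(2)] cB[OF ab(5)]
    have k: "comm b a' \<in> C" using c by simp
    have "x \<otimes> y = a \<otimes> (b \<otimes> a') \<otimes> b'" using ab c by (simp add: m_assoc)
    also have "\<dots> = a \<otimes> (comm b a' \<otimes> (a' \<otimes> b)) \<otimes> b'" using comm_swap[of b a'] c by simp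
    also have "\<dots> = (comm b a' \<otimes> (a \<otimes> a')) \<otimes> (b \<otimes> b')"
      using c by (simp add: m_assoc comm_left_commute)
    finally have e: "x \<otimes> y = (comm b a' \<otimes> (a \<otimes> a')) \<otimes> (b \<otimes> b')" .
    have "h (x \<otimes> y) = f (comm b a' \<otimes> (a \<otimes> a')) \<otimes> g (b \<otimes> b')"
      unfolding e by (rule h) (use ab k in \<open>auto intro: sub_mult[OF A] sub_mult[OF B] sub_C[OF A]\<close>)
    also have "f (comm b a' \<otimes> (a \<otimes> a')) = f a \<otimes> f a'"
      using ab k fC by (simp add: chr_mult[OF f] sub_mult[OF A] sub_C[OF A] chr_C[OF f])
    also have "g (b \<otimes> b') = g b \<otimes> g b'" using ab by (simp add: chr_mult[OF g])
    also have "f a \<otimes> f a' \<otimes> (g b \<otimes> g b') = (f a \<otimes> g b) \<otimes> (f a' \<otimes> g b')"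
      using ab fC gC by (intro C_mult_mult') auto
    also have "\<dots> = h x \<otimes> h y" using h ab by simp
    finally show "h (x \<otimes> y) = h x \<otimes> h y" .
  qed
  then show thesis using that hA hB by blast
qed

text \<open>Multiplicativity together with fixing \<open>C\<close> pointwise is enough for
  preserving inverses and constants as well, see \<open>piso_fn\<close>.\<close>

definition piso where
  "piso A B h \<longleftrightarrow> sub A \<and> sub B \<and> bij_betw h A B \<and>
     (\<forall>x\<in>A. \<forall>y\<in>A. h (x \<otimes> y) = h x \<otimes> h y) \<and> (\<forall>z\<in>C. h z = z)"

lemma pisoD:
  assumes "piso A B h"
  shows "sub A" "sub B" "bij_betw h A B" "inj_on h A" "h ` A = B"
    "\<And>x. x \<in> A \<Longrightarrow> h x \<in> B"
    "\<And>x y. x \<in> A \<Longrightarrow> y \<in> A \<Longrightarrow> h (x \<otimes> y) = h x \<otimes> h y" "\<And>z. z \<in> C \<Longrightarrow> h z = z"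
  using assms by (auto simp: piso_def bij_betw_def)

lemma piso_inv:
  assumes h: "piso A B h" and x: "x \<in> A"
  shows "h (inv x) = inv (h x)"
proof -
  note d = pisoD[OF h]
  have "h (inv x) \<otimes> h x = h (inv x \<otimes> x)" using d(7)[of "inv x" x] x sub_inv[OF d(1)] by simp
  also have "inv x \<otimes> x = \<one>" using x sub_carrier[OF d(1)] by simp
  finally have "h (inv x) \<otimes> h x = \<one>" using d(8)[OF C_one] by simp
  then show ?thesis
    using d(6)[OF x] d(6)[OF sub_inv[OF d(1) x]] sub_carrier[OF d(2)]
    by (intro inv_equality[symmetric]) auto
qed

lemma piso_fn:
  assumes h: "piso A B h" and "(f, length xs) \<in> L" "set xs \<subseteq> A"
  shows "fn M f (map h xs) = h (fn M f xs)"
  using assms(2,3)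
proof (induction rule: Lg_induct)
  note d = pisoD[OF h]
  {
    case One
    then show ?case using d(8)[OF C_one] by (simp add: one_eq)
  next
    case (Inv x)
    then show ?case
      using piso_inv[OF h, of x] Inv_eq[of x] Inv_eq[of "h x"] d sub_carrier by simp
  next
    case (Mul x y)
    then show ?case using d(7)[of x y] by (simp add: mult_eq)
  next
    case (Cst i)
    then show ?case using d(8)[OF cst_C] by (simp add: cst_def)
  }
qed

lemma piso_evalt:
  assumes h: "piso A B h"
  shows "wf_trm L t \<Longrightarrow> e ` vars_trm t \<subseteq> A \<Longrightarrow> evalt M (h \<circ> e) t = h (evalt M e t)"
proof (induction t)
  case (Fun f ts)
  note d = pisoD[OF h]
  have ih: "map (evalt M (h \<circ> e)) ts = map h (map (evalt M e) ts)" using Fun by fastforce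
  have "set (map (evalt M e) ts) \<subseteq> A"
  proof -
    have "evalt M e t \<in> A" if "t \<in> set ts" for t
      using evalt_in_gen[of L t e A M] gn_sub[OF d(1)] Fun.prems that by fastforce
    then show ?thesis by auto
  qed
  moreover have "(f, length (map (evalt M e) ts)) \<in> L" using Fun.prems by simp
  ultimately have "fn M f (map h (map (evalt M e) ts)) = h (fn M f (map (evalt M e) ts))"
    by (intro piso_fn[OF h])
  then show ?case using ih by (simp only: evalt.simps)
qed simp

lemma piso_sym:
  assumes h: "piso A B h"
  shows "piso B A (inv_into A h)"
proof -
  note d = pisoD[OF h]
  let ?k = "inv_into A h"
  have k: "?k x \<in> A" "h (?k x) = x" if "x \<in> B" for x
    using that d(5) by (auto simp: inv_into_into f_inv_into_f)
  have kh: "?k (h x) = x" if "x \<in> A" for x using that d(4) by simp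
  have "?k (x \<otimes> y) = ?k x \<otimes> ?k y" if "x \<in> B" "y \<in> B" for x y
    using d(7)[of "?k x" "?k y"] k[OF that(1)] k[OF that(2)] kh[of "?k x \<otimes> ?k y"] sub_mult[OF d(1)] by simp
  moreover have "?k z = z" if "z \<in> C" for z using kh[of z] d(8)[OF that] sub_C[OF d(1) that] by simp
  ultimately show ?thesis using d bij_betw_inv_into[OF d(3)] by (simp add: piso_def)
qed

lemma piso_id: "sub A \<Longrightarrow> piso A A id"
  by (simp add: piso_def)

lemma piso_restrict:
  assumes h: "piso A B h" and A': "sub A'" "A' \<subseteq> A"
  shows "piso A' (h ` A') h"
proof -
  note d = pisoD[OF h]
  have "sub (h ` A')"
  proof (rule subI)
    show "h ` A' \<subseteq> carrier G" using d sub_carrier[OF d(2)] A' by blast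
    show "C \<subseteq> h ` A'" using d(8) sub_C[OF A'(1)] by (metis image_eqI subsetI)
    show "x \<otimes> y \<in> h ` A'" if xy: "x \<in> h ` A'" "y \<in> h ` A'" for x y
    proof -
      obtain u v where uv: "u \<in> A'" "v \<in> A'" "x = h u" "y = h v" using xy by blast
      then have "x \<otimes> y = h (u \<otimes> v)" using d(7)[OF subsetD[OF A'(2)] subsetD[OF A'(2)]] by simp
      then show ?thesis using sub_mult[OF A'(1) uv(1,2)] by simp
    qed
  qed
  moreover have "inj_on h A'" using d(4) A' inj_on_subset by blast
  moreover have "h (x \<otimes> y) = h x \<otimes> h y" if "x \<in> A'" "y \<in> A'" for x y
    using that A'(2) by (intro d(7)) auto
  ultimately show ?thesis using d(8) A' by (auto simp: piso_def bij_betw_def)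
qed

lemma piso_image_gn:
  assumes h: "piso A B h" and X: "X \<subseteq> A"
  shows "h ` gn X = gn (h ` X)"
proof
  note d = pisoD[OF h]
  have c: "X \<subseteq> carrier G" "h ` X \<subseteq> carrier G" using X d sub_carrier by blast+
  have A: "gn X \<subseteq> A" by (rule gen_sub_least[OF d(1) X])
  have "sub (h ` gn X)" using pisoD(2)[OF piso_restrict[OF h sub_gn[OF c(1)] A]] .
  then show "gn (h ` X) \<subseteq> h ` gn X" using gen_incl[of X L M] by (intro gen_sub_least) auto
  show "h ` gn X \<subseteq> gn (h ` X)"
  proof (clarify)
    fix x assume "x \<in> gn X"
    then have "x \<in> gn (id ` X)" by simp
    have "x \<in> {x \<in> A. h x \<in> gn (h ` X)}"
    proof (rule subsetD[OF gen_sub_least \<open>x \<in> gn X\<close>])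
      show "sub {x \<in> A. h x \<in> gn (h ` X)}"
        using sub_subset[OF d(1)] d(7,8) sub_mult[OF d(1)] sub_C[OF d(1)] sub_mult[OF sub_gn[OF c(2)]]
          sub_C[OF sub_gn[OF c(2)]]
        by (intro subI) auto
      show "X \<subseteq> {x \<in> A. h x \<in> gn (h ` X)}" using X gen_incl[of "h ` X" L M] by auto
    qed
    then show "h x \<in> gn (h ` X)" by simp
  qed
qed

text \<open>Products of normal forms depend on \<open>a\<close> only through its commutators with
  \<open>A\<close>. When \<open>b\<close> has the corresponding commutators with \<open>B\<close>,
  sending \<open>a\<close> to \<open>b\<close> transports \<open>adj_mult\<close>. This is why a
  character determines a new element up to isomorphism over \<open>A\<close>.\<close>

lemma piso_adj:
  assumes h: "piso A B h" and a: "a \<in> carrier G" "a \<notin> A" and b: "b \<in> carrier G" "b \<notin> B"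
    and cm: "\<And>y. y \<in> A \<Longrightarrow> comm b (h y) = comm a y"
  obtains k where "piso (adj A a) (adj B b) k" "\<And>x. x \<in> A \<Longrightarrow> k x = h x" "k a = b"
proof -
  note d = pisoD[OF h]
  note cA = sub_carrier[OF d(1)] and cB = sub_carrier[OF d(2)]
  have "h x \<otimes> b [^] (i mod p) = h x \<otimes> b [^] i" for x i using b by (simp add: pow_mod)
  then obtain k where k: "\<And>x i. x \<in> A \<Longrightarrow> k (x \<otimes> a [^] (i::nat)) = h x \<otimes> b [^] i"
    using adj_function[OF d(1) a, of "\<lambda>x i. h x \<otimes> b [^] i"] by blast
  have kA: "k x = h x" if "x \<in> A" for x
    using k[OF that, of 0] that cA cB d(6) by simp
  have ka: "k a = b"
    using k[OF sub_C[OF d(1) C_one], of 1] a b d(8)[OF C_one] by simp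
  have "inj_on k (adj A a)"
  proof (rule inj_onI)
    fix x y assume x: "x \<in> adj A a" and y: "y \<in> adj A a" and eq: "k x = k y"
    obtain u i where u: "u \<in> A" "x = u \<otimes> a [^] (i::nat)" using x by (rule adjE)
    obtain v j where v: "v \<in> A" "y = v \<otimes> a [^] (j::nat)" using y by (rule adjE)
    have "h u \<otimes> b [^] i = h v \<otimes> b [^] j" using eq k u v by simp
    then have e: "i mod p = j mod p" "h u = h v"
      using adj_unique[OF d(2) b] d(6) u v by blast+
    then have "u = v" using d(4) u v by (simp add: inj_on_eq_iff)
    moreover have "a [^] i = a [^] j" using e(1) pow_mod[of a i] pow_mod[of a j] a by simp
    ultimately show "x = y" using u v by simp
  qed
  moreover have "k ` adj A a = adj B b"
  proof (intro equalityI subsetI)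
    fix x assume "x \<in> k ` adj A a"
    then show "x \<in> adj B b" using adjI[OF d(6)] by (auto elim!: adjE simp: k)
  next
    fix x assume "x \<in> adj B b"
    then obtain v j where v: "v \<in> B" "x = v \<otimes> b [^] (j::nat)" by (rule adjE)
    then obtain u where "u \<in> A" "v = h u" using d(5) by blast
    then have "x = k (u \<otimes> a [^] j)" using k v by simp
    then show "x \<in> k ` adj A a" using adjI[OF \<open>u \<in> A\<close>] by blast
  qed
  moreover have "k (x \<otimes> y) = k x \<otimes> k y" if x: "x \<in> adj A a" and y: "y \<in> adj A a" for x y
  proof -
    obtain u i where u: "u \<in> A" "x = u \<otimes> a [^] (i::nat)" using x by (rule adjE)
    obtain v j where v: "v \<in> A" "y = v \<otimes> a [^] (j::nat)" using y by (rule adjE)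
    have kC: "comm a v [^] i \<in> C" using a cA[OF v(1)] by simp
    have e: "x \<otimes> y = (u \<otimes> v \<otimes> comm a v [^] i) \<otimes> a [^] (i + j)"
      unfolding u(2) v(2) by (rule adj_mult) (use cA u v a in auto)
    have "k (x \<otimes> y) = h (u \<otimes> v \<otimes> comm a v [^] i) \<otimes> b [^] (i + j)"
      unfolding e by (rule k) (intro sub_mult[OF d(1)] u v sub_C[OF d(1) kC])
    also have "h (u \<otimes> v \<otimes> comm a v [^] i) = h u \<otimes> h v \<otimes> comm b (h v) [^] i"
      using u v kC sub_C[OF d(1) kC] sub_mult[OF d(1)] cm by (simp add: d(7) d(8))
    also have "\<dots> \<otimes> b [^] (i + j) = (h u \<otimes> b [^] i) \<otimes> (h v \<otimes> b [^] j)"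
      by (rule adj_mult[symmetric]) (use cB d(6) u v b in auto)
    also have "\<dots> = k x \<otimes> k y" using u v k by simp
    finally show ?thesis .
  qed
  moreover have "k z = z" if "z \<in> C" for z using kA sub_C[OF d(1) that] d(8)[OF that] by simp
  ultimately have "piso (adj A a) (adj B b) k"
    using sub_adj[OF d(1) a(1)] sub_adj[OF d(2) b(1)] by (simp add: piso_def bij_betw_def)
  then show thesis using that kA ka by blast
qed

end

section \<open>One-point extensions\<close>

context nil2
begin

text \<open>The semidirect product of \<open>A\<close> with the cyclic group of order
  \<open>p\<close> whose generator \<open>(\<one>, 1)\<close> acts by
  \<open>b \<mapsto> b \<otimes> f b\<close>. This action is multiplicative because \<open>f\<close>
  is a homomorphism with central values, and it gives the generator the commutators prescribed by
  \<open>f\<close>.\<close>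

definition split_ext :: "'a set \<Rightarrow> ('a \<Rightarrow> 'a) \<Rightarrow> (gsym, 'a \<times> nat) struct" where
  "split_ext A f = \<lparr>univ = A \<times> {..<p},
     fn = (\<lambda>s xs. case s of
         One \<Rightarrow> (\<one>, 0)
       | Inv \<Rightarrow> (case hd xs of (a, i) \<Rightarrow> (inv a \<otimes> f a [^] i, (p - i) mod p))
       | Mul \<Rightarrow> (case (hd xs, hd (tl xs)) of ((a, i), (b, j)) \<Rightarrow> (a \<otimes> b \<otimes> f b [^] i, (i + j) mod p))
       | Cst i \<Rightarrow> (cst M i, 0))\<rparr>"

lemma split_ext_simps [simp]:
  "univ (split_ext A f) = A \<times> {..<p}"
  "fn (split_ext A f) One xs = (\<one>, 0)"
  "fn (split_ext A f) Inv [(a, i)] = (inv a \<otimes> f a [^] i, (p - i) mod p)"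
  "fn (split_ext A f) Mul [(a, i), (b, j)] = (a \<otimes> b \<otimes> f b [^] i, (i + j) mod p)"
  "fn (split_ext A f) (Cst k) xs = (cst M k, 0)"
  by (auto simp: split_ext_def)

context
  fixes A :: "'a set" and f :: "'a \<Rightarrow> 'a"
  assumes A: "sub A" and f: "chr A f"
begin

lemma fA: "a \<in> A \<Longrightarrow> f a \<in> C" "a \<in> A \<Longrightarrow> f a \<in> carrier G" "a \<in> A \<Longrightarrow> f a [^] (k::nat) \<in> A"
  using chr_in_C[OF f] C_carrier sub_C[OF A] by (auto intro: sub_pow[OF A])

lemma fA_mult_C:
  assumes "a \<in> A" "z \<in> C"
  shows "f (a \<otimes> z) = f a"
  using assms fA by (simp add: chr_mult[OF f] chr_C[OF f] sub_C[OF A])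

lemma is_struct_split_ext: "is_struct L (split_ext A f)"
  unfolding is_struct_def
proof (intro conjI ballI)
  show "univ (split_ext A f) \<noteq> {}" using sub_C[OF A C_one] p_pos by auto
  have "fn (split_ext A f) s xs \<in> univ (split_ext A f)"
    if "(s, length xs) \<in> L" "set xs \<subseteq> univ (split_ext A f)" for s xs
    using that
  proof (induction rule: Lg_induct)
    case (Inv x)
    then show ?case
      using p_pos by (cases x) (auto intro!: sub_mult[OF A] sub_inv[OF A] fA)
  next
    case (Mul x y)
    then show ?case
      using p_pos by (cases x; cases y) (auto intro!: sub_mult[OF A] fA)
  qed (use sub_C[OF A C_one] sub_C[OF A cst_C] p_pos in auto)
  then show "case sk of (s, k) \<Rightarrow> \<forall>xs. set xs \<subseteq> univ (split_ext A f) \<and> length xs = k \<longrightarrow>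
      fn (split_ext A f) s xs \<in> univ (split_ext A f)" if "sk \<in> L" for sk
    using that by auto
qed

text \<open>The exponents of \<open>f a\<close> add up to
  \<open>i * (0 + 1 + ... + (k - 1))\<close>, whence the binomial coefficient.\<close>

lemma pow_split_ext:
  assumes "a \<in> A" "i < p"
  shows "(a, i) [^]\<^bsub>grp (split_ext A f)\<^esub> k = (a [^] k \<otimes> f a [^] (i * (k choose 2)), (i * k) mod p)"
proof (induction k)
  case 0
  then show ?case by (simp add: numeral_2_eq_2)
next
  case (Suc k)
  have c: "a \<in> carrier G" using assms sub_carrier[OF A] by simp
  have "f a [^] ((i * k) mod p) = f a [^] (i * k)" using fA assms by (simp add: pow_mod)
  moreover have "a [^] k \<otimes> f a [^] (i * (k choose 2)) \<otimes> a \<otimes> f a [^] (i * k) =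
     a [^] k \<otimes> a \<otimes> f a [^] (i * (Suc k choose 2))"
  proof -
    have "f a [^] (i * (k choose 2)) \<otimes> a = a \<otimes> f a [^] (i * (k choose 2))"
      using fA assms c by (intro C_central) auto
    then have "a [^] k \<otimes> f a [^] (i * (k choose 2)) \<otimes> a \<otimes> f a [^] (i * k) =
        a [^] k \<otimes> a \<otimes> (f a [^] (i * (k choose 2)) \<otimes> f a [^] (i * k))"
      using fA assms c by (simp add: m_assoc)
    also have "f a [^] (i * (k choose 2)) \<otimes> f a [^] (i * k) = f a [^] (i * (Suc k choose 2))"
      using fA assms by (simp add: nat_pow_mult numeral_2_eq_2 algebra_simps)
    finally show ?thesis .
  qed
  ultimately show ?case using Suc by (simp add: mod_simps algebra_simps)
qed

lemma lc_carrier: "k \<le> n \<Longrightarrow> lc M r k \<in> carrier G"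
proof (induction k)
  case 0
  show ?case by (simp only: lc_0 one_closed)
next
  case (Suc k)
  then have "cst M (Suc k) \<in> carrier G" by (intro C_carrier cst_C) simp
  with Suc show ?case unfolding lc_Suc by simp
qed

lemma lc_split_ext: "k \<le> n \<Longrightarrow> lc (split_ext A f) r k = (lc M r k, 0)"
proof (induction k)
  case 0
  then show ?case by (simp add: one_eq)
next
  case (Suc k)
  have c: "cst M (Suc k) \<in> C" using Suc.prems by (intro cst_C) auto
  have "cst (split_ext A f) (Suc k) = (cst M (Suc k), 0)" by (simp add: cst_def)
  moreover have "(cst M (Suc k), 0) [^]\<^bsub>grp (split_ext A f)\<^esub> r (Suc k) = (cst M (Suc k) [^] r (Suc k), 0)"
    using pow_split_ext[OF sub_C[OF A c] p_pos] C_carrier[OF c] by simp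
  moreover have "lc M r k \<in> carrier G" using Suc.prems by (intro lc_carrier) simp
  ultimately show ?case
    unfolding lc_Suc lc.simps(2)[of "split_ext A f"] using Suc C_carrier[OF c] by simp
qed

lemma in_G_split_ext: "in_G p n (split_ext A f)"
proof -
  let ?E = "split_ext A f"
  note cA = sub_carrier[OF A]
  have ax: "sem_axioms p n M" using in_G p_pos in_G_iff by blast
  \<comment> \<open>Oddness of \<open>p\<close> makes \<open>(p - 1) div 2\<close> exact.
    Consequently the factor \<open>f a [^] (i * (p choose 2))\<close> in a \<open>p\<close>-th power
    is trivial.\<close>
  have dvd: "p dvd (p choose 2)"
  proof -
    have "even (p - 1)" using prime_odd_nat[OF prime_p] p_gt_2 by simp
    then have "p choose 2 = p * ((p - 1) div 2)" by (simp add: choose_two div_mult_swap)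
    then show ?thesis by simp
  qed
  have assoc: "fn ?E Mul [fn ?E Mul [x, y], z] = fn ?E Mul [x, fn ?E Mul [y, z]]"
    if xyz: "x \<in> univ ?E" "y \<in> univ ?E" "z \<in> univ ?E" for x y z
  proof -
    obtain a i b j c k where e: "x = (a, i)" "y = (b, j)" "z = (c, k)" by (cases x; cases y; cases z)
    then have m: "a \<in> A" "b \<in> A" "c \<in> A" using xyz by auto
    have g: "a \<in> carrier G" "b \<in> carrier G" "c \<in> carrier G" using m cA by auto
    have "f (b \<otimes> c \<otimes> f c [^] j) = f b \<otimes> f c"
      using m fA by (simp add: fA_mult_C sub_mult[OF A] chr_mult[OF f])
    then have 1: "f (b \<otimes> c \<otimes> f c [^] j) [^] i = f b [^] i \<otimes> f c [^] i"
      using m fA by (simp add: C_pow_mult)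
    have 2: "f c [^] ((i + j) mod p) = f c [^] j \<otimes> f c [^] i"
      using m fA by (simp add: pow_mod nat_pow_mult add.commute)
    have "f b [^] i \<otimes> (c \<otimes> (f c [^] j \<otimes> f c [^] i)) = c \<otimes> (f c [^] j \<otimes> (f b [^] i \<otimes> f c [^] i))"
      using m fA g by (simp add: C_left_commute[of "f b [^] i" c, symmetric]
          C_left_commute[of "f b [^] i" "f c [^] j", symmetric])
    then show ?thesis
      unfolding e using g fA m 1 2
      by (simp add: m_assoc mod_simps add.assoc)
  qed
  have comm: "\<exists>r. (\<forall>i\<in>{1..n}. r i < p) \<and> fn ?E Mul [x, y] = fn ?E Mul [lc ?E r n, fn ?E Mul [y, x]]"
    if xy: "x \<in> univ ?E" "y \<in> univ ?E" for x y
  proof -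
    obtain a i b j where e: "x = (a, i)" "y = (b, j)" by (cases x; cases y)
    then have m: "a \<in> A" "b \<in> A" using xy by auto
    have g: "a \<in> carrier G" "b \<in> carrier G" using m cA by auto
    have k: "f b [^] i \<in> C" "f a [^] j \<in> C" "inv (f a [^] j) \<in> C"
      using m fA by (auto intro: subgroup.m_inv_closed[OF C_subgroup])
    note kc = k[THEN C_carrier]
    \<comment> \<open>The commutator of \<open>(a, i)\<close> and \<open>(b, j)\<close>, found by
      expanding bilinearly with \<open>f\<close> as the commutator map of the new generator.\<close>
    define z where "z = comm a b \<otimes> (f b [^] i \<otimes> inv (f a [^] j))"
    have zC: "z \<in> C" unfolding z_def using k g by simp
    then obtain r where r: "r \<in> set (exps p n)" "z = lc M r n" by (rule C_exps)
    have "z \<otimes> (b \<otimes> a \<otimes> f a [^] j) = comm a b \<otimes> (b \<otimes> a) \<otimes> f b [^] i"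
    proof -
      have "z \<otimes> (b \<otimes> a \<otimes> f a [^] j) =
          comm a b \<otimes> (f b [^] i \<otimes> (inv (f a [^] j) \<otimes> (f a [^] j \<otimes> (b \<otimes> a))))"
        unfolding z_def using g kc C_central[OF k(2), of "b \<otimes> a"] by (simp add: m_assoc)
      also have "inv (f a [^] j) \<otimes> (f a [^] j \<otimes> (b \<otimes> a)) = b \<otimes> a"
        using g kc by (simp add: inv_mult_cancel)
      also have "f b [^] i \<otimes> (b \<otimes> a) = (b \<otimes> a) \<otimes> f b [^] i" using g k by (intro C_central) auto
      finally show ?thesis using g kc by (simp add: m_assoc)
    qed
    also have "comm a b \<otimes> (b \<otimes> a) = a \<otimes> b" using comm_swap[of a b] g by simp
    finally have "fn ?E Mul [x, y] = fn ?E Mul [(z, 0), fn ?E Mul [y, x]]"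
      using g kc C_carrier[OF zC] unfolding e by (simp add: add.commute)
    then show ?thesis using r exps_less[OF r(1)] lc_split_ext[of n r] by (intro exI[of _ r]) simp
  qed
  have pow: "x [^]\<^bsub>grp ?E\<^esub> p = fn ?E One []" if hx: "x \<in> univ ?E" for x
  proof -
    obtain a i where e: "x = (a, i)" "a \<in> A" "i < p" using hx by auto
    obtain q where q: "p choose 2 = p * q" using dvd by (auto simp: dvd_def)
    have "f a [^] (i * (p choose 2)) = (f a [^] p) [^] (i * q)"
      using fA e unfolding q by (simp add: nat_pow_pow mult.left_commute)
    also have "\<dots> = \<one>" using fA e by (simp add: pow_p)
    finally show ?thesis using e pow_split_ext[OF e(2,3), of p] cA pow_p by simp
  qed
  have one: "fn ?E Mul [fn ?E One [], x] = x" if "x \<in> univ ?E" for x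
    using that cA fA by auto
  have inverse: "fn ?E Mul [fn ?E Inv [x], x] = fn ?E One []" if hx: "x \<in> univ ?E" for x
  proof -
    obtain a i where e: "x = (a, i)" "a \<in> A" "i < p" using hx by auto
    have c: "a \<in> carrier G" using e cA by simp
    have "inv a \<otimes> f a [^] i \<otimes> a \<otimes> f a [^] ((p - i) mod p) = inv a \<otimes> (f a [^] i \<otimes> a) \<otimes> f a [^] (p - i)"
      using c fA e by (simp add: m_assoc pow_mod)
    also have "f a [^] i \<otimes> a = a \<otimes> f a [^] i" using c fA e by (intro C_central) auto
    also have "inv a \<otimes> (a \<otimes> f a [^] i) \<otimes> f a [^] (p - i) = f a [^] i \<otimes> f a [^] (p - i)"
      using c fA e by (simp add: inv_mult_cancel)
    also have "\<dots> = \<one>" using fA e by (simp add: nat_pow_mult pow_p)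
    finally show ?thesis using e by (simp add: mod_simps)
  qed
  have central: "fn ?E Mul [cst ?E i, x] = fn ?E Mul [x, cst ?E i]" if i: "i \<in> {1..n}" and hx: "x \<in> univ ?E" for i x
  proof -
    obtain a j where e: "x = (a, j)" "a \<in> A" "j < p" using hx by auto
    note c = cA[OF e(2)] and k = cst_C[OF i]
    have "cst M i \<otimes> a = a \<otimes> cst M i" using k c by (rule C_central)
    moreover have "cst ?E i = (cst M i, 0)" by (simp add: cst_def)
    ultimately show ?thesis using e c C_carrier[OF k] chr_C[OF f k] by simp
  qed
  have indep: "\<forall>i\<in>{1..n}. r i = 0" if "\<forall>i\<in>{1..n}. r i < p" "lc ?E r n = fn ?E One []" for r
    using that ax lc_split_ext[of n r] unfolding sem_axioms_def by (simp add: one_eq)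
  have "sem_axioms p n ?E"
    unfolding sem_axioms_def
    by (intro conjI ballI allI impI) (use assoc one inverse pow comm central indep in blast)+
  then show ?thesis using in_G_iff[OF p_pos, of n ?E] is_struct_split_ext by simp
qed

end

end

text \<open>The members of \<open>K_class\<close> live on natural numbers, whereas the split
  extension lives on pairs.\<close>

lemma nat_copy:
  fixes N :: "('f, 'b) struct"
  assumes "is_struct L N" "finite (univ N)"
  obtains N' :: "('f, nat) struct" and h where "isomorphism L N N' h" "finite (univ N')"
proof -
  obtain h :: "'b \<Rightarrow> nat" where h: "inj_on h (univ N)"
    using finite_imp_inj_to_nat_seg[OF assms(2)] by blast
  define N' where "N' = \<lparr>univ = h ` univ N, fn = (\<lambda>f xs. h (fn N f (map (inv_into (univ N) h) xs)))\<rparr>"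
  have "map (inv_into (univ N) h) (map h xs) = xs" if "set xs \<subseteq> univ N" for xs
    using that h by (auto intro!: map_idI)
  then have "isomorphism L N N' h"
    using h by (auto simp: isomorphism_def embedding_def N'_def tuples_def)
  moreover have "finite (univ N')" using assms by (simp add: N'_def)
  ultimately show thesis by (rule that)
qed

lemma in_G_isomorphism:
  assumes "isomorphism (Lg n) N N' h" "in_G p n N" "p > 0"
  shows "in_G p n N'"
proof -
  have N: "is_struct (Lg n) N" "\<forall>\<phi>\<in>G_axioms p n. valid N \<phi>"
    using assms in_G_iff[OF assms(3), of n N] valid_G_axioms_iff[of n N p] by auto
  have "is_struct (Lg n) N'" using assms(1) N(1) by (rule is_struct_isomorphism)
  moreover have "\<forall>\<phi>\<in>G_axioms p n. valid N' \<phi>"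
    using N valid_isomorphism[OF assms(1) N(1)] wf_G_axioms by blast
  ultimately show ?thesis using in_G_iff[OF assms(3)] valid_G_axioms_iff by blast
qed

text \<open>The age condition speaks only of finitely generated substructures; the axioms are
  universal, so they extend to the whole limit.\<close>

lemma in_G_fraisse_limit:
  assumes "fraisse_limit (Lg n) (K_class p n) D" "p > 0"
  shows "in_G p n D"
proof -
  have st: "is_struct (Lg n) D" using assms by (simp add: fraisse_limit_def)
  have "valid D \<phi>" if \<phi>: "\<phi> \<in> G_axioms p n" for \<phi>
  proof (rule valid_of_substructures[OF st])
    show "qf \<phi>" using \<phi> by (rule qf_G_axioms)
    fix X assume "finite X" "X \<subseteq> univ D"
    then obtain A h where A: "A \<in> K_class p n" "isomorphism (Lg n) A (D\<lparr>univ := gen (Lg n) D X\<rparr>) h"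
      using assms by (auto simp: fraisse_limit_def)
    then have g: "is_struct (Lg n) A" "sem_axioms p n A"
      using in_G_iff[OF assms(2)] by (auto simp: K_class_def)
    then have "valid A \<phi>" using \<phi> valid_G_axioms_iff by blast
    then show "valid (D\<lparr>univ := gen (Lg n) D X\<rparr>) \<phi>"
      using A(2) g(1) wf_G_axioms[OF \<phi>] valid_isomorphism by blast
  qed
  then show ?thesis using st in_G_iff[OF assms(2)] valid_G_axioms_iff by blast
qed

context nil2
begin

section \<open>The extension property and its first-order form\<close>

definition extension_property where
  "extension_property \<longleftrightarrow> (\<forall>A f. finite A \<and> sub A \<and> chr A f \<longrightarrow>
     (\<exists>x\<in>carrier G - A. \<forall>a\<in>A. comm x a = f a))"

text \<open>Embedding the split extension places \<open>A\<close> somewhere else in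
  \<open>M\<close>. An automorphism supplied by ultrahomogeneity moves that copy back onto
  \<open>A\<close>, and the image of the new generator is the required element.\<close>

lemma extension_property_fraisse_limit:
  assumes "fraisse_limit L (K_class p n) M"
  shows extension_property
  unfolding extension_property_def
proof (intro allI impI, elim conjE)
  fix A f assume fin: "finite A" and A: "sub A" and f: "chr A f"
  let ?E = "split_ext A f"
  note stE = is_struct_split_ext[OF A f]
  obtain N :: "(gsym, nat) struct" and h where N: "isomorphism L ?E N h" "finite (univ N)"
    using nat_copy[OF stE] fin by auto
  have "N \<in> K_class p n"
    using in_G_isomorphism[OF N(1) in_G_split_ext[OF A f] p_pos] N(2) by (simp add: K_class_def)
  then obtain k where k: "embedding L N M k" using assms by (auto simp: fraisse_limit_def)
  define e where "e = k \<circ> h"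
  have e_inj: "inj_on e (univ ?E)"
    using N(1) k unfolding e_def isomorphism_def embedding_def
    by (intro comp_inj_on) (auto intro: inj_on_subset)
  have e_cl: "e x \<in> carrier G" if "x \<in> univ ?E" for x
    using N(1) k that unfolding e_def isomorphism_def embedding_def carrier_eq by auto
  have e_fn: "fn M s (map e xs) = e (fn ?E s xs)" if s: "(s, length xs) \<in> L" "set xs \<subseteq> univ ?E" for s xs
  proof -
    have "h (fn ?E s xs) = fn N s (map h xs)"
      using N(1) s unfolding isomorphism_def embedding_def by (auto simp: tuples_def)
    moreover have "map h xs \<in> tuples N (length xs)"
      using N(1) s unfolding isomorphism_def embedding_def by (auto simp: tuples_def)
    then have "k (fn N s (map h xs)) = fn M s (map k (map h xs))"
      using k s unfolding embedding_def by auto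
    ultimately show ?thesis by (simp add: e_def)
  qed
  have A_E: "(a, 0) \<in> univ ?E" if "a \<in> A" for a using that p_pos by simp
  have pair_fn: "fn ?E s (map (\<lambda>a. (a, 0)) ys) = (fn M s ys, 0)" if "(s, length ys) \<in> L" "set ys \<subseteq> A" for s ys
    using that
  proof (induction rule: Lg_induct)
    case One
    then show ?case by (simp add: one_eq)
  next
    case (Inv x)
    then show ?case using sub_carrier[OF A] by (simp add: Inv_eq)
  next
    case (Mul x y)
    then show ?case using sub_carrier[OF A] by (simp add: mult_eq[symmetric])
  next
    case (Cst i)
    then show ?case by (simp add: cst_def)
  qed
  define i where "i a = e (a, 0)" for a
  have i_inj: "inj_on i A"
    using e_inj A_E unfolding i_def inj_on_def by blast
  have i_fn: "fn M s (map i ys) = i (fn M s ys)" if "(s, length ys) \<in> L" "set ys \<subseteq> A" for s ys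
  proof -
    have "map i ys = map e (map (\<lambda>a. (a, 0)) ys)" by (simp add: i_def)
    then have "fn M s (map i ys) = fn M s (map e (map (\<lambda>a. (a, 0)) ys))" by (simp only:)
    also have "\<dots> = e (fn ?E s (map (\<lambda>a. (a, 0)) ys))"
      using that A_E by (intro e_fn) auto
    also have "\<dots> = i (fn M s ys)" using pair_fn[OF that] by (simp add: i_def)
    finally show ?thesis .
  qed
  let ?j = "inv_into A i"
  have pull: "\<exists>ys. xs = map i ys \<and> set ys \<subseteq> A \<and> map ?j xs = ys" if "set xs \<subseteq> i ` A" for xs
  proof (intro exI conjI)
    show "xs = map i (map ?j xs)" using that by (auto simp: f_inv_into_f intro!: map_idI[symmetric])
    show "set (map ?j xs) \<subseteq> A" using that by (auto intro!: inv_into_into)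
  qed simp
  have closed: "gn (i ` A) = i ` A"
  proof (rule equalityI[OF gen_least gen_incl])
    fix s xs assume s: "(s, length xs) \<in> L" "set xs \<subseteq> i ` A"
    then obtain ys where ys: "xs = map i ys" "set ys \<subseteq> A" using pull by blast
    then show "fn M s xs \<in> i ` A" using i_fn[of s ys] sub_fn_closed[OF A, of s ys] s by simp
  qed simp
  have iA: "i ` A \<subseteq> carrier G" using e_cl[OF A_E] by (auto simp: i_def)
  have "isomorphism L (M\<lparr>univ := gn (i ` A)\<rparr>) (M\<lparr>univ := gn A\<rparr>) ?j"
    unfolding isomorphism_def embedding_def closed gn_sub[OF A]
  proof (intro conjI ballI)
    show "inj_on ?j (univ (M\<lparr>univ := i ` A\<rparr>))" by (simp add: inj_on_inv_into)
    show "?j ` univ (M\<lparr>univ := i ` A\<rparr>) = univ (M\<lparr>univ := A\<rparr>)"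
      using i_inj by (simp add: image_image)
    then show "?j ` univ (M\<lparr>univ := i ` A\<rparr>) \<subseteq> univ (M\<lparr>univ := A\<rparr>)" by simp
    have "?j (fn M s xs) = fn M s (map ?j xs)" if s: "(s, length xs) \<in> L" "set xs \<subseteq> i ` A" for s xs
    proof -
      obtain ys where ys: "xs = map i ys" "set ys \<subseteq> A" "map ?j xs = ys" using pull s by blast
      then have "fn M s xs = i (fn M s ys)" using i_fn s by simp
      moreover have "fn M s ys \<in> A" using sub_fn_closed[OF A, of s ys] ys s by simp
      ultimately show ?thesis using ys(3) i_inj by simp
    qed
    then show "case sk of (s, k) \<Rightarrow> \<forall>xs\<in>tuples (M\<lparr>univ := i ` A\<rparr>) k.
        ?j (fn (M\<lparr>univ := i ` A\<rparr>) s xs) = fn (M\<lparr>univ := A\<rparr>) s (map ?j xs)" if "sk \<in> L" for sk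
      using that by (auto simp: tuples_def)
  qed
  then obtain g where g: "isomorphism L M M g" "\<forall>x\<in>gn (i ` A). g x = ?j x"
    using assms fin sub_subset[OF A] iA unfolding fraisse_limit_def ultrahomogeneous_def carrier_eq
    by (metis finite_imageI)
  have g_mult: "g (x \<otimes> y) = g x \<otimes> g y" if "x \<in> carrier G" "y \<in> carrier G" for x y
  proof -
    have "(Mul, 2) \<in> L" by simp
    moreover have "[x, y] \<in> tuples M 2" using that by (simp add: tuples_def carrier_eq)
    ultimately show ?thesis
      using g(1) unfolding isomorphism_def embedding_def mult_eq by fastforce
  qed
  have gi: "g (i a) = a" if "a \<in> A" for a
    using g(2) closed that i_inj by simp
  have one: "(\<one>, 1) \<in> univ ?E" using sub_C[OF A C_one] p_gt_2 by simp
  define x where "x = g (e (\<one>, 1))"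
  have gc: "g y \<in> carrier G" if "y \<in> carrier G" for y
    using g(1) that by (auto simp: isomorphism_def embedding_def carrier_eq)
  have x: "x \<in> carrier G" unfolding x_def using gc e_cl[OF one] by simp
  have "x \<notin> A"
  proof
    assume "x \<in> A"
    then have "g (e (\<one>, 1)) = g (i x)" using gi by (simp add: x_def)
    moreover have "inj_on g (carrier G)" using g(1) by (simp add: isomorphism_def embedding_def carrier_eq)
    ultimately have "e (\<one>, 1) = e (x, 0)"
      using e_cl[OF one] e_cl[OF A_E[OF \<open>x \<in> A\<close>]] by (simp add: i_def inj_on_eq_iff)
    then have "(\<one>, 1::nat) = (x, 0)"
      using e_inj one A_E[OF \<open>x \<in> A\<close>] by (simp only: inj_on_eq_iff)
    then show False by simp
  qed
  moreover have "comm x a = f a" if a: "a \<in> A" for a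
  proof (rule comm_unique)
    have fa: "f a \<in> A" "f a \<in> carrier G" using a chr_in_C[OF f] sub_C[OF A] C_carrier by auto
    note ca = sub_carrier[OF A a]
    have e_mult: "e (u, l) \<otimes> e (v, m) = e (u \<otimes> v \<otimes> f v [^] l, (l + m) mod p)"
      if "(u, l) \<in> univ ?E" "(v, m) \<in> univ ?E" for u l v m
      using e_fn[of Mul "[(u, l), (v, m)]"] that by (simp add: mult_eq)
    have p1: "1 mod p = (1::nat)" using p_gt_2 by simp
    have "e (\<one>, 1) \<otimes> e (a, 0) = e (f a, 0) \<otimes> (e (a, 0) \<otimes> e (\<one>, 1))"
      using a one fa ca A_E p1 p_gt_2 C_central[OF chr_in_C[OF f a] ca] sub_C[OF A C_one]
      by (simp add: e_mult)
    then have "g (e (\<one>, 1) \<otimes> i a) = g (i (f a) \<otimes> (i a \<otimes> e (\<one>, 1)))" by (simp add: i_def)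
    then show "x \<otimes> a = f a \<otimes> (a \<otimes> x)"
      using e_cl[OF one] e_cl[OF A_E[OF a]] e_cl[OF A_E[OF fa(1)]] gi[OF a] gi[OF fa(1)]
      by (simp add: g_mult x_def i_def)
    show "f a \<in> carrier G" "a \<in> carrier G" "x \<in> carrier G" by fact+
  qed
  ultimately show "\<exists>x\<in>carrier G - A. \<forall>a\<in>A. comm x a = f a" using x by blast
qed


text \<open>The four lists state: closure under products with multiplicativity of the values,
  independence of the value from the index (the enumeration may repeat elements), values in
  \<open>C\<close>, and \<open>C\<close> being enumerated with value \<open>\<one>\<close>.\<close>

definition ext_premise :: "nat \<Rightarrow> gsym fm list" where
  "ext_premise N =
     [Disj [And (Eq (Var k) (mulT (Var i) (Var j))) (Eq (Var (N + k)) (mulT (Var (N + i)) (Var (N + j)))).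
        k \<leftarrow> [0..<N]]. i \<leftarrow> [0..<N], j \<leftarrow> [0..<N]] @
     [Imp (Eq (Var i) (Var j)) (Eq (Var (N + i)) (Var (N + j))). i \<leftarrow> [0..<N], j \<leftarrow> [0..<N]] @
     [Disj [Eq (Var (N + i)) (lcT r n). r \<leftarrow> exps p n]. i \<leftarrow> [0..<N]] @
     [Disj [And (Eq (Var k) (lcT r n)) (Eq (Var (N + k)) oneT). k \<leftarrow> [0..<N]]. r \<leftarrow> exps p n]"

definition ext_conclusion :: "nat \<Rightarrow> gsym fm list" where
  "ext_conclusion N =
     [And (Neg (Eq (Var (2 * N)) (Var i)))
        (Eq (mulT (Var (2 * N)) (Var i)) (mulT (Var (N + i)) (mulT (Var i) (Var (2 * N))))).
        i \<leftarrow> [0..<N]]"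

text \<open>The values of the variables \<open>x\<^sub>0, \<dots>, x\<^sub>N\<^sub>-\<^sub>1\<close> enumerate a subgroup, and those of
  \<open>x\<^sub>N, \<dots>, x\<^sub>2\<^sub>N\<^sub>-\<^sub>1\<close> the values of a character on it.\<close>

definition ext_fm :: "nat \<Rightarrow> gsym fm" where
  "ext_fm N = Imp (Conj (ext_premise N)) (ExF (2 * N) (Conj (ext_conclusion N)))"

lemma wf_ext_fm: "wf_fm L (ext_fm N)"
  by (auto simp: ext_fm_def ext_premise_def ext_conclusion_def)

lemma sat_ext_premise:
  assumes "range e \<subseteq> carrier G"
  shows "(\<forall>\<phi>\<in>set (ext_premise N). sat M e \<phi>) \<longleftrightarrow>
    (\<exists>f. sub (e ` {..<N}) \<and> chr (e ` {..<N}) f \<and> (\<forall>i<N. f (e i) = e (N + i)))"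
    (is "?P \<longleftrightarrow> ?Q")
proof -
  have "?P \<longleftrightarrow>
    (\<forall>i<N. \<forall>j<N. \<exists>k<N. e k = e i \<otimes> e j \<and> e (N + k) = e (N + i) \<otimes> e (N + j)) \<and>
    (\<forall>i<N. \<forall>j<N. e i = e j \<longrightarrow> e (N + i) = e (N + j)) \<and>
    (\<forall>i<N. \<exists>r\<in>set (exps p n). e (N + i) = lc M r n) \<and>
    (\<forall>r\<in>set (exps p n). \<exists>k<N. e k = lc M r n \<and> e (N + k) = \<one>)"
    by (simp add: ext_premise_def ball_Un mult_eq one_eq) (simp add: Ball_def Bex_def)
  also have "\<dots> \<longleftrightarrow>
    (\<forall>i<N. \<forall>j<N. \<exists>k<N. e k = e i \<otimes> e j \<and> e (N + k) = e (N + i) \<otimes> e (N + j)) \<and>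
    (\<forall>i<N. \<forall>j<N. e i = e j \<longrightarrow> e (N + i) = e (N + j)) \<and>
    (\<forall>i<N. e (N + i) \<in> C) \<and> (\<forall>z\<in>C. \<exists>k<N. e k = z \<and> e (N + k) = \<one>)"
  proof -
    have 1: "(\<exists>r\<in>set (exps p n). z = lc M r n) \<longleftrightarrow> z \<in> C" for z
      using C_exps lc_in_C by metis
    have 2: "(\<forall>r\<in>set (exps p n). Q (lc M r n)) \<longleftrightarrow> (\<forall>z\<in>C. Q z)" for Q
      using C_exps lc_in_C by metis
    show ?thesis unfolding 1 2[of "\<lambda>z. \<exists>k<N. e k = z \<and> e (N + k) = \<one>"] by (rule refl)
  qed
  also have "\<dots> \<longleftrightarrow> ?Q"
  proof
    assume *: "(\<forall>i<N. \<forall>j<N. \<exists>k<N. e k = e i \<otimes> e j \<and> e (N + k) = e (N + i) \<otimes> e (N + j)) \<and>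
      (\<forall>i<N. \<forall>j<N. e i = e j \<longrightarrow> e (N + i) = e (N + j)) \<and>
      (\<forall>i<N. e (N + i) \<in> C) \<and> (\<forall>z\<in>C. \<exists>k<N. e k = z \<and> e (N + k) = \<one>)"
    \<comment> \<open>Any index of \<open>x\<close> may be chosen, by the second conjunct of the
      premise.\<close>
    define f where "f x = e (N + (SOME i. i < N \<and> e i = x))" for x
    have f: "f (e i) = e (N + i)" if "i < N" for i
    proof -
      have "(SOME j. j < N \<and> e j = e i) < N \<and> e (SOME j. j < N \<and> e j = e i) = e i"
        by (rule someI[of _ i]) (use that in simp)
      then show ?thesis using * that unfolding f_def by blast
    qed
    have "sub (e ` {..<N})"
    proof (rule subI)
      show "e ` {..<N} \<subseteq> carrier G" using assms by auto
      show "C \<subseteq> e ` {..<N}"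
      proof
        fix z assume "z \<in> C"
        then obtain k where "k < N" "e k = z" using * by meson
        then show "z \<in> e ` {..<N}" by blast
      qed
      show "x \<otimes> y \<in> e ` {..<N}" if "x \<in> e ` {..<N}" "y \<in> e ` {..<N}" for x y
      proof -
        obtain i j where "i < N" "j < N" "x = e i" "y = e j" using \<open>x \<in> _\<close> \<open>y \<in> _\<close> by blast
        then obtain k where "k < N" "e k = x \<otimes> y" using * by blast
        then show ?thesis by (metis imageI lessThan_iff)
      qed
    qed
    moreover have "chr (e ` {..<N}) f"
      unfolding chr_def
    proof (intro conjI ballI)
      show "f a \<in> C" if a: "a \<in> e ` {..<N}" for a
      proof -
        obtain i where i: "i < N" "a = e i" using a by blast
        then have "e (N + i) \<in> C" using * by meson
        then show ?thesis using f i by simp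
      qed
      show "f z = \<one>" if z: "z \<in> C" for z
      proof -
        obtain k where "k < N" "e k = z" "e (N + k) = \<one>" using * z by meson
        then show ?thesis using f by auto
      qed
      show "f (x \<otimes> y) = f x \<otimes> f y" if "x \<in> e ` {..<N}" "y \<in> e ` {..<N}" for x y
      proof -
        obtain i j where ij: "i < N" "j < N" "x = e i" "y = e j" using \<open>x \<in> _\<close> \<open>y \<in> _\<close> by blast
        then obtain k where k: "k < N" "e k = x \<otimes> y" "e (N + k) = e (N + i) \<otimes> e (N + j)" using * by meson
        have "f (e k) = e (N + i) \<otimes> e (N + j)" using f[OF k(1)] k(3) by simp
        then show ?thesis using f[OF ij(1)] f[OF ij(2)] ij(3,4) k(2) by simp
      qed
    qed
    ultimately show ?Q using f by blast
  next
    assume ?Q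
    then obtain f where A: "sub (e ` {..<N})" and f: "chr (e ` {..<N}) f"
      and fe: "\<And>i. i < N \<Longrightarrow> f (e i) = e (N + i)" by blast
    have "\<exists>k<N. e k = e i \<otimes> e j \<and> e (N + k) = e (N + i) \<otimes> e (N + j)" if "i < N" "j < N" for i j
    proof -
      have m: "e i \<in> e ` {..<N}" "e j \<in> e ` {..<N}" using that by auto
      then obtain k where "k < N" "e k = e i \<otimes> e j" using sub_mult[OF A m] by force
      then show ?thesis using chr_mult[OF f m] fe that by (metis)
    qed
    moreover have "e (N + i) = e (N + j)" if "i < N" "j < N" "e i = e j" for i j
      using fe[OF that(1)] fe[OF that(2)] that(3) by simp
    moreover have "e (N + i) \<in> C" if "i < N" for i
      using fe[OF that] chr_in_C[OF f, of "e i"] that by auto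
    moreover have "\<exists>k<N. e k = z \<and> e (N + k) = \<one>" if "z \<in> C" for z
    proof -
      obtain k where "k < N" "z = e k" using sub_C[OF A \<open>z \<in> C\<close>] by blast
      then show ?thesis using fe chr_C[OF f \<open>z \<in> C\<close>] by metis
    qed
    ultimately show "(\<forall>i<N. \<forall>j<N. \<exists>k<N. e k = e i \<otimes> e j \<and> e (N + k) = e (N + i) \<otimes> e (N + j)) \<and>
      (\<forall>i<N. \<forall>j<N. e i = e j \<longrightarrow> e (N + i) = e (N + j)) \<and>
      (\<forall>i<N. e (N + i) \<in> C) \<and> (\<forall>z\<in>C. \<exists>k<N. e k = z \<and> e (N + k) = \<one>)" by blast
  qed
  finally show ?thesis .
qed

lemma sat_ext_conclusion:
  assumes "range e \<subseteq> carrier G" "x \<in> carrier G"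
  shows "(\<forall>\<phi>\<in>set (ext_conclusion N). sat M (e(2 * N := x)) \<phi>) \<longleftrightarrow>
    (\<forall>i<N. x \<noteq> e i \<and> comm x (e i) = e (N + i))"
proof -
  have "comm x y = z \<longleftrightarrow> x \<otimes> y = z \<otimes> (y \<otimes> x)" if "y \<in> carrier G" "z \<in> carrier G" for y z
    using comm_unique comm_swap that assms(2) by metis
  moreover have "e i \<in> carrier G" for i using assms by auto
  ultimately show ?thesis
    by (simp add: ext_conclusion_def mult_eq) (simp add: Ball_def)
qed

lemma valid_ext_fm_iff: "(\<forall>N. valid M (ext_fm N)) \<longleftrightarrow> extension_property"
proof
  assume v: "\<forall>N. valid M (ext_fm N)"
  show extension_property
    unfolding extension_property_def
  proof (intro allI impI, elim conjE)
    fix A f assume A: "finite A" "sub A" "chr A f"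
    obtain as where as: "set as = A" using A(1) finite_list by blast
    define N where "N = length as"
    \<comment> \<open>The first block enumerates \<open>A\<close>, the second the values of
      \<open>f\<close>; from \<open>2 * N\<close> on the default \<open>\<one>\<close> keeps the
      range inside the carrier.\<close>
    define e where "e i = (if i < N then as ! i else if i < 2 * N then f (as ! (i - N)) else \<one>)" for i
    have im: "e ` {..<N} = A" using as by (auto simp: e_def N_def in_set_conv_nth image_iff)
    have eA: "e i \<in> A" if "i < N" for i using im that by blast
    have fe: "f (e i) = e (N + i)" if "i < N" for i using that by (simp add: e_def)
    have ran: "range e \<subseteq> carrier G"
    proof clarify
      fix i
      show "e i \<in> carrier G"
        using as N_def A chr_in_C[OF A(3)] C_carrier sub_carrier[OF A(2)] by (auto simp: e_def)
    qed
    then have "\<exists>x\<in>carrier G. \<forall>\<phi>\<in>set (ext_conclusion N). sat M (e(2 * N := x)) \<phi>"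
      using v sat_ext_premise[OF ran, of N] A fe im unfolding valid_def ext_fm_def
      by (auto simp: carrier_eq simp del: fun_upd_apply)
    then obtain x where x: "x \<in> carrier G" "\<forall>i<N. x \<noteq> e i \<and> comm x (e i) = e (N + i)"
      using sat_ext_conclusion[OF ran] by blast
    have "x \<notin> A" using x(2) im by blast
    moreover have "comm x a = f a" if "a \<in> A" for a
    proof -
      obtain i where "i < N" "a = e i" using im \<open>a \<in> A\<close> by blast
      then show ?thesis using x(2) fe by simp
    qed
    ultimately show "\<exists>x\<in>carrier G - A. \<forall>a\<in>A. comm x a = f a" using x(1) by blast
  qed
next
  assume ext: extension_property
  show "\<forall>N. valid M (ext_fm N)"
    unfolding valid_def ext_fm_def sat_Imp sat_Conj sat_ExF carrier_eq[symmetric]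
  proof (intro allI impI)
    fix N and e :: "nat \<Rightarrow> 'a"
    assume ran: "range e \<subseteq> carrier G" and "\<forall>\<phi>\<in>set (ext_premise N). sat M e \<phi>"
    then obtain f where f: "sub (e ` {..<N})" "chr (e ` {..<N}) f" "\<forall>i<N. f (e i) = e (N + i)"
      using sat_ext_premise[OF ran] by blast
    then obtain x where "x \<in> carrier G - e ` {..<N}" "\<forall>a\<in>e ` {..<N}. comm x a = f a"
      using ext[unfolded extension_property_def, rule_format, of "e ` {..<N}" f] by auto
    then have "\<forall>i<N. x \<noteq> e i \<and> comm x (e i) = e (N + i)" "x \<in> carrier G" using f(3) by auto
    then show "\<exists>x\<in>carrier G. \<forall>\<phi>\<in>set (ext_conclusion N). sat M (e(2 * N := x)) \<phi>"
      using sat_ext_conclusion[OF ran] by blast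
  qed
qed

end

section \<open>Types in saturated models\<close>

text \<open>By Zorn there is a maximal finitely satisfiable set. If it contained neither
  \<open>\<phi>\<close> nor its negation, there would be finite parts incompatible with the one and
  with the other; a tuple satisfying both parts decides \<open>\<phi>\<close>, a
  contradiction.\<close>

lemma extend_to_complete_type:
  assumes \<Sigma>: "\<Sigma> \<subseteq> pfms L k P"
    and fs: "\<And>q. finite q \<Longrightarrow> q \<subseteq> \<Sigma> \<Longrightarrow> \<exists>a\<in>tuples M k. \<forall>\<theta>\<in>q. pholds M a \<theta>"
  obtains p where "p \<in> complete_types L M k P" "\<Sigma> \<subseteq> p"
proof -
  define FS where "FS q \<longleftrightarrow> (\<exists>a\<in>tuples M k. \<forall>\<theta>\<in>q. pholds M a \<theta>)" for q
  define \<A> where "\<A> = {q. \<Sigma> \<subseteq> q \<and> q \<subseteq> pfms L k P \<and> (\<forall>r. finite r \<and> r \<subseteq> q \<longrightarrow> FS r)}"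
  have "\<Sigma> \<in> \<A>" using \<Sigma> fs by (simp add: \<A>_def FS_def)
  moreover have "\<Union>\<C> \<in> \<A>" if ne: "\<C> \<noteq> {}" and ch: "subset.chain \<A> \<C>" for \<C>
  proof -
    have sub: "\<C> \<subseteq> \<A>" using ch by (simp add: subset.chain_def)
    have "FS r" if r: "finite r" "r \<subseteq> \<Union>\<C>" for r
    proof -
      obtain q where "q \<in> \<C>" "r \<subseteq> q" using finite_subset_Union_chain[OF r ne ch] by blast
      then show ?thesis using sub r(1) by (auto simp: \<A>_def)
    qed
    moreover obtain q where "q \<in> \<C>" using ne by blast
    then have "\<Sigma> \<subseteq> q" using sub by (auto simp: \<A>_def)
    then have "\<Sigma> \<subseteq> \<Union>\<C>" using \<open>q \<in> \<C>\<close> by blast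
    moreover have "\<Union>\<C> \<subseteq> pfms L k P" using sub by (auto simp: \<A>_def)
    ultimately show ?thesis by (simp add: \<A>_def)
  qed
  ultimately obtain p where p: "p \<in> \<A>" and max: "\<forall>q\<in>\<A>. p \<subseteq> q \<longrightarrow> q = p"
    using subset_Zorn_nonempty[of \<A>] by blast
  have "(\<phi>, b) \<in> p \<or> (Neg \<phi>, b) \<in> p" if b: "(\<phi>, b) \<in> pfms L k P" for \<phi> b
  proof (rule ccontr)
    assume n: "\<not> ((\<phi>, b) \<in> p \<or> (Neg \<phi>, b) \<in> p)"
    have nb: "(Neg \<phi>, b) \<in> pfms L k P" using b by (simp add: pfms_def fms_def)
    have ex: "\<exists>r. finite r \<and> r \<subseteq> p \<and> \<not> FS (insert \<theta> r)" if \<theta>: "\<theta> \<in> pfms L k P" "\<theta> \<notin> p" for \<theta>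
    proof -
      have "insert \<theta> p \<notin> \<A>" using max \<theta>(2) by blast
      then obtain r where r: "finite r" "r \<subseteq> insert \<theta> p" "\<not> FS r" using p \<theta>(1) by (auto simp: \<A>_def)
      have "r \<subseteq> insert \<theta> (r - {\<theta>})" by blast
      then have "\<not> FS (insert \<theta> (r - {\<theta>}))" using r(3) unfolding FS_def by blast
      moreover have "r - {\<theta>} \<subseteq> p" using r by blast
      ultimately show ?thesis using r(1) by blast
    qed
    obtain r where r: "finite r" "r \<subseteq> p" "\<not> FS (insert (\<phi>, b) r)" using ex[OF b] n by blast
    obtain s where s: "finite s" "s \<subseteq> p" "\<not> FS (insert (Neg \<phi>, b) s)" using ex[OF nb] n by blast
    have "FS (r \<union> s)" using p r s by (simp add: \<A>_def)
    then obtain a where a: "a \<in> tuples M k" "\<forall>\<theta>\<in>r \<union> s. pholds M a \<theta>" by (auto simp: FS_def)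
    have "pholds M a (\<phi>, b) \<or> pholds M a (Neg \<phi>, b)" by (simp add: pholds_def holds_def)
    then show False using a r(3) s(3) by (auto simp: FS_def)
  qed
  then have "p \<in> complete_types L M k P" using p by (auto simp: complete_types_def \<A>_def FS_def)
  then show thesis using that p by (auto simp: \<A>_def)
qed

lemma saturated_realize:
  assumes "saturated L \<kappa> M" "small \<kappa> M P" "\<Sigma> \<subseteq> pfms L 1 P"
    and "\<And>q. finite q \<Longrightarrow> q \<subseteq> \<Sigma> \<Longrightarrow> \<exists>a\<in>tuples M 1. \<forall>\<theta>\<in>q. pholds M a \<theta>"
  obtains a where "a \<in> tuples M 1" "\<And>\<theta>. \<theta> \<in> \<Sigma> \<Longrightarrow> pholds M a \<theta>"
proof -
  obtain p where "p \<in> complete_types L M 1 P" "\<Sigma> \<subseteq> p"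
    using extend_to_complete_type[OF assms(3,4)] by blast
  then show thesis using assms(1,2) that unfolding saturated_def by blast
qed

section \<open>The monster model\<close>

locale monster_group = nil2 G p n M for G (structure) and p n :: nat and M :: "(gsym, 'a) struct" +
  fixes \<kappa> :: "'k rel"
  assumes ext: extension_property
    and card_order: "Card_order \<kappa>" and natLeq_less: "natLeq <o \<kappa>"
    and saturated: "saturated L \<kappa> M"
begin

lemma small_Un: "small \<kappa> M A \<Longrightarrow> small \<kappa> M B \<Longrightarrow> small \<kappa> M (A \<union> B)"
proof -
  have "natLeq \<le>o |Field \<kappa>|"
    using ordLess_imp_ordLeq[OF natLeq_less] ordIso_symmetric[OF card_of_Field_ordIso[OF card_order]]
    by (rule ordLeq_ordIso_trans)
  then have "infinite (Field \<kappa>)" using infinite_iff_natLeq_ordLeq by blast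
  then show "small \<kappa> M A \<Longrightarrow> small \<kappa> M B \<Longrightarrow> small \<kappa> M (A \<union> B)"
    using card_of_Un_ordLess_infinite_Field[OF _ card_order] by (auto simp: small_def)
qed

lemma small_countable: "countable A \<Longrightarrow> A \<subseteq> carrier G \<Longrightarrow> small \<kappa> M A"
proof -
  assume A: "countable A" "A \<subseteq> carrier G"
  obtain f :: "'a \<Rightarrow> nat" where "inj_on f A" using A(1) by (auto simp: countable_def)
  then have "|A| \<le>o |UNIV :: nat set|" using card_of_ordLeq[of A "UNIV :: nat set"] by blast
  then have "|A| \<le>o natLeq" using card_of_nat by (rule ordLeq_ordIso_trans)
  then have "|A| <o \<kappa>" using natLeq_less by (rule ordLeq_ordLess_trans)
  then show ?thesis using A(2) by (simp add: small_def carrier_eq)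
qed

lemma small_subset: "small \<kappa> M A \<Longrightarrow> A \<subseteq> carrier G"
  by (simp add: small_def carrier_eq)

text \<open>Extending the character to the larger substructure first makes the extension property
  yield an \<open>x\<close> outside all of it.\<close>

lemma ext_point:
  assumes X: "finite X" "X \<subseteq> carrier G" and f: "chr (gn X) f" and S: "finite S" "S \<subseteq> carrier G"
  obtains x where "x \<in> carrier G" "x \<notin> gn (X \<union> S)" "\<And>a. a \<in> gn X \<Longrightarrow> comm x a = f a"
proof -
  obtain g where g: "chr (gn (X \<union> S)) g" "\<And>a. a \<in> gn X \<Longrightarrow> g a = f a"
    using chr_extend[OF X(2) f S] by blast
  have "finite (gn (X \<union> S))" "sub (gn (X \<union> S))" using X S by (auto intro: finite_gn sub_gn)
  then obtain x where x: "x \<in> carrier G - gn (X \<union> S)" "\<forall>a\<in>gn (X \<union> S). comm x a = g a"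
    using ext g(1) unfolding extension_property_def by blast
  moreover have m: "gn X \<subseteq> gn (X \<union> S)" by (rule gen_mono) simp
  have "comm x a = f a" if "a \<in> gn X" for a using x(2) g(2)[OF that] subsetD[OF m that] by simp
  then show thesis using x(1) by (intro that[of x]) auto
qed

subsection \<open>Finite partial isomorphisms are elementary\<close>

lemma chr_piso:
  assumes h: "piso A B h" and f: "chr B f"
  shows "chr A (\<lambda>x. f (h x))"
  using pisoD[OF h] f unfolding chr_def by simp

lemma finite_adj: "finite A \<Longrightarrow> y \<in> carrier G \<Longrightarrow> finite (adj A y)"
  by (simp add: adj_mod)

text \<open>The image of \<open>a\<close> is an element outside \<open>B\<close> whose commutators
  are those of \<open>a\<close>, transported along \<open>h\<close>.\<close>

lemma piso_forth:
  assumes fin: "finite A" and h: "piso A B h" and a: "a \<in> carrier G"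
  obtains A' B' h' where "finite A'" "piso A' B' h'" "A \<subseteq> A'" "a \<in> A'" "\<And>y. y \<in> A \<Longrightarrow> h' y = h y"
proof (cases "a \<in> A")
  case True
  then show ?thesis using that[of A B h] assms by blast
next
  case False
  note d = pisoD[OF h] and k = piso_sym[OF h]
  have f: "chr B (\<lambda>y. comm a (inv_into A h y))"
    by (rule chr_piso[OF k chr_comm[OF a d(1)]])
  have "finite B" using fin d(5) by auto
  then obtain b where b: "b \<in> carrier G" "b \<notin> B" "\<forall>y\<in>B. comm b y = comm a (inv_into A h y)"
    using ext d(2) f unfolding extension_property_def by blast
  have cm: "comm b (h y) = comm a y" if "y \<in> A" for y using b(3) d(4,6) that by simp
  obtain h' where "piso (adj A a) (adj B b) h'" "\<And>x. x \<in> A \<Longrightarrow> h' x = h x"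
    using piso_adj[OF h a False b(1,2) cm] by blast
  then show ?thesis
    using that[of "adj A a" "adj B b" h'] adj_incl[OF d(1)] adj_self[OF d(1) a] finite_adj[OF fin a] by blast
qed

lemma piso_back:
  assumes fin: "finite A" and h: "piso A B h" and b: "b \<in> carrier G"
  obtains A' B' h' where "finite A'" "piso A' B' h'" "A \<subseteq> A'" "b \<in> B'" "\<And>y. y \<in> A \<Longrightarrow> h' y = h y"
proof -
  note d = pisoD[OF h]
  have "finite B" using fin d(5) by auto
  then obtain A' B' k where k: "finite B'" "piso B' A' k" "B \<subseteq> B'" "b \<in> B'"
      "\<And>y. y \<in> B \<Longrightarrow> k y = inv_into A h y"
    using piso_forth[OF _ piso_sym[OF h] b] by blast
  note dk = pisoD[OF k(2)]
  have kh: "k (h y) = y" if "y \<in> A" for y using k(5) d(4,6) that by simp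
  have "finite A'" using k(1) dk(5) by auto
  moreover have "A \<subseteq> A'" using kh d(6) k(3) dk(6) by (metis subsetD subsetI)
  moreover have "inv_into B' k y = h y" if "y \<in> A" for y
    using inv_into_f_f[OF dk(4), of "h y"] kh[OF that] d(6)[OF that] k(3) by auto
  ultimately show thesis using that piso_sym[OF k(2)] k(4) by blast
qed

text \<open>Quantifiers are handled by back-and-forth, so the induction has to range over all finite
  substructures and isomorphisms at once. In effect, quantifier-free types determine types.\<close>

lemma piso_elementary:
  assumes "finite A" "piso A B h" "wf_fm L \<phi>" "e ` fv \<phi> \<subseteq> A" "\<And>x. x \<in> fv \<phi> \<Longrightarrow> e' x = h (e x)"
  shows "sat M e \<phi> \<longleftrightarrow> sat M e' \<phi>"
  using assms
proof (induction \<phi> arbitrary: A B h e e')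
  case (Eq s t)
  note d = pisoD[OF Eq(2)]
  have *: "evalt M e' u = h (evalt M e u)" "evalt M e u \<in> A" if "u = s \<or> u = t" for u
  proof -
    have "evalt M e' u = evalt M (h \<circ> e) u" using Eq(5) that by (intro evalt_cong) auto
    also have "\<dots> = h (evalt M e u)" using Eq that by (intro piso_evalt[OF Eq(2)]) auto
    finally show "evalt M e' u = h (evalt M e u)" .
    show "evalt M e u \<in> A"
      using evalt_in_gen[of L u e A M] gn_sub[OF d(1)] Eq(3,4) that by auto
  qed
  then show ?case using d(4) by (simp add: inj_on_eq_iff)
next
  case (Neg \<phi>)
  have "sat M e \<phi> = sat M e' \<phi>" by (rule Neg.IH[OF Neg.prems(1,2)]) (use Neg.prems in auto)
  then show ?case by simp
next
  case (And \<phi> \<psi>)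
  have "sat M e \<phi> = sat M e' \<phi>" by (rule And.IH(1)[OF And.prems(1,2)]) (use And.prems in auto)
  moreover have "sat M e \<psi> = sat M e' \<psi>" by (rule And.IH(2)[OF And.prems(1,2)]) (use And.prems in auto)
  ultimately show ?case by simp
next
  case (All x \<phi>)
  have step: "sat M (e(x := a)) \<phi> = sat M (e'(x := h' a)) \<phi>"
    if "finite A'" "piso A' B' h'" "A \<subseteq> A'" "a \<in> A'" "\<And>y. y \<in> A \<Longrightarrow> h' y = h y" for A' B' h' a
  proof (rule All.IH[OF that(1,2)])
    show "wf_fm L \<phi>" using All.prems by simp
    show "e(x := a) ` fv \<phi> \<subseteq> A'" using All.prems that by auto
    show "(e'(x := h' a)) y = h' ((e(x := a)) y)" if "y \<in> fv \<phi>" for y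
      using All.prems that \<open>\<And>y. y \<in> A \<Longrightarrow> h' y = h y\<close> by auto
  qed
  have "(\<forall>a\<in>univ M. sat M (e(x := a)) \<phi>) \<longleftrightarrow> (\<forall>a\<in>univ M. sat M (e'(x := a)) \<phi>)"
  proof (intro iffI ballI)
    fix b assume *: "\<forall>a\<in>univ M. sat M (e(x := a)) \<phi>" and "b \<in> univ M"
    then obtain A' B' h' where A': "finite A'" "piso A' B' h'" "A \<subseteq> A'" "b \<in> B'" "\<And>y. y \<in> A \<Longrightarrow> h' y = h y"
      using piso_back[OF All.prems(1,2)] by (metis carrier_eq)
    then obtain a where a: "a \<in> A'" "b = h' a" using pisoD(5)[OF A'(2)] by blast
    then show "sat M (e'(x := b)) \<phi>"
      using step[OF A'(1-3) a(1) A'(5)] * sub_carrier[OF pisoD(1)[OF A'(2)] a(1)] by (simp add: carrier_eq)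
  next
    fix a assume *: "\<forall>a\<in>univ M. sat M (e'(x := a)) \<phi>" and "a \<in> univ M"
    then obtain A' B' h' where A': "finite A'" "piso A' B' h'" "A \<subseteq> A'" "a \<in> A'" "\<And>y. y \<in> A \<Longrightarrow> h' y = h y"
      using piso_forth[OF All.prems(1,2)] by (metis carrier_eq)
    moreover have "h' a \<in> univ M"
      using pisoD(6)[OF A'(2,4)] sub_carrier[OF pisoD(2)[OF A'(2)]] by (simp add: carrier_eq)
    ultimately show "sat M (e(x := a)) \<phi>"
      using step[OF A'(1-5)] * by simp
  qed
  then show ?case by simp
qed

lemma piso_holds:
  assumes "finite A" "piso A B h" "set xs \<subseteq> A" "\<phi> \<in> fms L (length xs)"
  shows "holds M \<phi> xs \<longleftrightarrow> holds M \<phi> (map h xs)"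
  unfolding holds_def
proof (rule piso_elementary[OF assms(1,2)])
  show "wf_fm L \<phi>" using assms(4) by (simp add: fms_def)
  show "(!) xs ` fv \<phi> \<subseteq> A" using assms(3,4) by (auto simp: fms_def subset_iff)
  show "map h xs ! x = h (xs ! x)" if "x \<in> fv \<phi>" for x
    using assms(4) that by (auto simp: fms_def subset_iff)
qed

text \<open>Equality of quantifier-free types, and hence of types by \<open>piso_holds\<close>. The
  isomorphism may live on more than the generated substructure; \<open>eqvE\<close> cuts it
  down.\<close>

definition eqv :: "'a list \<Rightarrow> 'a list \<Rightarrow> bool" where
  "eqv xs ys \<longleftrightarrow> (\<exists>A B h. finite A \<and> piso A B h \<and> set xs \<subseteq> A \<and> ys = map h xs)"

lemma eqvE:
  assumes "eqv xs ys"
  obtains h where "piso (gn (set xs)) (gn (set ys)) h" "ys = map h xs" "finite (gn (set xs))"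
    "set xs \<subseteq> carrier G" "set ys \<subseteq> carrier G"
proof -
  obtain A B h where A: "finite A" "piso A B h" "set xs \<subseteq> A" "ys = map h xs"
    using assms by (auto simp: eqv_def)
  note d = pisoD[OF A(2)]
  have c: "set xs \<subseteq> carrier G" using A(3) sub_subset[OF d(1)] by blast
  have "gn (set xs) \<subseteq> A" by (rule gen_sub_least[OF d(1) A(3)])
  then have "piso (gn (set xs)) (h ` gn (set xs)) h" by (rule piso_restrict[OF A(2) sub_gn[OF c]])
  moreover have "h ` gn (set xs) = gn (set ys)" using piso_image_gn[OF A(2,3)] A(4) by simp
  moreover have "set ys \<subseteq> carrier G" using A(3,4) d(6) sub_carrier[OF d(2)] by auto
  ultimately show thesis using that[of h] A(4) finite_gn[OF _ c] c by simp
qed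

lemma eqvI: "finite A \<Longrightarrow> piso A B h \<Longrightarrow> set xs \<subseteq> A \<Longrightarrow> ys = map h xs \<Longrightarrow> eqv xs ys"
  by (auto simp: eqv_def)

lemma eqv_refl: "set xs \<subseteq> carrier G \<Longrightarrow> eqv xs xs"
  by (rule eqvI[OF _ piso_id[OF sub_gn], of "set xs"]) (auto intro: finite_gn gen.base)

lemma eqv_length: "eqv xs ys \<Longrightarrow> length xs = length ys"
  by (auto simp: eqv_def)

text \<open>The value of a term at \<open>xs\<close> is sent to the value of the same term at
  \<open>ys\<close>; equations and inequations make this well defined and injective. An implication
  suffices as hypothesis because negations are among the formulas.\<close>

lemma eqv_of_same_type:
  assumes xs: "set xs \<subseteq> carrier G" and ys: "set ys \<subseteq> carrier G" and len: "length xs = length ys"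
    and imp: "\<And>\<phi>. \<phi> \<in> fms L (length xs) \<Longrightarrow> holds M \<phi> xs \<Longrightarrow> holds M \<phi> ys"
  shows "eqv xs ys"
proof -
  define k where "k = length xs"
  define T where "T = {t. wf_trm L t \<and> vars_trm t \<subseteq> {..<k}}"
  have img: "set xs = (!) xs ` {..<k}" "set ys = (!) ys ` {..<k}"
    using len by (auto simp: k_def in_set_conv_nth image_iff)
  have val: "evalt M ((!) xs) t \<in> gn (set xs)" "evalt M ((!) ys) t \<in> gn (set ys)" if "t \<in> T" for t
    using that unfolding img T_def by (auto intro!: evalt_in_gen)
  have rep: "\<exists>t\<in>T. x = evalt M ((!) xs) t" if "x \<in> gn (set xs)" for x
    using that gen_term[of x L M "(!) xs" "{..<k}"] unfolding img T_def by blast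
  have rep': "\<exists>t\<in>T. x = evalt M ((!) ys) t" if "x \<in> gn (set ys)" for x
    using that gen_term[of x L M "(!) ys" "{..<k}"] unfolding img T_def by blast
  have eq_iff: "evalt M ((!) xs) s = evalt M ((!) xs) t \<longleftrightarrow> evalt M ((!) ys) s = evalt M ((!) ys) t"
    if "s \<in> T" "t \<in> T" for s t
  proof -
    have "Eq s t \<in> fms L k" "Neg (Eq s t) \<in> fms L k" using that by (auto simp: fms_def T_def)
    then show ?thesis using imp[of "Eq s t"] imp[of "Neg (Eq s t)"] by (auto simp: holds_def k_def)
  qed
  define h where "h x = evalt M ((!) ys) (SOME t. t \<in> T \<and> x = evalt M ((!) xs) t)" for x
  have h: "h (evalt M ((!) xs) t) = evalt M ((!) ys) t" if "t \<in> T" for t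
  proof -
    let ?s = "SOME s. s \<in> T \<and> evalt M ((!) xs) t = evalt M ((!) xs) s"
    have "?s \<in> T \<and> evalt M ((!) xs) t = evalt M ((!) xs) ?s" by (rule someI[of _ t]) (use that in simp)
    then show ?thesis using eq_iff[of ?s t] that by (simp add: h_def)
  qed
  have "piso (gn (set xs)) (gn (set ys)) h"
    unfolding piso_def
  proof (intro conjI ballI)
    show "sub (gn (set xs))" "sub (gn (set ys))" using xs ys by (auto intro: sub_gn)
    have "inj_on h (gn (set xs))"
    proof (rule inj_onI)
      fix x y assume "x \<in> gn (set xs)" "y \<in> gn (set xs)" "h x = h y"
      moreover obtain s t where "s \<in> T" "t \<in> T" "x = evalt M ((!) xs) s" "y = evalt M ((!) xs) t"
        using rep[OF calculation(1)] rep[OF calculation(2)] by blast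
      ultimately show "x = y" using h eq_iff by simp
    qed
    moreover have "h ` gn (set xs) = gn (set ys)"
    proof (intro equalityI subsetI)
      fix y assume "y \<in> h ` gn (set xs)"
      then obtain x where "x \<in> gn (set xs)" "y = h x" by blast
      then show "y \<in> gn (set ys)" using rep h val by metis
    next
      fix y assume "y \<in> gn (set ys)"
      then obtain t where "t \<in> T" "y = evalt M ((!) ys) t" using rep' by blast
      then show "y \<in> h ` gn (set xs)" using h val(1) by (metis imageI)
    qed
    ultimately show "bij_betw h (gn (set xs)) (gn (set ys))" by (simp add: bij_betw_def)
    show "h (x \<otimes> y) = h x \<otimes> h y" if xy: "x \<in> gn (set xs)" "y \<in> gn (set xs)" for x y
    proof -
      obtain s t where st: "s \<in> T" "t \<in> T" "x = evalt M ((!) xs) s" "y = evalt M ((!) xs) t"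
        using rep[OF xy(1)] rep[OF xy(2)] by blast
      have "mulT s t \<in> T" using st(1,2) by (auto simp: T_def)
      then have "h (evalt M ((!) xs) (mulT s t)) = evalt M ((!) ys) (mulT s t)" by (rule h)
      then show ?thesis using st h by (simp add: mult_eq)
    qed
    show "h z = z" if z: "z \<in> C" for z
    proof -
      obtain r where "z = lc M r n" using C_exps[OF z] by blast
      moreover have "lcT r n \<in> T" by (simp add: T_def)
      ultimately show ?thesis using h[of "lcT r n"] by simp
    qed
  qed
  moreover have "ys = map h xs"
  proof (rule nth_equalityI)
    show "length ys = length (map h xs)" using len by simp
    fix i assume "i < length ys"
    then have "Var i \<in> T" "i < length xs" using len by (auto simp: T_def k_def)
    then show "ys ! i = map h xs ! i" using h[of "Var i"] by simp
  qed
  ultimately show ?thesis using xs by (intro eqvI[of "gn (set xs)"]) (auto intro: finite_gn gen.base)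
qed

subsection \<open>Realizing prescribed commutators\<close>

text \<open>Compactness for prescribed commutators. Avoiding \<open>gn N\<close> is expressed by
  inequations with all terms over \<open>N\<close>, each of which has finitely many
  parameters.\<close>

lemma realize_comm:
  assumes sm: "small \<kappa> M (fst ` R \<union> snd ` R \<union> N)"
    and fs: "\<And>R0 N0. finite R0 \<Longrightarrow> R0 \<subseteq> R \<Longrightarrow> finite N0 \<Longrightarrow> N0 \<subseteq> N \<Longrightarrow>
      \<exists>x\<in>carrier G. x \<notin> gn N0 \<and> (\<forall>(y, z)\<in>R0. comm x y = z)"
  obtains x where "x \<in> carrier G" "x \<notin> gn N" "\<And>y z. (y, z) \<in> R \<Longrightarrow> comm x y = z"
proof -
  define \<chi> :: "gsym fm" where
    "\<chi> = Eq (mulT (Var 0) (Var 1)) (mulT (Var 2) (mulT (Var 1) (Var 0)))"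
  define \<Sigma>1 where "\<Sigma>1 = (\<lambda>(y, z). (\<chi>, [y, z])) ` R"
  \<comment> \<open>Variable 0 is the unknown, so the variables for the parameters start at
    1.\<close>
  define \<Sigma>2 where "\<Sigma>2 = {(Neg (Eq (Var 0) t), b) | t b.
    set b \<subseteq> N \<and> wf_trm L t \<and> vars_trm t \<subseteq> {1..<Suc (length b)}}"
  have c: "y \<in> carrier G" "z \<in> carrier G" if "(y, z) \<in> R" for y z
    using small_subset[OF sm] that by (auto simp: image_subset_iff)
  have chi: "pholds M [x] (\<chi>, [y, z]) \<longleftrightarrow> comm x y = z" if "x \<in> carrier G" "(y, z) \<in> R" for x y z
    using comm_unique[of x y z] comm_swap[of x y] c[OF that(2)] that(1)
    by (auto simp: pholds_def holds_def \<chi>_def mult_eq[symmetric])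
  obtain a where a: "a \<in> tuples M 1" "\<And>\<theta>. \<theta> \<in> \<Sigma>1 \<union> \<Sigma>2 \<Longrightarrow> pholds M a \<theta>"
  proof (rule saturated_realize[OF saturated sm, of "\<Sigma>1 \<union> \<Sigma>2"])
    have "\<Sigma>1 \<subseteq> pfms L 1 (fst ` R \<union> snd ` R \<union> N)"
      unfolding \<Sigma>1_def by (force simp: pfms_def fms_def \<chi>_def)
    moreover have "\<Sigma>2 \<subseteq> pfms L 1 (fst ` R \<union> snd ` R \<union> N)"
      unfolding \<Sigma>2_def by (fastforce simp: pfms_def fms_def)
    ultimately show "\<Sigma>1 \<union> \<Sigma>2 \<subseteq> pfms L 1 (fst ` R \<union> snd ` R \<union> N)" by blast
  next
    fix q assume q: "finite q" "q \<subseteq> \<Sigma>1 \<union> \<Sigma>2"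
    define R0 where "R0 = {(y, z) \<in> R. (\<chi>, [y, z]) \<in> q}"
    \<comment> \<open>The restriction to parameters inside \<open>N\<close> is needed since pairs of
      \<open>R\<close> occurring in \<open>q\<close> may lie outside \<open>N\<close>.\<close>
    define N0 where "N0 = \<Union>{set b | \<phi> b. (\<phi>, b) \<in> q \<and> set b \<subseteq> N}"
    have "finite R0"
    proof (rule finite_imageD)
      show "finite ((\<lambda>(y, z). (\<chi>, [y, z])) ` R0)"
        by (rule finite_subset[OF _ q(1)]) (auto simp: R0_def)
      show "inj_on (\<lambda>(y, z). (\<chi>, [y, z])) R0" by (auto simp: inj_on_def)
    qed
    moreover have "finite N0"
    proof -
      have "N0 \<subseteq> (\<Union>\<theta>\<in>q. set (snd \<theta>))" by (force simp: N0_def)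
      then show ?thesis using q(1) by (auto intro: finite_subset)
    qed
    moreover have "R0 \<subseteq> R" "N0 \<subseteq> N" by (auto simp: R0_def N0_def)
    ultimately obtain x where x: "x \<in> carrier G" "x \<notin> gn N0" "\<forall>(y, z)\<in>R0. comm x y = z"
      using fs by blast
    have "pholds M [x] \<theta>" if "\<theta> \<in> q" for \<theta>
    proof (cases "\<theta> \<in> \<Sigma>1")
      case True
      then obtain y z where yz: "(y, z) \<in> R" "\<theta> = (\<chi>, [y, z])" by (auto simp: \<Sigma>1_def)
      then have "(y, z) \<in> R0" using that by (simp add: R0_def)
      then show ?thesis using x chi[OF x(1) yz(1)] yz(2) by auto
    next
      case False
      then have "\<theta> \<in> \<Sigma>2" using that q by blast
      then obtain t b where t: "\<theta> = (Neg (Eq (Var 0) t), b)" "set b \<subseteq> N" "wf_trm L t"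
          "vars_trm t \<subseteq> {1..<Suc (length b)}" by (auto simp: \<Sigma>2_def)
      have "set b \<subseteq> N0" using that t unfolding N0_def by blast
      moreover have "(!) (x # b) ` vars_trm t \<subseteq> set b" using t(4) by (auto simp: nth_Cons' subset_iff)
      ultimately have "evalt M ((!) (x # b)) t \<in> gn N0" using t(3) by (intro evalt_in_gen) auto
      then show ?thesis using x(2) t(1) by (auto simp: pholds_def holds_def)
    qed
    then show "\<exists>a\<in>tuples M 1. \<forall>\<theta>\<in>q. pholds M a \<theta>"
      using x(1) by (intro bexI[of _ "[x]"]) (auto simp: tuples_def carrier_eq)
  qed blast
  obtain x where x: "a = [x]" "x \<in> carrier G"
    using a(1) by (auto simp: tuples_def carrier_eq length_Suc_conv)
  have "x \<notin> gn N"
  proof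
    assume "x \<in> gn N"
    then obtain F where F: "finite F" "F \<subseteq> N" "x \<in> gn F" using gen_finite_support by metis
    obtain b where b: "set b = F" using F(1) finite_list by blast
    have "F = (!) (x # b) ` {1..<Suc (length b)}"
      unfolding b[symmetric] set_conv_nth
      by (force simp: image_iff nth_Cons' Suc_le_eq intro: bexI[of _ "Suc _"])
    then obtain t where t: "wf_trm L t" "vars_trm t \<subseteq> {1..<Suc (length b)}" "x = evalt M ((!) (x # b)) t"
      using F(3) gen_term[of x L M "(!) (x # b)"] by metis
    then have "(Neg (Eq (Var 0) t), b) \<in> \<Sigma>2" using b F by (auto simp: \<Sigma>2_def)
    then have "pholds M [x] (Neg (Eq (Var 0) t), b)" using a(2) x(1) by blast
    then show False using t(3) by (simp add: pholds_def holds_def)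
  qed
  moreover have "comm x y = z" if "(y, z) \<in> R" for y z
  proof -
    have "(\<chi>, [y, z]) \<in> \<Sigma>1" using that unfolding \<Sigma>1_def by force
    then show ?thesis using a(2) chi[OF x(2) that] x(1) by blast
  qed
  ultimately show thesis using that x(2) by blast
qed

end

text \<open>The recursion runs over the sets of elements chosen so far, because the condition on the
  next element refers to that whole set.\<close>

lemma greedy_sequence:
  assumes "\<And>I. finite I \<Longrightarrow> I \<subseteq> J \<Longrightarrow> \<exists>i\<in>J - I. Q I i"
  obtains s :: "nat \<Rightarrow> 'i" where "inj s" "range s \<subseteq> J" "\<And>k. Q (s ` {..<k}) (s k)"
proof -
  have "\<forall>I. \<exists>i. finite I \<and> I \<subseteq> J \<longrightarrow> i \<in> J - I \<and> Q I i" using assms by blast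
  then obtain c where c: "\<And>I. finite I \<Longrightarrow> I \<subseteq> J \<Longrightarrow> c I \<in> J - I \<and> Q I (c I)" by metis
  define S where "S = rec_nat {} (\<lambda>_ I. insert (c I) I)"
  have S: "S 0 = {}" "\<And>k. S (Suc k) = insert (c (S k)) (S k)" by (simp_all add: S_def)
  have fin: "finite (S k) \<and> S k \<subseteq> J" for k by (induction k) (use S c in auto)
  define s where "s k = c (S k)" for k
  have Ss: "S k = s ` {..<k}" for k by (induction k) (auto simp: S s_def lessThan_Suc)
  have sk: "s k \<in> J - s ` {..<k}" "Q (s ` {..<k}) (s k)" for k
    unfolding Ss[symmetric] using c[of "S k"] fin[of k] by (simp_all add: s_def[of k])
  have "s i \<noteq> s j" if "i < j" for i j
    using sk(1)[of j] that by (metis DiffD2 imageI lessThan_iff)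
  then have "inj s" by (metis injI linorder_neqE_nat)
  moreover have "range s \<subseteq> J" using sk(1) by blast
  ultimately show thesis using that sk(2) by blast
qed

section \<open>Dividing and forking\<close>

context monster_group
begin

lemma map_piso_append:
  assumes h: "piso (gn (set xs)) B h" and xs: "set xs \<subseteq> carrier G" and a: "a \<in> gn (set xs)"
  shows "eqv (xs @ [a]) (map h xs @ [h a])"
proof (rule eqvI[OF finite_gn h])
  show "set (xs @ [a]) \<subseteq> gn (set xs)" using a gen_incl[of "set xs" L M] by auto
qed (use xs in auto)

text \<open>Over a maximal common part \<open>U0\<close> of the embeddings \<open>\<sigma> i\<close>, on which infinitely many of them
  agree, the remaining images can be made disjoint from what was chosen before; this lets
  the characters \<open>comm a \<circ> (\<sigma> i)\<inverse>\<close> be amalgamated one after the other.\<close>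

lemma realize_along_subsequence:
  assumes inf: "infinite J" and eqv: "\<And>i. i \<in> J \<Longrightarrow> eqv xs (ys i)"
    and a: "a \<in> carrier G" "a \<notin> gn (set xs)"
  obtains J' b where "infinite J'" "J' \<subseteq> (J :: nat set)" "b \<in> carrier G"
    "\<And>i. i \<in> J' \<Longrightarrow> eqv (xs @ [a]) (ys i @ [b])"
proof -
  define E where "E = gn (set xs)"
  have "\<forall>i. \<exists>h. i \<in> J \<longrightarrow> piso E (gn (set (ys i))) h \<and> ys i = map h xs \<and> finite E \<and>
      set xs \<subseteq> carrier G \<and> set (ys i) \<subseteq> carrier G"
    using eqv eqvE unfolding E_def by metis
  then obtain \<sigma> where \<sigma>: "\<And>i. i \<in> J \<Longrightarrow> piso E (gn (set (ys i))) (\<sigma> i)"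
      "\<And>i. i \<in> J \<Longrightarrow> ys i = map (\<sigma> i) xs"
    and J: "\<And>i. i \<in> J \<Longrightarrow> finite E \<and> set xs \<subseteq> carrier G \<and> set (ys i) \<subseteq> carrier G"
    by metis
  obtain i0 where "i0 \<in> J" using inf by (metis finite.emptyI equals0I)
  then have finE: "finite E" and xs: "set xs \<subseteq> carrier G" using J by auto
  have subE: "sub E" unfolding E_def by (rule sub_gn[OF xs])
  \<comment> \<open>As \<open>E\<close> is finite, the sets \<open>U\<close> on which infinitely
    many embeddings agree have bounded size, so one of largest cardinality exists.\<close>
  define P where "P = (\<lambda>(U, J'). U \<subseteq> E \<and> J' \<subseteq> J \<and> infinite J' \<and> (\<forall>u\<in>U. \<forall>i\<in>J'. \<forall>j\<in>J'. \<sigma> i u = \<sigma> j u))"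
  have P0: "P ({}, J)" using inf by (simp add: P_def)
  have "card (fst y) < Suc (card E)" if "P y" for y
    using finE that by (auto simp: P_def less_Suc_eq_le intro: card_mono)
  then have "\<exists>x. P x \<and> (\<forall>y. P y \<longrightarrow> card (fst y) \<le> card (fst x))"
    by (intro ex_has_greatest_nat[where P = P and k = "({}, J)" and b = "Suc (card E)"] P0) auto
  then obtain UJ where "P UJ" and max: "\<And>y. P y \<Longrightarrow> card (fst y) \<le> card (fst UJ)"
    by (elim exE conjE) blast
  define U0 J0 where "U0 = fst UJ" and "J0 = snd UJ"
  then have "P (U0, J0)" and UJ1: "UJ = (U0, J0)" using \<open>P UJ\<close> by simp_all
  then have "U0 \<subseteq> E \<and> J0 \<subseteq> J \<and> infinite J0 \<and> (\<forall>u\<in>U0. \<forall>i\<in>J0. \<forall>j\<in>J0. \<sigma> i u = \<sigma> j u)"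
    unfolding P_def prod.case by blast
  then have UJ: "UJ = (U0, J0)" "U0 \<subseteq> E" "J0 \<subseteq> J" "infinite J0"
    and const: "\<And>u i j. u \<in> U0 \<Longrightarrow> i \<in> J0 \<Longrightarrow> j \<in> J0 \<Longrightarrow> \<sigma> i u = \<sigma> j u"
    using UJ1 by blast+
  \<comment> \<open>Otherwise \<open>u\<close> could be added to \<open>U0\<close> after shrinking
    the index set, against maximality.\<close>
  have fin1: "finite {i\<in>J0. \<sigma> i u = w}" if u: "u \<in> E - U0" for u w
  proof (rule ccontr)
    assume "infinite {i\<in>J0. \<sigma> i u = w}"
    then have "P (insert u U0, {i\<in>J0. \<sigma> i u = w})"
      using u UJ const by (auto simp: P_def)
    then have "card (insert u U0) \<le> card U0" using max UJ(1) by fastforce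
    moreover have "finite U0" using UJ(2) finE finite_subset by blast
    ultimately show False using u by simp
  qed
  define Q where "Q I i \<longleftrightarrow> (\<forall>u\<in>E - U0. \<sigma> i u \<notin> gn (\<Union>j\<in>I. set (ys j)))" for I i
  \<comment> \<open>Each of the finitely many \<open>u\<close> outside \<open>U0\<close> is sent
    into the finite set \<open>?F\<close> by only finitely many of the embeddings, so all but
    finitely many indices of \<open>J0\<close> qualify.\<close>
  have "\<exists>i\<in>J0 - I. Q I i" if I: "finite I" "I \<subseteq> J0" for I
  proof -
    let ?F = "gn (\<Union>j\<in>I. set (ys j))"
    have "finite ?F" using I J UJ(3) by (intro finite_gn) (auto dest!: subsetD)
    then have fin2: "finite (\<Union>u\<in>E - U0. \<Union>w\<in>?F. {i\<in>J0. \<sigma> i u = w})"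
      using fin1 finE by (intro finite_UN_I) auto
    have "infinite (J0 - (I \<union> (\<Union>u\<in>E - U0. \<Union>w\<in>?F. {i\<in>J0. \<sigma> i u = w})))"
      by (rule Diff_infinite_finite[OF finite_UnI[OF I(1) fin2] UJ(4)])
    then have "J0 - (I \<union> (\<Union>u\<in>E - U0. \<Union>w\<in>?F. {i\<in>J0. \<sigma> i u = w})) \<noteq> {}"
      by (rule infinite_imp_nonempty)
    then obtain i where "i \<in> J0 - (I \<union> (\<Union>u\<in>E - U0. \<Union>w\<in>?F. {i\<in>J0. \<sigma> i u = w}))"
      unfolding ex_in_conv[symmetric] by (elim exE) (rule that)
    then show ?thesis by (intro bexI[of _ i]) (auto simp: Q_def)
  qed
  then obtain s :: "nat \<Rightarrow> nat" where s: "inj s" "range s \<subseteq> J0" "\<And>k. Q (s ` {..<k}) (s k)"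
    using greedy_sequence[of J0 Q] by blast
  have sJ: "s k \<in> J" "s k \<in> J0" for k using s(2) UJ(3) by auto
  define N where "N k = (\<Union>j<k. set (ys (s j)))" for k
  have N: "N k \<subseteq> carrier G" "finite (N k)" for k using J sJ by (auto simp: N_def)
  have chE: "chr E (comm a)" by (rule chr_comm[OF a(1) subE])
  \<comment> \<open>\<open>F\<close> is the commutator map that \<open>b\<close> must have on
    everything generated by the first \<open>k\<close> tuples.\<close>
  have amalg: "\<exists>F. chr (gn (N k)) F \<and> (\<forall>j<k. \<forall>u\<in>E. F (\<sigma> (s j) u) = comm a u)" for k
  proof (induction k)
    case 0
    have "chr (gn (N 0)) (\<lambda>_. \<one>)" by (simp add: chr_def)
    then show ?case by blast
  next
    case (Suc k)
    then obtain F where F: "chr (gn (N k)) F" "\<And>j u. j < k \<Longrightarrow> u \<in> E \<Longrightarrow> F (\<sigma> (s j) u) = comm a u"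
      by blast
    let ?Y = "set (ys (s k))" and ?\<sigma> = "\<sigma> (s k)"
    note h = \<sigma>(1)[OF sJ(1)[of k]] and Y = J[OF sJ(1)[of k]]
    note d = pisoD[OF h]
    define f where "f y = comm a (inv_into E ?\<sigma> y)" for y
    have f: "chr (gn ?Y) f" unfolding f_def by (rule chr_piso[OF piso_sym[OF h] chE])
    have f\<sigma>: "f (?\<sigma> u) = comm a u" if "u \<in> E" for u using d(4) that by (simp add: f_def)
    \<comment> \<open>By the choice of \<open>s\<close>, an element of the overlap comes from some
      \<open>u\<close> in \<open>U0\<close>, where all embeddings agree; an earlier stage has
      already given it the value \<open>comm a u\<close>. For \<open>k = 0\<close> there is no
      earlier stage, but then the overlap is just \<open>C\<close>.\<close>
    have "F x = f x" if x: "x \<in> gn (N k)" "x \<in> gn ?Y" for x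
    proof (cases "x \<in> C")
      case True
      then show ?thesis using chr_C[OF F(1)] chr_C[OF f] by simp
    next
      case False
      obtain u where u: "u \<in> E" "x = ?\<sigma> u" using d(5) x(2) by blast
      have "(\<Union>j\<in>s ` {..<k}. set (ys j)) = N k" by (simp add: N_def)
      then have u0: "u \<in> U0" using s(3)[of k] x(1) u unfolding Q_def by auto
      have "k \<noteq> 0"
      proof
        assume "k = 0"
        then have "N k = {}" by (simp add: N_def)
        then show False using False x(1) gn_empty by simp
      qed
      then have "F (\<sigma> (s 0) u) = comm a u" using F(2) u(1) by simp
      moreover have "\<sigma> (s 0) u = x" using const[OF u0 sJ(2) sJ(2)] u(2) by simp
      ultimately show ?thesis using f\<sigma>[OF u(1)] u(2) by simp
    qed
    then obtain F' where F': "chr (gn (N k) <#> gn ?Y) F'" "\<And>x. x \<in> gn (N k) \<Longrightarrow> F' x = F x"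
        "\<And>y. y \<in> gn ?Y \<Longrightarrow> F' y = f y"
      using chr_amalgam[OF sub_gn[OF N(1)[of k]] sub_gn[of ?Y] F(1) f] Y by blast
    have "N (Suc k) = N k \<union> ?Y" by (auto simp: N_def lessThan_Suc)
    then have "gn (N (Suc k)) = gn (N k) <#> gn ?Y" using gn_Un[OF N(1)[of k], of ?Y] Y by simp
    moreover have "F' (\<sigma> (s j) u) = comm a u" if j: "j < Suc k" and u: "u \<in> E" for j u
    proof (cases "j = k")
      case True
      then show ?thesis using F'(3)[OF d(6)[OF u]] f\<sigma>[OF u] by simp
    next
      case False
      then have "j < k" using j by simp
      have "gn (set (ys (s j))) \<subseteq> gn (N k)" using \<open>j < k\<close> by (intro gen_mono) (auto simp: N_def)
      then have "\<sigma> (s j) u \<in> gn (N k)" using pisoD(6)[OF \<sigma>(1)[OF sJ(1)[of j]] u] by blast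
      then show ?thesis using F'(2) F(2)[OF \<open>j < k\<close> u] by simp
    qed
    ultimately show ?case using F'(1) by metis
  qed
  define R where "R = {(\<sigma> (s k) u, comm a u) | k u. u \<in> E}"
  define NN where "NN = (\<Union>k. N k)"
  have Rc: "fst ` R \<union> snd ` R \<subseteq> carrier G"
  proof -
    have "\<sigma> (s k) u \<in> carrier G" if "u \<in> E" for k u
      using pisoD(2,6)[OF \<sigma>(1)[OF sJ(1)[of k]]] that sub_carrier by blast
    then show ?thesis using a(1) sub_carrier[OF subE] by (auto simp: R_def)
  qed
  have "countable R"
  proof -
    have "R = (\<Union>k. (\<lambda>u. (\<sigma> (s k) u, comm a u)) ` E)" by (auto simp: R_def)
    then show ?thesis using finE by (simp add: countable_finite)
  qed
  then have sm: "small \<kappa> M (fst ` R \<union> snd ` R \<union> NN)"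
    using Rc N by (intro small_countable) (auto simp: NN_def countable_finite)
  \<comment> \<open>A finite part of \<open>R\<close> concerns only the first \<open>K\<close>
    tuples, where \<open>amalg\<close> provides a character to be realized by
    \<open>ext_point\<close>.\<close>
  obtain b where b: "b \<in> carrier G" "b \<notin> gn NN" "\<And>y z. (y, z) \<in> R \<Longrightarrow> comm b y = z"
  proof (rule realize_comm[OF sm])
    fix R0 N0 assume R0: "finite R0" "R0 \<subseteq> R" and N0: "finite N0" "N0 \<subseteq> NN"
    have "\<forall>r\<in>R0. \<exists>k. \<exists>u\<in>E. r = (\<sigma> (s k) u, comm a u)" using R0(2) unfolding R_def by blast
    then obtain kr where kr: "\<And>r. r \<in> R0 \<Longrightarrow> \<exists>u\<in>E. r = (\<sigma> (s (kr r)) u, comm a u)" by metis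
    \<comment> \<open>Inserting 0 covers the case that \<open>R0\<close> is empty.\<close>
    define K where "K = Suc (Max (insert 0 (kr ` R0)))"
    have krK: "kr r < K" if "r \<in> R0" for r
      using that R0(1) by (auto simp: K_def less_Suc_eq_le)
    obtain F where F: "chr (gn (N K)) F" "\<And>j u. j < K \<Longrightarrow> u \<in> E \<Longrightarrow> F (\<sigma> (s j) u) = comm a u"
      using amalg[of K] by blast
    have N0c: "N0 \<subseteq> carrier G" using N0(2) N by (auto simp: NN_def)
    obtain x where x: "x \<in> carrier G" "x \<notin> gn (N K \<union> N0)" "\<And>y. y \<in> gn (N K) \<Longrightarrow> comm x y = F y"
      using ext_point[OF N(2)[of K] N(1)[of K] F(1) N0(1) N0c] by blast
    have "x \<notin> gn N0" using x(2) gen_mono[of N0 "N K \<union> N0" L M] by blast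
    moreover have "\<forall>(y, z)\<in>R0. comm x y = z"
    proof clarify
      fix y z assume r: "(y, z) \<in> R0"
      define l where "l = kr (y, z)"
      have l: "l < K" using krK[OF r] by (simp only: l_def)
      obtain u where "u \<in> E" "(y, z) = (\<sigma> (s l) u, comm a u)" using kr[OF r] unfolding l_def by blast
      then have u: "u \<in> E" "y = \<sigma> (s l) u" "z = comm a u" by blast+
      have "gn (set (ys (s l))) \<subseteq> gn (N K)" using l by (intro gen_mono) (auto simp: N_def)
      then have "y \<in> gn (N K)" using pisoD(6)[OF \<sigma>(1)[OF sJ(1)] u(1)] u(2) by blast
      then show "comm x y = z" using x(3) F(2)[OF l u(1)] u(2,3) by simp
    qed
    ultimately show "\<exists>x\<in>carrier G. x \<notin> gn N0 \<and> (\<forall>(y, z)\<in>R0. comm x y = z)" using x(1) by blast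
  qed (rule that, assumption+)
  have "eqv (xs @ [a]) (ys i @ [b])" if "i \<in> range s" for i
  proof -
    obtain k where k: "i = s k" using \<open>i \<in> range s\<close> by blast
    note h = \<sigma>(1)[OF sJ(1)[of k]]
    have nb: "b \<notin> gn (set (ys (s k)))"
      using b(2) gen_mono[of "set (ys (s k))" NN L M] by (auto simp: NN_def N_def)
    have cm: "comm b (\<sigma> (s k) y) = comm a y" if "y \<in> E" for y
      using b(3) that by (auto simp: R_def)
    obtain h' where h': "piso (adj E a) (adj (gn (set (ys (s k)))) b) h'"
        "\<And>x. x \<in> E \<Longrightarrow> h' x = \<sigma> (s k) x" "h' a = b"
      using piso_adj[OF h a(1) _ b(1) nb cm] a(2) unfolding E_def by blast
    have xsE: "set xs \<subseteq> E" unfolding E_def by (rule gen_incl)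
    show ?thesis
    proof (rule eqvI[OF finite_adj[OF finE a(1)] h'(1)])
      show "set (xs @ [a]) \<subseteq> adj E a" using xsE adj_incl[OF subE] adj_self[OF subE a(1)] by auto
      show "ys i @ [b] = map h' (xs @ [a])" using h'(2,3) xsE \<sigma>(2)[OF sJ(1)[of k]] k by auto
    qed
  qed
  moreover have "infinite (range s)" using s(1) by (simp add: finite_image_iff)
  moreover have "range s \<subseteq> J" using sJ by blast
  ultimately show thesis using that b(1) by blast
qed

text \<open>Independence of a tuple from \<open>E\<close> over \<open>P\<close>, tested entry by entry so that no basis of the tuple over
  \<open>P\<close> has to be chosen.\<close>

primrec free :: "'a list \<Rightarrow> 'a set \<Rightarrow> 'a set \<Rightarrow> bool" where
  "free [] P E \<longleftrightarrow> True"
| "free (a # as) P E \<longleftrightarrow> (a \<in> gn P \<or> a \<notin> gn (E \<union> P)) \<and> free as (insert a P) E"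

lemma free_antimono: "free as P H \<Longrightarrow> E \<subseteq> H \<Longrightarrow> free as P E"
proof (induction as arbitrary: P)
  case (Cons a as)
  moreover have "gn (E \<union> P) \<subseteq> gn (H \<union> P)" using Cons.prems by (intro gen_mono) auto
  ultimately show ?case by auto
qed simp

lemma freeI:
  assumes "\<And>j. j < length as \<Longrightarrow>
    as ! j \<in> gn (P \<union> set (take j as)) \<or> as ! j \<notin> gn (E \<union> P \<union> set (take j as))"
  shows "free as P E"
  using assms
proof (induction as arbitrary: P)
  case (Cons a as)
  have "free as (insert a P) E"
  proof (rule Cons.IH)
    fix j assume "j < length as"
    then show "as ! j \<in> gn (insert a P \<union> set (take j as)) \<or> as ! j \<notin> gn (E \<union> insert a P \<union> set (take j as))"
      using Cons.prems[of "Suc j"] by (simp add: Un_insert_right)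
  qed
  then show ?case using Cons.prems[of 0] by simp
qed simp

lemma gn_list_term:
  assumes "x \<in> gn (set xs)"
  obtains t where "wf_trm L t" "vars_trm t \<subseteq> {..<length xs}" "x = evalt M ((!) xs) t"
proof -
  have "set xs = (!) xs ` {..<length xs}" by (auto simp: in_set_conv_nth image_iff)
  then show thesis using assms that gen_term[of x L M "(!) xs" "{..<length xs}"] by auto
qed

lemma evalt_piso_list:
  assumes h: "piso A B h" and xs: "set xs \<subseteq> A" and t: "wf_trm L t" "vars_trm t \<subseteq> {..<length xs}"
  shows "evalt M ((!) (map h xs)) t = h (evalt M ((!) xs) t)"
proof -
  have "evalt M ((!) (map h xs)) t = evalt M (h \<circ> (!) xs) t" using t by (intro evalt_cong) auto
  also have "\<dots> = h (evalt M ((!) xs) t)" using xs t by (intro piso_evalt[OF h]) (auto simp: subset_iff)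
  finally show ?thesis .
qed

text \<open>One tuple \<open>as'\<close> has to work for all remaining indices. An entry dependent
  on \<open>\<beta>\<close> is copied by the same term over \<open>\<beta>'\<close>, which does not
  involve the index; any other entry is realized along a subsequence. Each treated entry joins
  \<open>\<beta>\<close> and its copy joins \<open>\<beta>'\<close>, which is why the two may
  differ.\<close>

lemma free_realize:
  assumes "free as (set \<beta>) (set \<epsilon>)" "infinite J" "\<And>i. i \<in> J \<Longrightarrow> eqv (\<epsilon> @ \<beta>) (\<epsilon>s i @ \<beta>')"
    "length \<beta>' = length \<beta>" "set as \<subseteq> carrier G"
  shows "\<exists>J' as'. infinite J' \<and> J' \<subseteq> (J :: nat set) \<and> (\<forall>i\<in>J'. eqv (\<epsilon> @ \<beta> @ as) (\<epsilon>s i @ \<beta>' @ as'))"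
  using assms
proof (induction as arbitrary: \<beta> \<beta>' J)
  case Nil
  then show ?case by (intro exI[of _ J] exI[of _ "[]"]) auto
next
  case (Cons a as)
  have "\<exists>J1 a'. infinite J1 \<and> J1 \<subseteq> J \<and> (\<forall>i\<in>J1. eqv ((\<epsilon> @ \<beta>) @ [a]) ((\<epsilon>s i @ \<beta>') @ [a']))"
  proof (cases "a \<in> gn (set \<beta>)")
    case True
    then obtain t where t: "wf_trm L t" "vars_trm t \<subseteq> {..<length \<beta>}" "a = evalt M ((!) \<beta>) t"
      by (rule gn_list_term)
    have "eqv ((\<epsilon> @ \<beta>) @ [a]) ((\<epsilon>s i @ \<beta>') @ [evalt M ((!) \<beta>') t])" if i: "i \<in> J" for i
    proof -
      obtain h where h: "piso (gn (set (\<epsilon> @ \<beta>))) (gn (set (\<epsilon>s i @ \<beta>'))) h" "\<epsilon>s i @ \<beta>' = map h (\<epsilon> @ \<beta>)"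
          "finite (gn (set (\<epsilon> @ \<beta>)))" "set (\<epsilon> @ \<beta>) \<subseteq> carrier G" "set (\<epsilon>s i @ \<beta>') \<subseteq> carrier G"
        by (rule eqvE[OF Cons.prems(3)[OF i]])
      have "\<beta>' = map h \<beta>" using h(2) Cons.prems(4) by (simp add: append_eq_append_conv)
      then have "evalt M ((!) \<beta>') t = h a"
        using evalt_piso_list[OF h(1) _ t(1,2)] gen_incl[of "set (\<epsilon> @ \<beta>)" L M] t(3) by simp
      moreover have "a \<in> gn (set (\<epsilon> @ \<beta>))" using True gen_mono[of "set \<beta>" "set (\<epsilon> @ \<beta>)" L M] by auto
      ultimately show ?thesis using map_piso_append[OF h(1,4)] h(2) by simp
    qed
    then show ?thesis using Cons.prems(2) by blast
  next
    case False
    then have "a \<notin> gn (set (\<epsilon> @ \<beta>))" using Cons.prems(1) by simp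
    moreover have "a \<in> carrier G" using Cons.prems(5) by simp
    ultimately obtain J1 b where "infinite J1" "J1 \<subseteq> J" "b \<in> carrier G"
        "\<And>i. i \<in> J1 \<Longrightarrow> eqv ((\<epsilon> @ \<beta>) @ [a]) ((\<epsilon>s i @ \<beta>') @ [b])"
      using realize_along_subsequence[where ys = "\<lambda>i. \<epsilon>s i @ \<beta>'", OF Cons.prems(2) Cons.prems(3)] by metis
    then show ?thesis by blast
  qed
  then obtain J1 a' where J1: "infinite J1" "J1 \<subseteq> J"
      "\<And>i. i \<in> J1 \<Longrightarrow> eqv (\<epsilon> @ (\<beta> @ [a])) (\<epsilon>s i @ (\<beta>' @ [a']))" by auto
  have "\<exists>J' as'. infinite J' \<and> J' \<subseteq> J1 \<and> (\<forall>i\<in>J'. eqv (\<epsilon> @ (\<beta> @ [a]) @ as) (\<epsilon>s i @ (\<beta>' @ [a']) @ as'))"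
    by (rule Cons.IH[OF _ J1(1,3)]) (use Cons.prems in auto)
  then obtain J' as' where "infinite J'" "J' \<subseteq> J1"
      "\<forall>i\<in>J'. eqv (\<epsilon> @ \<beta> @ a # as) (\<epsilon>s i @ \<beta>' @ a' # as')" by auto
  then show ?case using J1(2) by (intro exI[of _ J'] exI[of _ "a' # as'"]) auto
qed

text \<open>Entries dependent on \<open>\<beta>\<close> are moved by the isomorphism; the others are
  chosen outside everything generated together with \<open>H\<close>. In the application
  \<open>H\<close> contains the parameters of all the dividing formulas.\<close>

lemma free_extend:
  assumes "free as (set \<beta>) (set \<gamma>)" "eqv (\<gamma> @ \<beta>) (\<gamma>' @ \<beta>')" "length \<beta>' = length \<beta>"
    "finite H" "H \<subseteq> carrier G" "set \<gamma>' \<subseteq> H" "set as \<subseteq> carrier G"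
  shows "\<exists>as'. eqv (\<gamma> @ \<beta> @ as) (\<gamma>' @ \<beta>' @ as') \<and> free as' (set \<beta>') H"
  using assms
proof (induction as arbitrary: \<beta> \<beta>')
  case Nil
  then show ?case by (intro exI[of _ "[]"]) auto
next
  case (Cons a as)
  obtain h where h: "piso (gn (set (\<gamma> @ \<beta>))) (gn (set (\<gamma>' @ \<beta>'))) h" "\<gamma>' @ \<beta>' = map h (\<gamma> @ \<beta>)"
      "finite (gn (set (\<gamma> @ \<beta>)))" "set (\<gamma> @ \<beta>) \<subseteq> carrier G" "set (\<gamma>' @ \<beta>') \<subseteq> carrier G"
    by (rule eqvE[OF Cons.prems(2)])
  have \<beta>': "\<beta>' = map h \<beta>" using h(2) Cons.prems(3) by (simp add: append_eq_append_conv)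
  note d = pisoD[OF h(1)]
  have "\<exists>a'. eqv ((\<gamma> @ \<beta>) @ [a]) ((\<gamma>' @ \<beta>') @ [a']) \<and> (a' \<in> gn (set \<beta>') \<or> a' \<notin> gn (H \<union> set \<beta>'))"
  proof (cases "a \<in> gn (set \<beta>)")
    case True
    moreover have \<beta>A: "set \<beta> \<subseteq> gn (set (\<gamma> @ \<beta>))" using gen_incl[of "set (\<gamma> @ \<beta>)" L M] by auto
    ultimately have "h a \<in> gn (set \<beta>')" using piso_image_gn[OF h(1) \<beta>A] \<beta>' by auto
    moreover have "a \<in> gn (set (\<gamma> @ \<beta>))" using True gen_mono[of "set \<beta>" "set (\<gamma> @ \<beta>)" L M] by auto
    ultimately show ?thesis using map_piso_append[OF h(1,4)] h(2) by metis
  next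
    case False
    then have na: "a \<notin> gn (set (\<gamma> @ \<beta>))" using Cons.prems(1) by simp
    have ca: "a \<in> carrier G" using Cons.prems by simp
    have f: "chr (gn (set (\<gamma>' @ \<beta>'))) (\<lambda>y. comm a (inv_into (gn (set (\<gamma> @ \<beta>))) h y))"
      by (rule chr_piso[OF piso_sym[OF h(1)] chr_comm[OF ca d(1)]])
    obtain b where b: "b \<in> carrier G" "b \<notin> gn (set (\<gamma>' @ \<beta>') \<union> H)"
        "\<And>y. y \<in> gn (set (\<gamma>' @ \<beta>')) \<Longrightarrow> comm b y = comm a (inv_into (gn (set (\<gamma> @ \<beta>))) h y)"
      using ext_point[OF _ h(5) f Cons.prems(4,5)] by auto
    have nb: "b \<notin> gn (H \<union> set \<beta>')" "b \<notin> gn (set (\<gamma>' @ \<beta>'))"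
      using b(2) gen_mono[of "H \<union> set \<beta>'" "set (\<gamma>' @ \<beta>') \<union> H" L M]
        gen_mono[of "set (\<gamma>' @ \<beta>')" "set (\<gamma>' @ \<beta>') \<union> H" L M] by auto
    have cm: "comm b (h y) = comm a y" if "y \<in> gn (set (\<gamma> @ \<beta>))" for y
      using b(3)[OF d(6)[OF that]] d(4) that by simp
    obtain k where k: "piso (adj (gn (set (\<gamma> @ \<beta>))) a) (adj (gn (set (\<gamma>' @ \<beta>'))) b) k"
        "\<And>x. x \<in> gn (set (\<gamma> @ \<beta>)) \<Longrightarrow> k x = h x" "k a = b"
      using piso_adj[OF h(1) ca na b(1) nb(2) cm] by blast
    have "eqv ((\<gamma> @ \<beta>) @ [a]) ((\<gamma>' @ \<beta>') @ [b])"
    proof (rule eqvI[OF finite_adj[OF h(3) ca] k(1)])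
      show "set ((\<gamma> @ \<beta>) @ [a]) \<subseteq> adj (gn (set (\<gamma> @ \<beta>))) a"
        using gen_incl[of "set (\<gamma> @ \<beta>)" L M] adj_incl[OF d(1), of a] adj_self[OF d(1) ca] by auto
      have "map h (\<gamma> @ \<beta>) = map k (\<gamma> @ \<beta>)"
        using k(2) gen_incl[of "set (\<gamma> @ \<beta>)" L M] by (intro map_cong) auto
      then show "(\<gamma>' @ \<beta>') @ [b] = map k ((\<gamma> @ \<beta>) @ [a])" using h(2) k(3) by simp
    qed
    then show ?thesis using nb(1) by blast
  qed
  then obtain a' where a': "eqv (\<gamma> @ (\<beta> @ [a])) (\<gamma>' @ (\<beta>' @ [a']))"
      "a' \<in> gn (set \<beta>') \<or> a' \<notin> gn (H \<union> set \<beta>')" by auto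
  have "\<exists>as'. eqv (\<gamma> @ (\<beta> @ [a]) @ as) (\<gamma>' @ (\<beta>' @ [a']) @ as') \<and> free as' (set (\<beta>' @ [a'])) H"
    by (rule Cons.IH[OF _ a'(1)]) (use Cons.prems in auto)
  then obtain as' where "eqv (\<gamma> @ \<beta> @ a # as) (\<gamma>' @ \<beta>' @ a' # as')" "free as' (insert a' (set \<beta>')) H"
    by auto
  then show ?case using a'(2) by (intro exI[of _ "a' # as'"]) auto
qed

lemma pholds_eqv:
  assumes "eqv (\<epsilon> @ \<beta> @ as) (\<epsilon>' @ \<beta>' @ as')" "length \<epsilon>' = length \<epsilon>" "length \<beta>' = length \<beta>"
    "\<phi> \<in> fms L (length as + length \<epsilon>)"
  shows "pholds M as (\<phi>, \<epsilon>) \<longleftrightarrow> pholds M as' (\<phi>, \<epsilon>')"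
proof -
  obtain h where h: "piso (gn (set (\<epsilon> @ \<beta> @ as))) (gn (set (\<epsilon>' @ \<beta>' @ as'))) h"
      "\<epsilon>' @ \<beta>' @ as' = map h (\<epsilon> @ \<beta> @ as)" "finite (gn (set (\<epsilon> @ \<beta> @ as)))"
      "set (\<epsilon> @ \<beta> @ as) \<subseteq> carrier G" "set (\<epsilon>' @ \<beta>' @ as') \<subseteq> carrier G"
    by (rule eqvE[OF assms(1)])
  have e: "\<epsilon>' = map h \<epsilon>" "as' = map h as" using h(2) assms(2,3) by (auto simp: append_eq_append_conv)
  have "holds M \<phi> (as @ \<epsilon>) \<longleftrightarrow> holds M \<phi> (map h (as @ \<epsilon>))"
    by (rule piso_holds[OF h(3,1)]) (use gen_incl[of "set (\<epsilon> @ \<beta> @ as)" L M] assms(4) in auto)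
  then show ?thesis by (simp add: pholds_def e)
qed

text \<open>The realization is chosen free from \<open>\<gamma>\<close> and from all parameters of
  \<open>D\<close> together. If it satisfied some member of \<open>D\<close>, then
  \<open>free_realize\<close> would produce a common solution for infinitely many instances of the
  dividing sequence, contradicting \<open>m\<close>-inconsistency.\<close>

lemma free_not_forking:
  assumes as: "set as \<subseteq> carrier G" and \<gamma>: "set \<gamma> \<subseteq> carrier G" and \<beta>: "set \<beta> \<subseteq> B" "set \<beta> \<subseteq> carrier G"
    and free: "free as (set \<beta>) (set \<gamma>)"
    and p0: "\<And>\<theta>. \<theta> \<in> p0 \<Longrightarrow> \<theta> \<in> pfms L (length as) (set \<gamma>) \<and> pholds M as \<theta>"
    and D: "finite D" "D \<subseteq> pfms L (length as) (univ M)" "\<And>\<theta>. \<theta> \<in> D \<Longrightarrow> divides L M (length as) \<theta> B"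
  shows "\<exists>a\<in>tuples M (length as). (\<forall>\<theta>\<in>p0. pholds M a \<theta>) \<and> (\<forall>\<theta>\<in>D. \<not> pholds M a \<theta>)"
proof -
  define H where "H = set \<gamma> \<union> (\<Union>\<theta>\<in>D. set (snd \<theta>))"
  have "set (snd \<theta>) \<subseteq> univ M" if "\<theta> \<in> D" for \<theta>
    using subsetD[OF D(2) that] by (cases \<theta>) (simp add: pfms_def)
  then have H: "finite H" "H \<subseteq> carrier G"
    using D(1) \<gamma> by (auto simp: H_def carrier_eq)
  have "eqv (\<gamma> @ \<beta>) (\<gamma> @ \<beta>)" using \<gamma> \<beta> by (intro eqv_refl) auto
  then obtain a where a: "eqv (\<gamma> @ \<beta> @ as) (\<gamma> @ \<beta> @ a)" "free a (set \<beta>) H"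
    using free_extend[OF free _ refl H _ as] by (auto simp: H_def)
  have len: "length a = length as" using eqv_length[OF a(1)] by simp
  have ac: "set a \<subseteq> carrier G" using eqvE[OF a(1)] by (metis Un_subset_iff set_append)
  have "pholds M a \<theta>" if \<theta>: "\<theta> \<in> p0" for \<theta>
  proof -
    obtain \<phi> b where b: "\<theta> = (\<phi>, b)" "set b \<subseteq> set \<gamma>" "\<phi> \<in> fms L (length as + length b)"
      using p0[OF \<theta>] by (cases \<theta>) (auto simp: pfms_def)
    obtain h where h: "piso (gn (set (\<gamma> @ \<beta> @ as))) (gn (set (\<gamma> @ \<beta> @ a))) h"
        "\<gamma> @ \<beta> @ a = map h (\<gamma> @ \<beta> @ as)" "finite (gn (set (\<gamma> @ \<beta> @ as)))"
        "set (\<gamma> @ \<beta> @ as) \<subseteq> carrier G" "set (\<gamma> @ \<beta> @ a) \<subseteq> carrier G"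
      by (rule eqvE[OF a(1)])
    have e: "map h \<gamma> = \<gamma>" "a = map h as" using h(2) by auto
    have "h x = x" if "x \<in> set \<gamma>" for x using e(1) that by (metis map_eq_conv map_ident)
    then have "map h b = b" using b(2) by (auto intro!: map_idI)
    moreover have "holds M \<phi> (as @ b) \<longleftrightarrow> holds M \<phi> (map h (as @ b))"
      by (rule piso_holds[OF h(3,1)])
        (use gen_incl[of "set (\<gamma> @ \<beta> @ as)" L M] b in auto)
    ultimately show ?thesis using p0[OF \<theta>] e(2) b(1) by (simp add: pholds_def)
  qed
  moreover have "\<not> pholds M a \<theta>" if \<theta>: "\<theta> \<in> D" for \<theta>
  proof
    assume hold: "pholds M a \<theta>"
    obtain \<phi> \<epsilon> where \<epsilon>: "\<theta> = (\<phi>, \<epsilon>)" by (cases \<theta>)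
    then have \<phi>: "\<phi> \<in> fms L (length as + length \<epsilon>)" "set \<epsilon> \<subseteq> carrier G" "set \<epsilon> \<subseteq> H"
      using D(2) \<theta> by (auto simp: pfms_def carrier_eq H_def)
    obtain \<epsilon>s :: "nat \<Rightarrow> 'a list" and m
      where *: "(\<forall>i. \<epsilon>s i \<in> tuples M (length \<epsilon>) \<and> tp L M B (\<epsilon>s i) = tp L M B \<epsilon>) \<and>
        (\<forall>I. finite I \<and> card I = m \<longrightarrow> \<not> (\<exists>a\<in>tuples M (length as). \<forall>i\<in>I. pholds M a (\<phi>, \<epsilon>s i)))"
      using D(3)[OF \<theta>] unfolding divides_def \<epsilon> fst_conv snd_conv by (elim exE) (rule that, assumption)
    then have \<epsilon>s: "\<And>i. \<epsilon>s i \<in> tuples M (length \<epsilon>)" "\<And>i. tp L M B (\<epsilon>s i) = tp L M B \<epsilon>"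
      by simp_all
    have incons: "\<not> (\<exists>a\<in>tuples M (length as). \<forall>i\<in>I. pholds M a (\<phi>, \<epsilon>s i))"
      if "finite I" "card I = m" for I
      using *[THEN conjunct2, rule_format, of I] that by simp
    have "eqv (\<epsilon> @ \<beta>) (\<epsilon>s i @ \<beta>)" for i
    proof (rule eqv_of_same_type)
      show "set (\<epsilon> @ \<beta>) \<subseteq> carrier G" using \<phi> \<beta> by auto
      show "set (\<epsilon>s i @ \<beta>) \<subseteq> carrier G" using \<epsilon>s(1)[of i] \<beta> by (auto simp: tuples_def carrier_eq)
      show len: "length (\<epsilon> @ \<beta>) = length (\<epsilon>s i @ \<beta>)" using \<epsilon>s(1)[of i] by (simp add: tuples_def)
      fix \<psi> assume \<psi>: "\<psi> \<in> fms L (length (\<epsilon> @ \<beta>))" "holds M \<psi> (\<epsilon> @ \<beta>)"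
      then have "(\<psi>, \<beta>) \<in> tp L M B \<epsilon>" using \<beta> by (simp add: tp_def pfms_def pholds_def)
      then have "(\<psi>, \<beta>) \<in> tp L M B (\<epsilon>s i)" using \<epsilon>s(2)[of i] by simp
      then show "holds M \<psi> (\<epsilon>s i @ \<beta>)" by (simp add: tp_def pholds_def)
    qed
    then obtain J a' where J: "infinite J" "\<And>i. i \<in> J \<Longrightarrow> eqv (\<epsilon> @ \<beta> @ a) (\<epsilon>s i @ \<beta> @ a')"
      using free_realize[OF free_antimono[OF a(2) \<phi>(3)] infinite_UNIV_nat _ refl ac, of \<epsilon>s] by blast
    obtain I where I: "finite I" "card I = m" "I \<subseteq> J" using infinite_arbitrarily_large[OF J(1)] by blast
    obtain i0 where "i0 \<in> J" using J(1) by (metis finite.emptyI equals0I)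
    have len\<epsilon>: "length (\<epsilon>s i) = length \<epsilon>" for i using \<epsilon>s(1)[of i] by (simp add: tuples_def)
    have "set a' \<subseteq> carrier G" using eqvE[OF J(2)[OF \<open>i0 \<in> J\<close>]] by (metis Un_subset_iff set_append)
    moreover have "length a' = length as"
      using eqv_length[OF J(2)[OF \<open>i0 \<in> J\<close>]] len\<epsilon>[of i0] len by simp
    ultimately have "a' \<in> tuples M (length as)" by (simp add: tuples_def carrier_eq)
    moreover have "pholds M a' (\<phi>, \<epsilon>s i)" if "i \<in> I" for i
      using pholds_eqv[OF J(2)[OF subsetD[OF I(3) that]] len\<epsilon> refl] \<phi>(1) hold len \<epsilon> by simp
    ultimately show False using incons[OF I(1,2)] by blast
  qed
  ultimately show ?thesis using ac len by (intro bexI[of _ a]) (auto simp: tuples_def carrier_eq)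
qed

subsection \<open>Non-forking extensions and independence\<close>

text \<open>Finitely many terms whose values exhaust the substructure generated by the values of
  \<open>vs\<close>, in the normal form of \<open>adj_mod\<close>. Not belonging to it is thus
  expressed by finitely many inequations.\<close>

fun gen_terms :: "nat list \<Rightarrow> gsym trm list" where
  "gen_terms [] = map (\<lambda>r. lcT r n) (exps p n)"
| "gen_terms (v # vs) = [mulT t (powT (Var v) k). t \<leftarrow> gen_terms vs, k \<leftarrow> [0..<p]]"

lemma wf_gen_terms: "t \<in> set (gen_terms vs) \<Longrightarrow> wf_trm L t \<and> vars_trm t \<subseteq> set vs"
proof (induction vs arbitrary: t)
  case (Cons v vs)
  then obtain s k where "s \<in> set (gen_terms vs)" "t = mulT s (powT (Var v) k)" by auto
  then show ?case using Cons.IH[of s] vars_powT[of "Var v" k] by auto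
qed auto

lemma gn_gen_terms:
  "e ` set vs \<subseteq> carrier G \<Longrightarrow> gn (e ` set vs) = evalt M e ` set (gen_terms vs)"
proof (induction vs)
  case Nil
  have "C = (\<lambda>r. lc M r n) ` set (exps p n)" using C_exps lc_in_C by blast
  then show ?case by (simp add: gn_empty image_image)
next
  case (Cons v vs)
  have "gn (e ` set (v # vs)) = adj (gn (e ` set vs)) (e v)" using Cons.prems gn_insert by simp
  also have "\<dots> = (\<lambda>(a, k). a \<otimes> e v [^] k) ` (gn (e ` set vs) \<times> {..<p})"
    using Cons.prems by (intro adj_mod) auto
  also have "gn (e ` set vs) = evalt M e ` set (gen_terms vs)" using Cons by simp
  also have "(\<lambda>(a, k). a \<otimes> e v [^] k) ` (evalt M e ` set (gen_terms vs) \<times> {..<p}) =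
      evalt M e ` set (gen_terms (v # vs))"
  proof -
    have *: "evalt M e (mulT t (powT (Var v) k)) = evalt M e t \<otimes> e v [^] k" for t k
      by (simp add: mult_eq flip: G_eq)
    have "set (gen_terms (v # vs)) = (\<lambda>(t, k). mulT t (powT (Var v) k)) ` (set (gen_terms vs) \<times> {..<p})"
      by (force simp: atLeast0LessThan)
    then have "evalt M e ` set (gen_terms (v # vs)) =
        (\<lambda>(t, k). evalt M e t \<otimes> e v [^] k) ` (set (gen_terms vs) \<times> {..<p})"
      using * by (simp only: image_image case_prod_unfold)
    also have "\<dots> = (\<lambda>(a, k). a \<otimes> e v [^] k) ` (evalt M e ` set (gen_terms vs) \<times> {..<p})"
      by force
    finally show ?thesis by (rule sym)
  qed
  finally show ?case .
qed

lemma image_nth_append: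
  assumes "length a = k" "j \<le> k"
  shows "(!) (a @ b) ` ({..<j} \<union> {k..<k + length b}) = set (take j a) \<union> set b"
proof -
  have "(!) (a @ b) ` {..<j} = set (take j a)"
    using nth_image[of j "a @ b"] assms by (simp add: lessThan_atLeast0)
  moreover have "(!) (a @ b) ` {k..<k + length b} = set b"
  proof -
    have "(!) (a @ b) ` {k..<k + length b} = (!) (a @ b) ` (\<lambda>i. i + k) ` {0..<length b}"
      by (simp add: add.commute)
    also have "\<dots> = (!) b ` {0..<length b}"
      unfolding image_image using assms by (intro image_cong) (simp_all add: nth_append)
    also have "\<dots> = set b" by (simp add: nth_image)
    finally show ?thesis .
  qed
  ultimately show ?thesis by (simp add: image_Un)
qed

text \<open>The set of formulas \<open>q\<close> says \<open>x\<^sub>j = t(x\<^sub>0, \<dots>, x\<^sub>j\<^sub>-\<^sub>1, b)\<close>.\<close>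

definition dependent_on :: "nat \<Rightarrow> (gsym, 'a) pfm set \<Rightarrow> nat \<Rightarrow> gsym trm \<Rightarrow> 'a list \<Rightarrow> bool" where
  "dependent_on k q j t b \<longleftrightarrow>
     (Eq (Var j) t, b) \<in> q \<and> vars_trm t \<subseteq> {..<j} \<union> {k..<k + length b}"

text \<open>Finitely many formulas of \<open>q\<close> already force freeness: for an entry
  dependent over \<open>B\<close> its equation, for any other entry the inequations with all terms
  in the earlier entries and in \<open>\<gamma>\<close>. A tuple satisfying them together with
  \<open>p0\<close> exists because \<open>q\<close> is finitely satisfiable, and
  \<open>free_not_forking\<close> applies to it.\<close>

lemma not_forks:
  assumes p: "q \<in> complete_types L M k B'" and B': "B' \<subseteq> carrier G"
    and dich: "\<And>j. j < k \<Longrightarrow>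
      (\<exists>t b. set b \<subseteq> B \<and> dependent_on k q j t b) \<or> (\<forall>t b. \<not> dependent_on k q j t b)"
  shows "\<not> forks L M k q B"
proof
  assume "forks L M k q B"
  then obtain p0 D where *: "finite p0 \<and> p0 \<subseteq> q \<and> finite D \<and> D \<subseteq> pfms L k (univ M) \<and>
      (\<forall>\<theta>\<in>D. divides L M k \<theta> B) \<and>
      (\<forall>a\<in>tuples M k. (\<forall>\<theta>\<in>p0. pholds M a \<theta>) \<longrightarrow> (\<exists>\<theta>\<in>D. pholds M a \<theta>))"
    unfolding forks_def by (elim exE) (rule that, assumption)
  then have p0: "finite p0" "p0 \<subseteq> q" and D: "finite D" "D \<subseteq> pfms L k (univ M)"
      "\<And>\<theta>. \<theta> \<in> D \<Longrightarrow> divides L M k \<theta> B" by simp_all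
  have imp: "\<exists>\<theta>\<in>D. pholds M a \<theta>" if "a \<in> tuples M k" "\<forall>\<theta>\<in>p0. pholds M a \<theta>" for a
    using * that by (elim conjE) (drule (1) bspec, simp)
  have q_pfms: "q \<subseteq> pfms L k B'" using p by (simp add: complete_types_def)
  define fst_kind where "fst_kind j \<longleftrightarrow> (\<exists>t b. set b \<subseteq> B \<and> dependent_on k q j t b)" for j
  have "\<forall>j. \<exists>tb. fst_kind j \<longrightarrow> set (snd tb) \<subseteq> B \<and> dependent_on k q j (fst tb) (snd tb)"
    unfolding fst_kind_def by auto
  then obtain tb where tb: "\<And>j. fst_kind j \<Longrightarrow>
      set (snd (tb j)) \<subseteq> B \<and> dependent_on k q j (fst (tb j)) (snd (tb j))" by metis
  define T bb where "T j = fst (tb j)" and "bb j = snd (tb j)" for j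
  have T: "set (bb j) \<subseteq> B \<and> dependent_on k q j (T j) (bb j)" if "fst_kind j" for j
    using tb[OF that] by (simp add: T_def bb_def)
  define \<beta> where "\<beta> = concat (map bb (filter fst_kind [0..<k]))"
  have bb\<beta>: "set (bb j) \<subseteq> set \<beta>" if "fst_kind j" "j < k" for j using that by (auto simp: \<beta>_def)
  have \<beta>B: "set \<beta> \<subseteq> B" using T by (auto simp: \<beta>_def)
  have "set (bb j) \<subseteq> B'" if "fst_kind j" for j
    using T[OF that] q_pfms by (auto simp: dependent_on_def pfms_def)
  then have \<beta>B': "set \<beta> \<subseteq> B'" by (auto simp: \<beta>_def)
  have "finite (set \<beta> \<union> (\<Union>\<theta>\<in>p0. set (snd \<theta>)))" using p0(1) by simp
  then obtain \<gamma> where \<gamma>: "set \<gamma> = set \<beta> \<union> (\<Union>\<theta>\<in>p0. set (snd \<theta>))" using finite_list by metis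
  have "set (snd \<theta>) \<subseteq> B'" if "\<theta> \<in> p0" for \<theta>
    using subsetD[OF q_pfms subsetD[OF p0(2) that]] by (cases \<theta>) (simp add: pfms_def)
  then have \<gamma>B': "set \<gamma> \<subseteq> B'" using \<gamma> \<beta>B' by auto
  define q1 where "q1 = (\<lambda>j. (Eq (Var j) (T j), bb j)) ` {j. j < k \<and> fst_kind j}"
  define q2 where "q2 = (\<Union>j\<in>{j. j < k \<and> \<not> fst_kind j}.
      (\<lambda>t. (Neg (Eq (Var j) t), \<gamma>)) ` set (gen_terms ([0..<j] @ [k..<k + length \<gamma>])))"
  have "q1 \<subseteq> q" using T by (auto simp: q1_def dependent_on_def)
  moreover have "q2 \<subseteq> q"
  proof
    fix \<theta> assume "\<theta> \<in> q2"
    then obtain j t where j: "j < k" "\<not> fst_kind j" "\<theta> = (Neg (Eq (Var j) t), \<gamma>)"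
      and t: "t \<in> set (gen_terms ([0..<j] @ [k..<k + length \<gamma>]))" by (auto simp: q2_def)
    have v: "wf_trm L t" "vars_trm t \<subseteq> {..<j} \<union> {k..<k + length \<gamma>}"
      using wf_gen_terms[OF t] by auto
    \<comment> \<open>An entry without an equation over \<open>B\<close> has none at all, by
      \<open>dich\<close>; completeness of \<open>q\<close> then supplies the inequation.\<close>
    have "(Eq (Var j) t, \<gamma>) \<notin> q"
      using dich[OF j(1)] j(2) v(2) by (auto simp: fst_kind_def dependent_on_def)
    moreover have "(Eq (Var j) t, \<gamma>) \<in> pfms L k B'"
      using v j(1) \<gamma>B' by (force simp: pfms_def fms_def)
    moreover have "\<forall>(\<phi>, b)\<in>pfms L k B'. (\<phi>, b) \<in> q \<or> (Neg \<phi>, b) \<in> q"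
      using p by (simp add: complete_types_def)
    ultimately show "\<theta> \<in> q" using j(3) by blast
  qed
  ultimately have "p0 \<union> q1 \<union> q2 \<subseteq> q" using p0(2) by blast
  moreover have "finite (p0 \<union> q1 \<union> q2)" using p0(1) by (simp add: q1_def q2_def)
  moreover have "\<exists>a\<in>tuples M k. \<forall>\<theta>\<in>r. pholds M a \<theta>" if "finite r" "r \<subseteq> q" for r
    using p that by (simp add: complete_types_def)
  ultimately have "\<exists>a\<in>tuples M k. \<forall>\<theta>\<in>p0 \<union> q1 \<union> q2. pholds M a \<theta>" by (simp only:)
  then obtain a where a: "a \<in> tuples M k" "\<And>\<theta>. \<theta> \<in> p0 \<union> q1 \<union> q2 \<Longrightarrow> pholds M a \<theta>"
    by (elim bexE) (rule that, assumption, rule bspec)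
  have ak: "length a = k" "set a \<subseteq> carrier G" using a(1) by (auto simp: tuples_def carrier_eq)
  have "free a (set \<beta>) (set \<gamma>)"
  proof (rule freeI)
    fix j assume "j < length a"
    then have j: "j < k" using ak by simp
    show "a ! j \<in> gn (set \<beta> \<union> set (take j a)) \<or> a ! j \<notin> gn (set \<gamma> \<union> set \<beta> \<union> set (take j a))"
    proof (cases "fst_kind j")
      case True
      have "pholds M a (Eq (Var j) (T j), bb j)" using a(2) j True by (auto simp: q1_def)
      then have e: "a ! j = evalt M ((!) (a @ bb j)) (T j)"
        using j ak by (simp add: pholds_def holds_def nth_append)
      have t: "wf_trm L (T j)" "vars_trm (T j) \<subseteq> {..<j} \<union> {k..<k + length (bb j)}"
        using T[OF True] q_pfms by (auto simp: dependent_on_def pfms_def fms_def)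
      have "(!) (a @ bb j) ` vars_trm (T j) \<subseteq> set (take j a) \<union> set (bb j)"
        using image_nth_append[OF ak(1), of j "bb j"] t(2) j by (metis image_mono less_imp_le)
      then have "(!) (a @ bb j) ` vars_trm (T j) \<subseteq> set \<beta> \<union> set (take j a)" using bb\<beta>[OF True j] by blast
      then show ?thesis unfolding e using evalt_in_gen[OF t(1)] by blast
    next
      case False
      have "a ! j \<notin> gn (set (take j a) \<union> set \<gamma>)"
      proof
        let ?vs = "[0..<j] @ [k..<k + length \<gamma>]"
        assume "a ! j \<in> gn (set (take j a) \<union> set \<gamma>)"
        moreover have vs: "(!) (a @ \<gamma>) ` set ?vs = set (take j a) \<union> set \<gamma>"
          using image_nth_append[OF ak(1), of j \<gamma>] j by (simp add: lessThan_atLeast0)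
        moreover have "set (take j a) \<union> set \<gamma> \<subseteq> carrier G"
          using ak \<gamma>B' B' set_take_subset[of j a] by blast
        ultimately obtain t where t: "t \<in> set (gen_terms ?vs)" "a ! j = evalt M ((!) (a @ \<gamma>)) t"
          using gn_gen_terms[of "(!) (a @ \<gamma>)" ?vs] by auto
        then have "(Neg (Eq (Var j) t), \<gamma>) \<in> q2" using j False unfolding q2_def by blast
        then have "pholds M a (Neg (Eq (Var j) t), \<gamma>)" using a(2) by blast
        then show False using t(2) j ak by (simp add: pholds_def holds_def nth_append)
      qed
      moreover have "set \<gamma> \<union> set \<beta> \<union> set (take j a) = set (take j a) \<union> set \<gamma>" using \<gamma> by blast
      ultimately show ?thesis by simp
    qed
  qed
  moreover have "\<theta> \<in> pfms L (length a) (set \<gamma>) \<and> pholds M a \<theta>" if "\<theta> \<in> p0" for \<theta>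
    using that a(2)[of \<theta>] p0(2) q_pfms \<gamma> ak by (cases \<theta>) (fastforce simp: pfms_def)
  ultimately obtain a' where "a' \<in> tuples M k" "\<forall>\<theta>\<in>p0. pholds M a' \<theta>" "\<forall>\<theta>\<in>D. \<not> pholds M a' \<theta>"
    using free_not_forking[of a \<gamma> \<beta> B p0 D] ak \<beta>B D subset_trans[OF \<gamma>B' B'] subset_trans[OF \<beta>B' B']
    by auto
  then show False using imp by blast
qed

section \<open>Independence implies non-forking\<close>

lemma tp_complete:
  "a \<in> tuples M k \<Longrightarrow> tp L M P a \<in> complete_types L M k P"
  by (auto simp: complete_types_def tp_def tuples_def pholds_def holds_def pfms_def fms_def)

lemma dependent_on_tp_iff:
  assumes a: "set a \<subseteq> carrier G" "length a = k" and P: "P \<subseteq> carrier G" and j: "j < k" and BP: "B \<subseteq> P"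
  shows "(\<exists>t b. set b \<subseteq> B \<and> dependent_on k (tp L M P a) j t b) \<longleftrightarrow> a ! j \<in> gn (B \<union> set (take j a))"
proof
  assume "\<exists>t b. set b \<subseteq> B \<and> dependent_on k (tp L M P a) j t b"
  then obtain t b where b: "set b \<subseteq> B" "(Eq (Var j) t, b) \<in> tp L M P a"
    and v: "vars_trm t \<subseteq> {..<j} \<union> {k..<k + length b}" by (auto simp: dependent_on_def)
  have t: "wf_trm L t" "a ! j = evalt M ((!) (a @ b)) t"
    using b(2) a j by (auto simp: tp_def pfms_def fms_def pholds_def holds_def nth_append)
  have "(!) (a @ b) ` vars_trm t \<subseteq> set (take j a) \<union> set b"
    using image_nth_append[OF a(2), of j b] v j by (metis image_mono less_imp_le)
  then have "(!) (a @ b) ` vars_trm t \<subseteq> B \<union> set (take j a)" using b(1) by blast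
  then show "a ! j \<in> gn (B \<union> set (take j a))" unfolding t(2) using t(1) by (rule evalt_in_gen[rotated])
next
  assume "a ! j \<in> gn (B \<union> set (take j a))"
  then obtain F where F: "finite F" "F \<subseteq> B \<union> set (take j a)" "a ! j \<in> gn F"
    by (rule gen_finite_support)
  obtain b where b: "set b = F \<inter> B" using F(1) finite_list[of "F \<inter> B"] by auto
  have "gn F \<subseteq> gn (set (take j a) \<union> set b)" using F(2) b by (intro gen_mono) auto
  then have "a ! j \<in> gn ((!) (a @ b) ` ({..<j} \<union> {k..<k + length b}))"
    using F(3) image_nth_append[OF a(2), of j b] j by auto
  then obtain t where t: "wf_trm L t" "vars_trm t \<subseteq> {..<j} \<union> {k..<k + length b}"
      "a ! j = evalt M ((!) (a @ b)) t"
    by (rule gen_term)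
  have "(Eq (Var j) t, b) \<in> tp L M P a"
    using t b a j BP by (force simp: tp_def pfms_def fms_def pholds_def holds_def nth_append)
  then show "\<exists>t b. set b \<subseteq> B \<and> dependent_on k (tp L M P a) j t b"
    using t(2) b by (auto simp: dependent_on_def)
qed

text \<open>A modular law: an entry generated by \<open>B \<union> D\<close> and the earlier entries
  is a product \<open>g \<otimes> h\<close> with \<open>g\<close> in
  \<open>gn (B \<union> D)\<close> and \<open>h\<close> in
  \<open>gn (B \<union> set (take j a))\<close>. Then \<open>g\<close> lies in
  \<open>gn (A \<union> B)\<close> too, so independence puts it into \<open>gn B\<close>, and the
  entry depends on \<open>B\<close> and the earlier entries alone.\<close>

lemma not_forks_of_indep0:
  assumes ind: "indep0 L M A B D" and ABC: "A \<subseteq> carrier G" "B \<subseteq> carrier G" "D \<subseteq> carrier G"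
    and a: "set a \<subseteq> A"
  shows "\<not> forks L M (length a) (tp L M (B \<union> D) a) B"
proof (rule not_forks[OF tp_complete])
  have ac: "set a \<subseteq> carrier G" using a ABC by blast
  then show "a \<in> tuples M (length a)" by (simp add: tuples_def carrier_eq)
  show BD: "B \<union> D \<subseteq> carrier G" using ABC by blast
  fix j assume j: "j < length a"
  have "a ! j \<in> gn (B \<union> set (take j a))" if "a ! j \<in> gn (B \<union> D \<union> set (take j a))"
  proof -
    have tk: "set (take j a) \<subseteq> A" using a set_take_subset[of j a] by blast
    have c: "B \<union> set (take j a) \<subseteq> carrier G" using tk ABC by blast
    have "gn (B \<union> D \<union> set (take j a)) \<subseteq> gn ((B \<union> D) \<union> (B \<union> set (take j a)))" by (rule gen_mono) auto
    also have "\<dots> = gn (B \<union> D) <#> gn (B \<union> set (take j a))" by (rule gn_Un[OF BD c])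
    finally have "a ! j \<in> gn (B \<union> D) <#> gn (B \<union> set (take j a))"
      using \<open>a ! j \<in> gn (B \<union> D \<union> set (take j a))\<close> by blast
    then obtain g h where gh: "g \<in> gn (B \<union> D)" "h \<in> gn (B \<union> set (take j a))" "a ! j = g \<otimes> h"
      unfolding set_mult_def by blast
    have sAB: "sub (gn (A \<union> B))" using ABC by (intro sub_gn) auto
    have "gn (B \<union> set (take j a)) \<subseteq> gn (A \<union> B)" using tk by (intro gen_mono) auto
    then have h: "h \<in> gn (A \<union> B)" using gh(2) by blast
    have gc: "g \<in> carrier G" using gh(1) sub_carrier[OF sub_gn[OF BD]] by blast
    have "a ! j \<in> gn (A \<union> B)" using a j by (intro gen.base) (auto dest: nth_mem)
    then have "a ! j \<otimes> inv h \<in> gn (A \<union> B)" using h by (intro sub_mult[OF sAB] sub_inv[OF sAB])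
    moreover have "a ! j \<otimes> inv h = g"
      using gh(3) gc sub_carrier[OF sAB h] by (simp add: m_assoc)
    ultimately have "g \<in> gn B" using ind gh(1) by (auto simp: indep0_def)
    then have "g \<in> gn (B \<union> set (take j a))" using gen_mono[of B "B \<union> set (take j a)" L M] by blast
    then show ?thesis unfolding gh(3) using gh(2) by (intro sub_mult[OF sub_gn[OF c]])
  qed
  then show "(\<exists>t b. set b \<subseteq> B \<and> dependent_on (length a) (tp L M (B \<union> D) a) j t b) \<or>
      (\<forall>t b. \<not> dependent_on (length a) (tp L M (B \<union> D) a) j t b)"
  proof (cases "a ! j \<in> gn (B \<union> set (take j a))")
    case True
    then show ?thesis using dependent_on_tp_iff[OF ac refl BD j, of B] by blast
  next
    case False
    then have "a ! j \<notin> gn (B \<union> D \<union> set (take j a))" using \<open>_ \<Longrightarrow> _\<close> by blast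
    then have "\<not> (\<exists>t b. set b \<subseteq> B \<union> D \<and> dependent_on (length a) (tp L M (B \<union> D) a) j t b)"
      using dependent_on_tp_iff[OF ac refl BD j, of "B \<union> D"] by blast
    moreover have "set b \<subseteq> B \<union> D" if "dependent_on (length a) (tp L M (B \<union> D) a) j t b" for t b
      using that by (auto simp: dependent_on_def tp_def pfms_def)
    ultimately show ?thesis by blast
  qed
qed

text \<open>The conditions \<open>comm x y = comm d y\<close> for \<open>y\<close> in
  \<open>B\<close> can be met outside \<open>gn (B \<union> I)\<close> for every finite
  \<open>I\<close>, so they have infinitely many solutions outside \<open>gn B\<close>. By
  \<open>piso_adj\<close> each of these looks like \<open>d\<close> over every finite tuple from
  \<open>B\<close>.\<close>

lemma many_conjugates:
  assumes B: "small \<kappa> M B" and d: "d \<in> carrier G" "d \<notin> gn B"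
  obtains ds :: "nat \<Rightarrow> 'a" where "inj ds" "\<And>i. ds i \<in> carrier G"
    "\<And>i b. set b \<subseteq> B \<Longrightarrow> eqv (b @ [d]) (b @ [ds i])"
proof -
  note Bc = small_subset[OF B]
  define J where "J = {x \<in> carrier G. x \<notin> gn B \<and> (\<forall>y\<in>B. comm x y = comm d y)}"
  have "\<exists>i\<in>J - I. True" if I: "finite I" "I \<subseteq> J" for I
  proof -
    let ?R = "(\<lambda>y. (y, comm d y)) ` B"
    have Ic: "I \<subseteq> carrier G" using I(2) by (auto simp: J_def)
    have fR: "fst ` ?R = B" by force
    have sR: "small \<kappa> M (snd ` ?R)"
    proof (rule small_countable[OF countable_finite])
      have "snd ` ?R \<subseteq> C" using Bc d(1) by auto
      then show "finite (snd ` ?R)" "snd ` ?R \<subseteq> carrier G"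
        using finite_C C_carrier finite_subset by blast+
    qed
    have sI: "small \<kappa> M (B \<union> I)"
      by (rule small_Un[OF B small_countable[OF countable_finite[OF I(1)] Ic]])
    have sm: "small \<kappa> M (fst ` ?R \<union> snd ` ?R \<union> (B \<union> I))"
      unfolding fR by (rule small_Un[OF small_Un[OF B sR] sI])
    obtain x where x: "x \<in> carrier G" "x \<notin> gn (B \<union> I)" "\<And>y z. (y, z) \<in> ?R \<Longrightarrow> comm x y = z"
    proof (rule realize_comm[OF sm])
      fix R0 N0 assume R0: "finite R0" "R0 \<subseteq> ?R" and N0: "finite N0" "N0 \<subseteq> B \<union> I"
      have Y: "finite (fst ` R0)" "fst ` R0 \<subseteq> carrier G" using R0 Bc by auto
      have N0c: "N0 \<subseteq> carrier G" using N0 Bc Ic by blast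
      obtain x where x: "x \<in> carrier G" "x \<notin> gn (fst ` R0 \<union> N0)"
          "\<And>y. y \<in> gn (fst ` R0) \<Longrightarrow> comm x y = comm d y"
        using ext_point[OF Y chr_comm[OF d(1) sub_gn[OF Y(2)]] N0(1) N0c] by blast
      have "x \<notin> gn N0" using x(2) gen_mono[of N0 "fst ` R0 \<union> N0" L M] by blast
      moreover have "comm x y = z" if "(y, z) \<in> R0" for y z
      proof -
        have "y \<in> fst ` R0" using that by force
        then have "comm x y = comm d y" using x(3)[OF gen.base] by blast
        then show ?thesis using that R0(2) by auto
      qed
      ultimately show "\<exists>x\<in>carrier G. x \<notin> gn N0 \<and> (\<forall>(y, z)\<in>R0. comm x y = z)" using x(1) by blast
    qed (rule that, assumption+)
    have "x \<notin> gn B" "x \<notin> I"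
      using x(2) gen_mono[of B "B \<union> I" L M] gen_incl[of "B \<union> I" L M] by auto
    then have "x \<in> J - I" using x(1,3) by (auto simp: J_def)
    then show ?thesis by blast
  qed
  then obtain ds :: "nat \<Rightarrow> 'a" where ds: "inj ds" "range ds \<subseteq> J"
    using greedy_sequence[of J "\<lambda>_ _. True"] by metis
  have "eqv (b @ [d]) (b @ [ds i])" if b: "set b \<subseteq> B" for i b
  proof -
    have x: "ds i \<in> carrier G" "ds i \<notin> gn B" "\<And>y. y \<in> B \<Longrightarrow> comm (ds i) y = comm d y"
      using ds(2) by (auto simp: J_def)
    have bc: "set b \<subseteq> carrier G" using b Bc by blast
    have gb: "gn (set b) \<subseteq> gn B" by (rule gen_mono[OF b])
    \<comment> \<open>The elements on which the two commutator maps agree form a substructure, so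
      agreement on \<open>b\<close> extends to all that \<open>b\<close> generates.\<close>
    have "sub {y \<in> carrier G. comm (ds i) y = comm d y}"
      by (rule subI) (use x(1) d(1) C_carrier in \<open>auto simp: comm_C_right comm_mult_right\<close>)
    then have "gn (set b) \<subseteq> {y \<in> carrier G. comm (ds i) y = comm d y}"
      by (rule gen_sub_least) (use b bc x(3) in auto)
    then have cm: "comm (ds i) (id y) = comm d y" if "y \<in> gn (set b)" for y using that by auto
    obtain k where k: "piso (adj (gn (set b)) d) (adj (gn (set b)) (ds i)) k"
        "\<And>y. y \<in> gn (set b) \<Longrightarrow> k y = id y" "k d = ds i"
      using piso_adj[OF piso_id[OF sub_gn[OF bc]] d(1) _ x(1) _ cm] d(2) x(2) gb by blast
    show ?thesis
    proof (rule eqvI[OF finite_adj[OF finite_gn[OF _ bc] d(1)] k(1)])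
      show "set (b @ [d]) \<subseteq> adj (gn (set b)) d"
        using gen_incl[of "set b" L M] adj_incl[OF sub_gn[OF bc], of d] adj_self[OF sub_gn[OF bc] d(1)] by auto
      have "map k b = b" using k(2) gen_incl[of "set b" L M] by (intro map_idI) auto
      then show "b @ [ds i] = map k (b @ [d])" using k(3) by simp
    qed simp
  qed
  moreover have "ds i \<in> carrier G" for i using ds(2) by (auto simp: J_def)
  ultimately show thesis using that ds(1) by blast
qed

text \<open>The element \<open>d\<close> is a term \<open>t\<close> in \<open>a\<close> and
  \<open>b\<close>. The formula \<open>t(x, b) = d\<close> divides over \<open>B\<close> because the
  conjugates of \<open>d\<close> are pairwise distinct, which makes any two instances
  contradictory.\<close>

lemma forks_if_dependent:
  assumes B: "small \<kappa> M B" and b: "set b \<subseteq> B" and a: "set a \<subseteq> carrier G" and D: "D \<subseteq> carrier G"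
    and d: "d \<in> gn (set a \<union> set b)" "d \<in> gn (B \<union> D)" "d \<notin> gn B"
  shows "forks L M (length a) (tp L M (B \<union> D) a) B"
proof -
  note Bc = small_subset[OF B]
  define k where "k = length a"
  define l where "l = length b"
  have dc: "d \<in> carrier G" using d(2) gn_carrier[of "B \<union> D"] Bc D by blast
  have "set a \<union> set b = set (a @ b)" by simp
  then obtain t where t: "wf_trm L t" "vars_trm t \<subseteq> {..<k + l}" "d = evalt M ((!) (a @ b)) t"
    using gn_list_term[of d "a @ b"] d(1) by (auto simp: k_def l_def)
  obtain F where F: "finite F" "F \<subseteq> B \<union> D" "d \<in> gn F" using gen_finite_support[OF d(2)] .
  obtain c where c: "set c = F" using F(1) finite_list by blast
  have sh: "set c = (!) (x @ c) ` {length x..<length x + length c}" for x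
    using image_nth_append[of x "length x" 0 c] by simp
  obtain s where s: "wf_trm L s" "vars_trm s \<subseteq> {k + l..<k + l + length c}" "d = evalt M ((!) ((a @ b) @ c)) s"
    using gen_term[of d L M "(!) ((a @ b) @ c)"] F(3) sh[of "a @ b"] c by (auto simp: k_def l_def)
  have ev_t: "evalt M ((!) ((a' @ b') @ c')) t = evalt M ((!) (a' @ b')) t"
    if "length a' = k" "length b' = l" for a' b' c'
    using t(2) that by (intro evalt_cong) (auto simp: nth_append subset_iff)
  \<comment> \<open>The term \<open>s\<close> mentions only positions of \<open>c\<close>, so its
    value is \<open>d\<close> whichever tuple of length \<open>k\<close> replaces
    \<open>a\<close>.\<close>
  have ev_s: "evalt M ((!) ((a' @ b) @ c)) s = d" if "length a' = k" for a'
    unfolding s(3) using s(2) that k_def l_def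
    by (intro evalt_cong) (auto simp: nth_append subset_iff)
  \<comment> \<open>Since \<open>d\<close> may lie outside \<open>B \<union> D\<close>, the type
    contains the equation with \<open>d\<close> written as the term \<open>s\<close> in parameters
    \<open>c\<close> from \<open>B \<union> D\<close>. This formula implies the dividing formula
    given by \<open>\<psi>\<close>.\<close>
  define \<theta>0 where "\<theta>0 = (Eq t s, b @ c)"
  define \<psi> where "\<psi> = Eq t (Var (k + l))"
  have "\<theta>0 \<in> tp L M (B \<union> D) a"
  proof -
    have "set (b @ c) \<subseteq> B \<union> D" using b c F by auto
    moreover have "Eq t s \<in> fms L (k + length (b @ c))"
      using t s by (auto simp: fms_def l_def subset_iff)
    moreover have "pholds M a \<theta>0"
      using ev_t[of a b c] ev_s[of a] t(3) by (simp add: pholds_def holds_def \<theta>0_def k_def l_def)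
    ultimately show ?thesis by (simp add: tp_def pfms_def \<theta>0_def k_def)
  qed
  moreover have "(\<psi>, b @ [d]) \<in> pfms L k (univ M)"
    using t b Bc dc by (auto simp: pfms_def fms_def \<psi>_def l_def carrier_eq subset_iff)
  moreover have "divides L M k (\<psi>, b @ [d]) B"
  proof -
    obtain ds :: "nat \<Rightarrow> 'a" where ds: "inj ds" "\<And>i. ds i \<in> carrier G"
        "\<And>i b. set b \<subseteq> B \<Longrightarrow> eqv (b @ [d]) (b @ [ds i])"
      using many_conjugates[OF B dc d(3)] by blast
    have "b @ [ds i] \<in> tuples M (length (b @ [d]))" for i
      using ds(2) b Bc by (auto simp: tuples_def carrier_eq)
    moreover have "tp L M B (b @ [ds i]) = tp L M B (b @ [d])" for i
    proof -
      have "pholds M (b @ [ds i]) (\<phi>, u) \<longleftrightarrow> pholds M (b @ [d]) (\<phi>, u)"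
        if u: "(\<phi>, u) \<in> pfms L (Suc l) B" for \<phi> u
      proof -
        have uB: "set u \<subseteq> B" "\<phi> \<in> fms L (Suc l + length u)" using u by (auto simp: pfms_def)
        have e: "eqv ((b @ u) @ [d]) ((b @ u) @ [ds i])" using ds(3)[of "b @ u"] uB b by simp
        obtain h where h: "piso (gn (set ((b @ u) @ [d]))) (gn (set ((b @ u) @ [ds i]))) h"
            "(b @ u) @ [ds i] = map h ((b @ u) @ [d])" "finite (gn (set ((b @ u) @ [d])))"
          using eqvE[OF e] by metis
        have "(b @ [ds i]) @ u = map h ((b @ [d]) @ u)" using h(2) by (simp add: append_eq_append_conv)
        moreover have "holds M \<phi> ((b @ [d]) @ u) \<longleftrightarrow> holds M \<phi> (map h ((b @ [d]) @ u))"
          by (rule piso_holds[OF h(3,1)])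
            (use gen_incl[of "set ((b @ u) @ [d])" L M] uB(2) in \<open>auto simp: l_def\<close>)
        ultimately show ?thesis by (simp add: pholds_def)
      qed
      then show ?thesis by (auto simp: tp_def l_def)
    qed
    moreover have "\<not> (\<exists>a'\<in>tuples M k. \<forall>i\<in>I. pholds M a' (\<psi>, b @ [ds i]))"
      if I: "finite I" "card I = 2" for I
    proof
      assume "\<exists>a'\<in>tuples M k. \<forall>i\<in>I. pholds M a' (\<psi>, b @ [ds i])"
      then obtain a' where a': "length a' = k" "\<And>i. i \<in> I \<Longrightarrow> pholds M a' (\<psi>, b @ [ds i])"
        by (auto simp: tuples_def)
      have "ds i = evalt M ((!) (a' @ b)) t" if "i \<in> I" for i
      proof -
        have "evalt M ((!) ((a' @ b) @ [ds i])) t = ((a' @ b) @ [ds i]) ! (k + l)"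
          using a'(2)[OF that] by (simp add: pholds_def holds_def \<psi>_def)
        moreover have "((a' @ b) @ [ds i]) ! (k + l) = ds i" using a'(1) l_def by (metis length_append nth_append_length)
        ultimately show ?thesis using ev_t[of a' b "[ds i]"] a'(1) l_def by simp
      qed
      moreover obtain i j where "i \<in> I" "j \<in> I" "i \<noteq> j" using I(2) by (auto simp: card_2_iff)
      ultimately show False using ds(1) by (metis injD)
    qed
    ultimately show ?thesis
      unfolding divides_def by (intro exI[of _ "\<lambda>i. b @ [ds i]"] exI[of _ 2]) auto
  qed
  moreover have "pholds M a' (\<psi>, b @ [d])" if "a' \<in> tuples M k" "pholds M a' \<theta>0" for a'
  proof -
    have l': "length a' = k" using that(1) by (simp add: tuples_def)
    have "evalt M ((!) ((a' @ b) @ c)) t = evalt M ((!) ((a' @ b) @ c)) s"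
      using that(2) by (simp add: pholds_def holds_def \<theta>0_def)
    then have "evalt M ((!) (a' @ b)) t = d" using ev_t[of a' b c] ev_s[of a'] l' l_def by simp
    moreover have "((a' @ b) @ [d]) ! (k + l) = d" using l' l_def by (metis length_append nth_append_length)
    ultimately show ?thesis
      using ev_t[of a' b "[d]"] l' l_def by (simp add: pholds_def holds_def \<psi>_def)
  qed
  ultimately show ?thesis
    unfolding forks_def k_def
    by (intro exI[of _ "{\<theta>0}"] exI[of _ "{(\<psi>, b @ [d])}"]) auto
qed

section \<open>The characterization of non-forking\<close>

theorem indep0_iff_not_forks:
  assumes A: "small \<kappa> M A" and B: "small \<kappa> M B" and D: "small \<kappa> M D"
  shows "indep0 L M A B D \<longleftrightarrow>
    (\<forall>a. set a \<subseteq> A \<longrightarrow> \<not> forks L M (length a) (tp L M (B \<union> D) a) B)"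
proof
  note c = small_subset[OF A] small_subset[OF B] small_subset[OF D]
  assume "indep0 L M A B D"
  then show "\<forall>a. set a \<subseteq> A \<longrightarrow> \<not> forks L M (length a) (tp L M (B \<union> D) a) B"
    using not_forks_of_indep0 c by blast
next
  note c = small_subset[OF A] small_subset[OF B] small_subset[OF D]
  assume nf: "\<forall>a. set a \<subseteq> A \<longrightarrow> \<not> forks L M (length a) (tp L M (B \<union> D) a) B"
  show "indep0 L M A B D"
  proof (rule ccontr)
    assume "\<not> indep0 L M A B D"
    moreover have "gn B \<subseteq> gn (A \<union> B)" "gn B \<subseteq> gn (B \<union> D)" by (rule gen_mono, simp)+
    ultimately obtain d where d: "d \<in> gn (A \<union> B)" "d \<in> gn (B \<union> D)" "d \<notin> gn B"
      unfolding indep0_def by blast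
    obtain F where F: "finite F" "F \<subseteq> A \<union> B" "d \<in> gn F" using gen_finite_support[OF d(1)] .
    obtain a where a: "set a = F \<inter> A" using F(1) finite_list[of "F \<inter> A"] by auto
    obtain b where b: "set b = F \<inter> B" using F(1) finite_list[of "F \<inter> B"] by auto
    have "gn F \<subseteq> gn (set a \<union> set b)" using F(2) a b by (intro gen_mono) auto
    then have "forks L M (length a) (tp L M (B \<union> D) a) B"
      using forks_if_dependent[OF B _ _ c(3) _ d(2,3), of b a] a b F(3) c(1) by auto
    then show False using nf a by blast
  qed
qed

section \<open>Supersimplicity and SU-rank\<close>

theorem supersimple_M: "supersimple L \<kappa> M"
  unfolding supersimple_def
proof (intro allI impI, elim conjE)
  fix k B q assume B: "small \<kappa> M B" and q: "q \<in> complete_types L M k B"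
  define kind where "kind j \<longleftrightarrow> (\<exists>t b. dependent_on k q j t b)" for j
  have "\<forall>j. \<exists>tb. kind j \<longrightarrow> dependent_on k q j (fst tb) (snd tb)" unfolding kind_def by auto
  then obtain tb where tb: "\<And>j. kind j \<Longrightarrow> dependent_on k q j (fst (tb j)) (snd (tb j))" by metis
  define T bb where "T j = fst (tb j)" and "bb j = snd (tb j)" for j
  have T: "dependent_on k q j (T j) (bb j)" if "kind j" for j using tb[OF that] by (simp add: T_def bb_def)
  \<comment> \<open>One equation is selected for each dependent entry; the finitely many parameters
    involved make all these entries dependent over \<open>B0\<close>.\<close>
  define B0 where "B0 = (\<Union>j\<in>{j. j < k \<and> kind j}. set (bb j))"
  have "set (bb j) \<subseteq> B" if "kind j" for j
    using T[OF that] q by (auto simp: dependent_on_def complete_types_def pfms_def)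
  then have "B0 \<subseteq> B" by (auto simp: B0_def)
  moreover have "\<not> forks L M k q B0"
  proof (rule not_forks[OF q small_subset[OF B]])
    fix j assume "j < k"
    then have "set (bb j) \<subseteq> B0" if "kind j" using that by (auto simp: B0_def)
    then show "(\<exists>t b. set b \<subseteq> B0 \<and> dependent_on k q j t b) \<or> (\<forall>t b. \<not> dependent_on k q j t b)"
      using T[of j] unfolding kind_def by blast
  qed
  moreover have "finite B0" by (simp add: B0_def)
  ultimately show "\<exists>B0. finite B0 \<and> B0 \<subseteq> B \<and> \<not> forks L M k q B0" by blast
qed

text \<open>In one variable, \<open>not_forks\<close> shows that a forking extension contains an
  equation of the unknown with a term over its own domain. Every further extension inherits this
  equation and therefore does not fork over that domain.\<close>

lemma not_SU_ge_2: "\<not> SU_ge L \<kappa> M 1 (Suc (Suc i)) B q"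
proof
  assume "SU_ge L \<kappa> M 1 (Suc (Suc i)) B q"
  then obtain D r D' r' where r: "small \<kappa> M D" "r \<in> complete_types L M 1 D" "forks L M 1 r B"
    and r': "small \<kappa> M D'" "r' \<in> complete_types L M 1 D'" "r \<subseteq> r'" "forks L M 1 r' D"
    by auto
  obtain j t b where j: "j < 1" "dependent_on 1 r j t b"
    using not_forks[OF r(2) small_subset[OF r(1)], of B] r(3) by blast
  have "set b \<subseteq> D" using j(2) r(2) by (auto simp: dependent_on_def complete_types_def pfms_def)
  moreover have "dependent_on 1 r' j t b" using j(2) r'(3) by (auto simp: dependent_on_def)
  ultimately have "\<not> forks L M 1 r' D"
    using not_forks[OF r'(2) small_subset[OF r'(1)], of D] j(1) by (metis less_one)
  then show False using r'(4) by blast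
qed

theorem SU_rank_M: "SU_rank L \<kappa> M = 1"
proof (rule antisym)
  have "SU L \<kappa> M 1 B q \<le> 1" for B q
  proof -
    have "j \<le> 1" if "SU_ge L \<kappa> M 1 j B q" for j
    proof (rule ccontr)
      assume "\<not> j \<le> 1"
      then obtain i where "j = Suc (Suc i)" by (metis Suc_leI not_less One_nat_def less_imp_Suc_add add_Suc)
      then show False using that not_SU_ge_2 by blast
    qed
    then show ?thesis unfolding SU_def by (intro Sup_least) (auto simp: one_enat_def)
  qed
  then show "SU_rank L \<kappa> M \<le> 1" unfolding SU_rank_def by (intro Sup_least) auto
  \<comment> \<open>Any element outside \<open>gn {}\<close>, that is, outside \<open>C\<close>,
    witnesses rank at least 1: its type over itself forks over the empty set.\<close>
  obtain x where x: "x \<in> carrier G" "x \<notin> gn ({} \<union> {})"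
    using ext_point[of "{}" "\<lambda>_. \<one>" "{}"] by (auto simp: chr_def)
  let ?p = "tp L M {} [x]" and ?q = "tp L M {x} [x]"
  have tup: "[x] \<in> tuples M 1" using x by (simp add: tuples_def carrier_eq)
  have sm: "small \<kappa> M {}" "small \<kappa> M {x}" using x(1) by (auto intro: small_countable)
  have "forks L M (length [x]) (tp L M ({} \<union> {x}) [x]) {}"
    by (rule forks_if_dependent[OF sm(1), of "[]" _ _ x]) (use x in \<open>auto intro: gen.base\<close>)
  moreover have "?p \<subseteq> ?q" by (auto simp: tp_def pfms_def)
  ultimately have "SU_ge L \<kappa> M 1 (Suc 0) {} ?p"
    using sm tp_complete[OF tup] by auto
  then have "enat (Suc 0) \<le> SU L \<kappa> M 1 {} ?p" unfolding SU_def by (intro Sup_upper) blast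
  also have "\<dots> \<le> SU_rank L \<kappa> M"
    unfolding SU_rank_def using sm(1) tp_complete[OF tup, of "{}"] by (intro Sup_upper) blast
  finally show "1 \<le> SU_rank L \<kappa> M" by (simp add: one_enat_def)
qed

subsection \<open>Instability\<close>

text \<open>If the square were trivial, the odd exponent \<open>p\<close> would make the constant
  itself trivial, against linear independence.\<close>

lemma cst_square_ne_one:
  assumes "n \<ge> 1"
  shows "cst M 1 \<otimes> cst M 1 \<noteq> \<one>"
proof
  assume sq: "cst M 1 \<otimes> cst M 1 = \<one>"
  have i1: "1 \<in> {1..n}" using assms by simp
  note c = C_carrier[OF cst_C[OF i1]]
  have "odd p" using prime_odd_nat[OF prime_p] p_gt_2 by simp
  then obtain m where m: "p = Suc (2 * m)" by (metis oddE Suc_eq_plus1)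
  have "cst M 1 [^] (2::nat) = \<one>" using sq c by (simp add: numeral_2_eq_2)
  then have "(cst M 1 [^] (2::nat)) [^] m = \<one>" by simp
  then have "cst M 1 [^] (2 * m) = \<one>" using c by (simp add: nat_pow_pow)
  then have "cst M 1 = \<one>" using pow_p[OF c] c unfolding m by simp
  then have "lc M (\<lambda>i. if i = 1 then 1 else 0) n = \<one>" using lc_eq_cst[OF i1] by simp
  moreover have "\<forall>r. (\<forall>i\<in>{1..n}. r i < p) \<and> lc M r n = \<one> \<longrightarrow> (\<forall>i\<in>{1..n}. r i = 0)"
    using in_G in_G_iff[OF p_pos, of n M] unfolding sem_axioms_def one_eq by (elim iffE) blast
  ultimately have "\<forall>i\<in>{1..n}. (if i = 1 then 1 else 0 :: nat) = 0"
    using p_gt_2 by (elim allE[of _ "\<lambda>i. if i = 1 then 1 else 0"]) simp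
  from bspec[OF this i1] show False by simp
qed

text \<open>The commutator of \<open>e i\<close> and \<open>e j\<close> is \<open>c\<close> for
  \<open>i < j\<close>, inverse to \<open>c\<close> for \<open>j < i\<close>, and trivial for
  \<open>i = j\<close>. As \<open>c \<otimes> c\<close> is not trivial, the last two values differ
  from \<open>c\<close>, so a single equation defines the order.\<close>

theorem not_stable_M:
  assumes n: "n \<ge> 1"
  shows "\<not> stable L M"
proof -
  define c where "c = cst M 1"
  have cC: "c \<in> C" using n by (auto simp: c_def intro: cst_C)
  then have cc: "c \<in> carrier G" and iC: "inv c \<in> C"
    using C_carrier subgroup.m_inv_closed[OF C_subgroup] by auto
  have ne: "c \<otimes> c \<noteq> \<one>" using cst_square_ne_one[OF n] by (simp add: c_def)
  \<comment> \<open>A state consists of the newest element \<open>x\<close>, the set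
    \<open>X\<close> of earlier elements, and the commutator map \<open>F\<close> of
    \<open>x\<close> on what they generate.\<close>
  define P where "P = (\<lambda>(x, X, F). finite X \<and> X \<subseteq> carrier G \<and> chr (gn X) F \<and>
    x \<in> carrier G \<and> x \<notin> gn X \<and> (\<forall>y\<in>gn X. comm x y = F y))"
  \<comment> \<open>The next element keeps the old values on \<open>X\<close> and gets
    \<open>inv c\<close> on \<open>x\<close>. The inverse appears because the later element is the
    left argument of \<open>comm\<close>.\<close>
  define Q where "Q = (\<lambda>(x, X, F) (x' :: 'a, X', F'). X' = insert x X \<and> F' x = inv c \<and> (\<forall>y\<in>gn X. F' y = F y))"
  have "\<exists>s. P s"
  proof -
    have "chr (gn {}) (\<lambda>_. \<one>)" by (simp add: chr_def)
    then obtain x where "x \<in> carrier G" "x \<notin> gn ({} \<union> {})" "\<And>y. y \<in> gn {} \<Longrightarrow> comm x y = \<one>"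
      using ext_point[of "{}" "\<lambda>_. \<one>" "{}"] by blast
    then have "P (x, {}, \<lambda>_. \<one>)" using \<open>chr (gn {}) _\<close> by (simp add: P_def)
    then show ?thesis by blast
  qed
  moreover have "\<exists>s'. P s' \<and> Q s s'" if s: "P s" for s
  proof -
    obtain x X F where e: "s = (x, X, F)" by (cases s)
    have X: "finite X" "X \<subseteq> carrier G" and F: "chr (gn X) F" and x: "x \<in> carrier G" "x \<notin> gn X"
      using s by (auto simp: e P_def)
    obtain F' where F': "chr (adj (gn X) x) F'" "\<And>y. y \<in> gn X \<Longrightarrow> F' y = F y" "F' x = inv c"
      using chr_adj[OF sub_gn[OF X(2)] F x iC] by blast
    have X': "finite (insert x X)" "insert x X \<subseteq> carrier G" using X x by auto
    have ch: "chr (gn (insert x X)) F'" using F'(1) gn_insert[OF X(2) x(1)] by simp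
    obtain x' where "x' \<in> carrier G" "x' \<notin> gn (insert x X \<union> {})"
        "\<And>y. y \<in> gn (insert x X) \<Longrightarrow> comm x' y = F' y"
      using ext_point[OF X' ch, of "{}"] by blast
    then have "P (x', insert x X, F')" using X' ch by (simp add: P_def)
    then show ?thesis using F' by (intro exI[of _ "(x', insert x X, F')"]) (simp add: Q_def e)
  qed
  ultimately obtain st where st: "\<And>i. P (st i)" "\<And>i. Q (st i) (st (Suc i))"
    using dependent_nat_choice[of "\<lambda>_. P" "\<lambda>_. Q"] by metis
  define e where "e i = fst (st i)" for i
  define X where "X i = fst (snd (st i))" for i
  define F where "F i = snd (snd (st i))" for i
  have sti: "st i = (e i, X i, F i)" for i by (simp add: e_def X_def F_def)
  have ec: "e i \<in> carrier G" for i using st(1)[of i] by (simp add: sti P_def)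
  have "e i \<in> X j \<and> F j (e i) = inv c" if "i < j" for i j
    using that
  proof (induction j)
    case (Suc j)
    have q: "X (Suc j) = insert (e j) (X j)" "F (Suc j) (e j) = inv c" "\<And>y. y \<in> gn (X j) \<Longrightarrow> F (Suc j) y = F j y"
      using st(2)[of j] by (simp_all add: sti Q_def)
    show ?case
    proof (cases "i = j")
      case False
      then have "e i \<in> X j" "F j (e i) = inv c" using Suc by auto
      then show ?thesis using q(1,3) gen.base by (metis insertI2)
    qed (use q in simp)
  qed simp
  then have "comm (e j) (e i) = inv c" if "i < j" for i j
    using st(1)[of j] that gen.base[of "e i" "X j" L M] by (simp add: sti P_def)
  then have lt: "comm (e i) (e j) = c" if "i < j" for i j
    using comm_inv_swap[of "e j" "e i"] ec cc that by simp
  have gt: "comm (e i) (e j) \<noteq> c" if "j \<le> i" for i j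
  proof (cases "i = j")
    case True
    have "c \<noteq> \<one>" using ne by auto
    then show ?thesis using True comm_self[OF ec] by simp
  next
    case False
    then have "comm (e i) (e j) = inv c" using \<open>\<And>j i. i < j \<Longrightarrow> comm (e j) (e i) = inv c\<close> that by simp
    moreover have "inv c \<noteq> c" using ne cc r_inv by metis
    ultimately show ?thesis by simp
  qed
  have iff: "comm (e i) (e j) = c \<longleftrightarrow> i < j" for i j 
  proof
    show "i < j" if "comm (e i) (e j) = c" using gt[of j i] that by (cases "i < j") simp_all
  qed (rule lt)
  define \<phi> where "\<phi> = Eq (mulT (Var 0) (Var 1)) (mulT (cstT 1) (mulT (Var 1) (Var 0)))"
  have "\<phi> \<in> fms L (1 + 1)" using n by (auto simp: \<phi>_def fms_def)
  moreover have "holds M \<phi> ([e i] @ [e j]) \<longleftrightarrow> i < j" for i j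
  proof -
    have "holds M \<phi> ([e i] @ [e j]) \<longleftrightarrow> e i \<otimes> e j = c \<otimes> (e j \<otimes> e i)"
      by (simp add: \<phi>_def holds_def mult_eq c_def cst_def)
    also have "\<dots> \<longleftrightarrow> comm (e i) (e j) = c"
      using comm_unique[of "e i" "e j" c] comm_swap[of "e i" "e j"] ec cc by auto
    finally show ?thesis using iff by simp
  qed
  then have "order_property L M 1 1 \<phi>"
    unfolding order_property_def
    by (intro exI[of _ "\<lambda>i. [e i]"]) (use ec in \<open>auto simp: tuples_def carrier_eq\<close>)
  ultimately show ?thesis unfolding stable_def by blast
qed

end

section \<open>Transfer to the given monster model\<close>

lemma nil2_grp:
  assumes "in_G p n M" "prime p" "p > 2"
  shows "nil2 (grp M) p n M"
proof -
  have "group (grp M)" using assms(1) by (simp add: in_G_def Let_def)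
  then interpret group "grp M" .
  show ?thesis by unfold_locales (use assms in simp_all)
qed

theorem theorem5p1:
  fixes p n :: nat
    and D :: "(gsym, 'd) struct"
    and M :: "(gsym, 'a) struct"
    and \<kappa> :: "'k rel"
  assumes "prime p" and "p > 2" and "n \<ge> 1"
    and "fraisse_limit (Lg n) (K_class p n) D"
    and "monster (Lg n) (Th (Lg n) D) \<kappa> M"
  shows "(\<forall>A B C. small \<kappa> M A \<and> small \<kappa> M B \<and> small \<kappa> M C \<longrightarrow>
            (indep0 (Lg n) M A B C \<longleftrightarrow>
              (\<forall>a. set a \<subseteq> A \<longrightarrow>
                 \<not> forks (Lg n) M (length a) (tp (Lg n) M (B \<union> C) a) B)))
       \<and> (supersimple (Lg n) \<kappa> M \<and> SU_rank (Lg n) \<kappa> M = 1)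
       \<and> \<not> stable (Lg n) M"
proof -
  have p: "p > 0" using assms(2) by simp
  have stD: "is_struct (Lg n) D" using assms(4) by (simp add: fraisse_limit_def)
  have gD: "in_G p n D" by (rule in_G_fraisse_limit[OF assms(4) p])
  have M: "model (Lg n) (Th (Lg n) D) M" "Card_order \<kappa>" "natLeq <o \<kappa>" "saturated (Lg n) \<kappa> M"
    using assms(5) by (simp_all add: monster_def)
  have "valid M \<phi>" if "\<phi> \<in> G_axioms p n" for \<phi>
    using valid_transfer[OF stD M(1) wf_G_axioms[OF that]] that gD in_G_iff[OF p, of n D]
      valid_G_axioms_iff[OF stD, of p] by blast
  then have gM: "in_G p n M"
    using M(1) in_G_iff[OF p, of n M] valid_G_axioms_iff[of n M p] by (simp add: model_def)
  interpret D: nil2 "grp D" p n D by (rule nil2_grp[OF gD assms(1,2)])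
  interpret M: nil2 "grp M" p n M by (rule nil2_grp[OF gM assms(1,2)])
  \<comment> \<open>The formula \<open>ext_fm N\<close> is built from \<open>p\<close>,
    \<open>n\<close> and \<open>N\<close> alone, so it is the same formula in \<open>D\<close> and
    in \<open>M\<close>, and its validity transfers.\<close>
  have "valid M (M.ext_fm N)" for N
    using valid_transfer[OF stD M(1) D.wf_ext_fm] D.valid_ext_fm_iff
      D.extension_property_fraisse_limit[OF assms(4)] by blast
  then have "M.extension_property" using M.valid_ext_fm_iff by blast
  then interpret M: monster_group "grp M" p n M \<kappa>
    by unfold_locales (use M in simp_all)
  show ?thesis
    using M.indep0_iff_not_forks M.supersimple_M M.SU_rank_M M.not_stable_M[OF assms(3)] by blast
qed

end
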